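(* Let $S\in\mathcal{S}_{2,2}^0$, with its associated non-degenerate Miquel quartic $Q_S$, in coordinates $(x,y)$ in which $Q_S$ has an equation of the form $(x^2+y^2)^2+ax^2+by^2+c=0$. Let $N$ be an intersection point of $Q_S$ with the $x$-axis. Then the elliptic normalization of $Q_S$ has a group law with neutral element $N$ such that, for every circle passing through $N$, the three other points of intersection $X,Y,Z$ of this circle with $Q_S$ satisfy $X+Y+Z=0$. For this group law, the inverse is given by reflection through the $x$-axis, and the sum of two points $P_1$ and $P_2$ is obtained by taking the circle going through $P_1,P_2$ and $N$ and reflecting through the $x$-axis the fourth point of intersection $P_3$ of this circle with $Q_S$.
   Context: **Circle patterns.** A square grid circle pattern (SGCP) is a family of points $(S_{i,j})_{(i,j)\in\mathbb{Z}^2}$ of $\mathbb{R}^2$ such that for every $(i,j)$ the points $S_{i,j},S_{i+1,j},S_{i,j+1},S_{i+1,j+1}$ are pairwise distinct and lie on a common circle. $\mathcal{S}_{2,2}$ is the set of SGCPs for which there are non-collinear vectors $\vec u,\vec v\in\mathbb{R}^2$ with $S_{i+2,j}=S_{i,j}+\vec u$ and $S_{i,j+2}=S_{i,j}+\vec v$ for all $(i,j)$. Write $A=S_{0,0}$, $B=S_{1,0}$, $C=S_{2,0}$, $D=S_{0,1}$, $E=S_{1,1}$, $F=S_{2,1}$, $G=S_{0,2}$, $H=S_{1,2}$, $I=S_{2,2}$. $\Omega$ denotes the center of the parallelogram $ACIG$. **Classes.** $S$ is horizontal trapezoidal if each of the triples $\{A,B,C\},\{D,E,F\},\{G,H,I\}$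 is aligned, vertical trapezoidal if each of $\{A,D,G\},\{B,E,H\},\{C,F,I\}$ is aligned, and generic otherwise (every $S\in\mathcal{S}_{2,2}$ is of one of these types). **The curve $Q_S$, generic case.** Let $O_B$ (resp. $O_D$) be the center of the circle through $A,B,C$ (resp. $A,D,G$). Let $P$ be the intersection of the parallel to $(AG)$ through $O_B$ with the parallel to $(AC)$ through $O_D$, and $P'$ the image of $P$ under the point reflection in $\Omega$. If $\Omega A\ne\Omega C$, put $$\lambda=\frac{PA^2P'A^2-PC^2P'C^2}{\Omega A^2-\Omega C^2},\qquad k=\frac{\Omega A^2PC^2P'C^2-\Omega C^2PA^2P'A^2}{\Omega A^2-\Omega C^2},$$ and $Q_S=\{M\in\mathbb{R}^2: PM^2P'M^2-\lambda\,\Omega M^2=k\}$. Orthonormal coordinates $(x,y)$ are centered at $\Omega$ with $P$ on the $x$-axis. **The curve $Q_S$, horizontal trapezoidal case.** Take orthonormal coordinates centered at $\Omega$ with $x$-axis parallel to $(AC)$; $C=(x_C,y_C)$, $D=(x_D,y_E)$, $E=(x_E,y_E)$. With $\rho=x_C^2+y_C^2-x_E^2-y_E^2$, put $$\alpha=x_C^2+y_C^2+x_E^2+y_E^2+\frac{(x_D+x_C)^2\rho}{y_C^2-y_E^2},\quad \beta=x_C^2+y_C^2+x_E^2+y_E^2+\frac{(x_D+x_C)^2(x_E^2-x_C^2)\rho}{(y_C^2-y_E^2)^2},$$ $$\gamma=(x_C^2+y_C^2)(x_E^2+y_E^2)+\frac{(x_D+x_C)^2(x_E^2y_C^2-x_C^2y_E^2)\rho}{(y_C^2-y_E^2)^2}.$$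 $Q_S$ is the curve $(x^2+y^2)^2-\alpha x^2-\beta y^2+\gamma=0$. **Vertical trapezoidal case.** $Q_S$ (and the coordinates) are those of the transposed pattern $(S_{j,i})_{(i,j)}$, which is horizontal trapezoidal. In all cases $Q_S$ has, in these coordinates, an equation $(x^2+y^2)^2+ax^2+by^2+c=0$ with $a,b,c\in\mathbb{R}$ (a "Miquel quartic"). A complex projective quartic is non-degenerate binodal if it has two nodes and no other singularities. $\mathcal{S}_{2,2}^0\subset\mathcal{S}_{2,2}$ is the set of $S$ for which $Q_S$ is defined and its projective closure in $\mathbb{CP}^2$ is a non-degenerate binodal quartic; its nodes are then the circular points $(1:\pm i:0)$. Its normalization is an elliptic curve. By abuse of notation, $Q_S$ also denotes its complex projective closure, and points of the quartic and their lifts to the normalization are denoted by the same symbols. **Conventions.** Here "circle" means a complex conic through both circular points (degenerate conics included), the $x$-axis means the complex line $y=0$, and reflection through the $x$-axis is $(x,y)\mapsto(x,-y)$, lifted to the normalization. Intersections are counted with multiplicity on the normalization: the pullback of a conic through the circular points to the normalization is an effective divisor of degree $8$; removing the four preimages of the nodes (once each) leaves a divisor of degree $4$, and for a circle through $N$ one further removes $N$ once, leaving $[X]+[Y]+[Z]$. "The circle through $P_1,P_2,N$" means a circle whose residual degree-$4$ divisor contains $[P_1]+[P_2]+[N]$, and $P_3$ is the remaining point of this divisor. *)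

theory Defs
  imports
    "HOL-Analysis.Analysis"
    "HOL-Computational_Algebra.Formal_Power_Series"
    "HOL-Library.Multiset"
    "HOL-Algebra.Group"
begin

section \<open>Square grid circle patterns\<close>

type_synonym pattern = "int \<Rightarrow> int \<Rightarrow> real^2"

definition sgcp :: "pattern \<Rightarrow> bool" where
  "sgcp S \<longleftrightarrow> (\<forall>i j.
     distinct [S i j, S (i+1) j, S i (j+1), S (i+1) (j+1)] \<and>
     (\<exists>z r. {S i j, S (i+1) j, S i (j+1), S (i+1) (j+1)} \<subseteq> sphere z r))"

definition S22 :: "pattern set" where
  "S22 = {S. sgcp S \<and>
     (\<exists>u v. \<not> collinear {0, u, v} \<and>
        (\<forall>i j. S (i+2) j = S i j + u \<and> S i (j+2) = S i j + v))}"

definition horizontal_trapezoidal :: "pattern \<Rightarrow> bool" where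
  "horizontal_trapezoidal S \<longleftrightarrow>
     collinear {S 0 0, S 1 0, S 2 0} \<and> collinear {S 0 1, S 1 1, S 2 1} \<and>
     collinear {S 0 2, S 1 2, S 2 2}"

definition vertical_trapezoidal :: "pattern \<Rightarrow> bool" where
  "vertical_trapezoidal S \<longleftrightarrow>
     collinear {S 0 0, S 0 1, S 0 2} \<and> collinear {S 1 0, S 1 1, S 1 2} \<and>
     collinear {S 2 0, S 2 1, S 2 2}"

definition transposed :: "pattern \<Rightarrow> pattern" where
  "transposed S = (\<lambda>i j. S j i)"

definition Omega :: "pattern \<Rightarrow> real^2" where
  "Omega S = midpoint (S 0 0) (S 2 2)"


section \<open>The curve of a pattern\<close>

text \<open>
  The curve is represented by the function \<open>q\<close> on the plane such that \<open>q M = 0\<close> is its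
  defining equation (right-hand side moved to the left).  The following predicates are relational
  because the curve need not be defined, and because the trapezoidal formula uses a choice of
  axes.
\<close>

definition generic_equation :: "pattern \<Rightarrow> (real^2 \<Rightarrow> real) \<Rightarrow> bool" where
  "generic_equation S q \<longleftrightarrow>
     \<not> horizontal_trapezoidal S \<and> \<not> vertical_trapezoidal S \<and>
     (let A = S 0 0; B = S 1 0; C = S 2 0; D = S 0 1; G = S 0 2; W = Omega S in
        dist W A \<noteq> dist W C \<and>
        (\<exists>OB OD P P' lam k.
           dist OB A = dist OB B \<and> dist OB B = dist OB C \<and>
           dist OD A = dist OD D \<and> dist OD D = dist OD G \<and>
           (\<exists>s. P = OB + s *\<^sub>R (G - A)) \<and> (\<exists>t. P = OD + t *\<^sub>R (C - A)) \<and>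
           midpoint P P' = W \<and>
           lam = ((dist P A)\<^sup>2 * (dist P' A)\<^sup>2 - (dist P C)\<^sup>2 * (dist P' C)\<^sup>2)
                   / ((dist W A)\<^sup>2 - (dist W C)\<^sup>2) \<and>
           k = ((dist W A)\<^sup>2 * (dist P C)\<^sup>2 * (dist P' C)\<^sup>2
                  - (dist W C)\<^sup>2 * (dist P A)\<^sup>2 * (dist P' A)\<^sup>2)
                 / ((dist W A)\<^sup>2 - (dist W C)\<^sup>2) \<and>
           q = (\<lambda>M. (dist P M)\<^sup>2 * (dist P' M)\<^sup>2 - lam * (dist W M)\<^sup>2 - k)))"

definition orthonormal :: "real^2 \<Rightarrow> real^2 \<Rightarrow> bool" where
  "orthonormal e1 e2 \<longleftrightarrow> norm e1 = 1 \<and> norm e2 = 1 \<and> e1 \<bullet> e2 = 0"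

definition horizontal_equation :: "pattern \<Rightarrow> (real^2 \<Rightarrow> real) \<Rightarrow> bool" where
  "horizontal_equation S q \<longleftrightarrow>
     horizontal_trapezoidal S \<and>
     (\<exists>e1 e2. orthonormal e1 e2 \<and> (\<exists>s. S 2 0 - S 0 0 = s *\<^sub>R e1) \<and>
        (let x = (\<lambda>M. (M - Omega S) \<bullet> e1); y = (\<lambda>M. (M - Omega S) \<bullet> e2);
             xC = x (S 2 0); yC = y (S 2 0); xD = x (S 0 1); xE = x (S 1 1); yE = y (S 1 1);
             rho = xC\<^sup>2 + yC\<^sup>2 - xE\<^sup>2 - yE\<^sup>2;
             alpha = xC\<^sup>2 + yC\<^sup>2 + xE\<^sup>2 + yE\<^sup>2 + (xD + xC)\<^sup>2 * rho / (yC\<^sup>2 - yE\<^sup>2);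
             beta = xC\<^sup>2 + yC\<^sup>2 + xE\<^sup>2 + yE\<^sup>2
                      + (xD + xC)\<^sup>2 * (xE\<^sup>2 - xC\<^sup>2) * rho / (yC\<^sup>2 - yE\<^sup>2)\<^sup>2;
             gamma = (xC\<^sup>2 + yC\<^sup>2) * (xE\<^sup>2 + yE\<^sup>2)
                      + (xD + xC)\<^sup>2 * (xE\<^sup>2 * yC\<^sup>2 - xC\<^sup>2 * yE\<^sup>2) * rho / (yC\<^sup>2 - yE\<^sup>2)\<^sup>2
         in yC\<^sup>2 \<noteq> yE\<^sup>2 \<and>
            q = (\<lambda>M. ((x M)\<^sup>2 + (y M)\<^sup>2)\<^sup>2 - alpha * (x M)\<^sup>2 - beta * (y M)\<^sup>2 + gamma)))"

definition Q_equation :: "pattern \<Rightarrow> (real^2 \<Rightarrow> real) \<Rightarrow> bool" where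
  "Q_equation S q \<longleftrightarrow>
     generic_equation S q \<or> horizontal_equation S q \<or> horizontal_equation (transposed S) q"

text \<open>
  In the orthonormal coordinates with origin \<open>p\<close> and axes \<open>e1\<close>, \<open>e2\<close>, the equation \<open>q = 0\<close>
  reads \<open>(x\<^sup>2 + y\<^sup>2)\<^sup>2 + a x\<^sup>2 + b y\<^sup>2 + c = 0\<close>.
\<close>

definition miquel_coordinates ::
  "(real^2 \<Rightarrow> real) \<Rightarrow> real^2 \<Rightarrow> real^2 \<Rightarrow> real^2 \<Rightarrow> real \<Rightarrow> real \<Rightarrow> real \<Rightarrow> bool" where
  "miquel_coordinates q p e1 e2 a b c \<longleftrightarrow> orthonormal e1 e2 \<and>
     (\<forall>x y. q (p + x *\<^sub>R e1 + y *\<^sub>R e2) = (x\<^sup>2 + y\<^sup>2)\<^sup>2 + a * x\<^sup>2 + b * y\<^sup>2 + c)"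


section \<open>Complex projective quartics\<close>

text \<open>
  Points of the complex projective plane are nonzero vectors of homogeneous coordinates
  \<open>(X, Y, Z)\<close> up to scaling; the affine plane is \<open>Z = 1\<close>.
\<close>

definition same_point :: "complex^3 \<Rightarrow> complex^3 \<Rightarrow> bool" where
  "same_point p r \<longleftrightarrow> (\<exists>k. k \<noteq> 0 \<and> r = k *s p)"

definition singular_point :: "(complex^3 \<Rightarrow> complex) \<Rightarrow> complex^3 \<Rightarrow> bool" where
  "singular_point F p \<longleftrightarrow> p \<noteq> 0 \<and> F p = 0 \<and> (F has_derivative (\<lambda>_. 0)) (at p)"

text \<open>
  A node is a double point whose tangent cone consists of two distinct lines: the lowest order
  part of \<open>h \<mapsto> F (p + h)\<close> at \<open>0\<close> is a product of two non-proportional linear forms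
  with coefficient vectors \<open>l\<close> and \<open>m\<close>.
\<close>

definition node :: "(complex^3 \<Rightarrow> complex) \<Rightarrow> complex^3 \<Rightarrow> bool" where
  "node F p \<longleftrightarrow> singular_point F p \<and>
     (\<exists>l m. l \<noteq> 0 \<and> m \<noteq> 0 \<and> \<not> same_point l m \<and>
        (\<forall>h. ((\<lambda>t. F (p + t *s h) / t\<^sup>2) \<longlongrightarrow> (\<Sum>i\<in>UNIV. l$i * h$i) * (\<Sum>i\<in>UNIV. m$i * h$i)) (at 0)))"

definition nondegenerate_binodal :: "(complex^3 \<Rightarrow> complex) \<Rightarrow> bool" where
  "nondegenerate_binodal F \<longleftrightarrow>
     (\<exists>p1 p2. node F p1 \<and> node F p2 \<and> \<not> same_point p1 p2 \<and>
        (\<forall>p. singular_point F p \<longrightarrow> same_point p1 p \<or> same_point p2 p))"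

definition miquel_form :: "'a \<Rightarrow> 'a \<Rightarrow> 'a \<Rightarrow> 'a^3 \<Rightarrow> 'a::comm_ring_1" where
  "miquel_form a b c v =
     ((v$1)\<^sup>2 + (v$2)\<^sup>2)\<^sup>2 + a * (v$1)\<^sup>2 * (v$3)\<^sup>2 + b * (v$2)\<^sup>2 * (v$3)\<^sup>2 + c * (v$3)^4"

definition quartic :: "real \<Rightarrow> real \<Rightarrow> real \<Rightarrow> complex^3 \<Rightarrow> complex" where
  "quartic a b c = miquel_form (of_real a) (of_real b) (of_real c)"

definition S22_0 :: "pattern set" where
  "S22_0 = {S \<in> S22. \<exists>q p e1 e2 a b c.
     Q_equation S q \<and> miquel_coordinates q p e1 e2 a b c \<and> nondegenerate_binodal (quartic a b c)}"


section \<open>The normalization\<close>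

text \<open>
  The points of the normalization are the places of the quartic: classes of irreducible formal
  parametrizations \<open>t \<mapsto> (X(t) : Y(t) : Z(t))\<close>, up to a unit factor and an invertible change of the
  parameter \<open>t\<close>.  Here \<open>\<phi>\<close> is irreducible if it is not obtained from another parametrization
  by a substitution \<open>t \<mapsto> \<sigma>(t)\<close> with \<open>\<sigma>(0) = \<sigma>'(0) = 0\<close>; taking \<open>\<sigma> = 0\<close> shows
  that constant parametrizations are excluded.
\<close>

definition substituted :: "complex fps \<Rightarrow> complex fps \<Rightarrow> (complex fps)^3 \<Rightarrow> (complex fps)^3" where
  "substituted u \<sigma> \<phi> = u *s (\<chi> i. fps_compose (\<phi>$i) \<sigma>)"

definition center :: "(complex fps)^3 \<Rightarrow> complex^3" where
  "center \<phi> = (\<chi> i. fps_nth (\<phi>$i) 0)"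

definition parametrization :: "real \<Rightarrow> real \<Rightarrow> real \<Rightarrow> (complex fps)^3 \<Rightarrow> bool" where
  "parametrization a b c \<phi> \<longleftrightarrow>
     center \<phi> \<noteq> 0 \<and>
     miquel_form (fps_const (of_real a)) (fps_const (of_real b)) (fps_const (of_real c)) \<phi> = 0 \<and>
     \<not> (\<exists>\<psi> u \<sigma>. fps_nth \<sigma> 0 = 0 \<and> fps_nth \<sigma> 1 = 0 \<and> \<phi> = substituted u \<sigma> \<psi>)"

definition reparametrization :: "(complex fps)^3 \<Rightarrow> (complex fps)^3 \<Rightarrow> bool" where
  "reparametrization \<phi> \<psi> \<longleftrightarrow>
     (\<exists>u \<sigma>. fps_nth u 0 \<noteq> 0 \<and> fps_nth \<sigma> 0 = 0 \<and> fps_nth \<sigma> 1 \<noteq> 0 \<and> \<psi> = substituted u \<sigma> \<phi>)"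

type_synonym place = "((complex fps)^3) set"

definition normalization :: "real \<Rightarrow> real \<Rightarrow> real \<Rightarrow> place set" where
  "normalization a b c =
     Collect (parametrization a b c) //
       {(\<phi>, \<psi>). parametrization a b c \<phi> \<and> parametrization a b c \<psi> \<and> reparametrization \<phi> \<psi>}"

definition representative :: "place \<Rightarrow> (complex fps)^3" where
  "representative P = (SOME \<phi>. \<phi> \<in> P)"

definition on_x_axis :: "place \<Rightarrow> bool" where
  "on_x_axis P \<longleftrightarrow> center (representative P) $ 2 = 0"

definition reflection :: "place \<Rightarrow> place" where
  "reflection P = (\<lambda>\<phi>. vector [\<phi>$1, - \<phi>$2, \<phi>$3]) ` P"


section \<open>Circles and their residual divisors\<close>

text \<open>A conic is given by the symmetric matrix of its quadratic form.\<close>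

definition conic_form :: "'a^3^3 \<Rightarrow> 'a^3 \<Rightarrow> 'a::comm_ring_1" where
  "conic_form K v = (\<Sum>i\<in>UNIV. \<Sum>j\<in>UNIV. K$i$j * v$i * v$j)"

definition complex_circle :: "complex^3^3 \<Rightarrow> bool" where
  "complex_circle K \<longleftrightarrow> K \<noteq> 0 \<and> transpose K = K \<and>
     conic_form K (vector [1, \<i>, 0]) = 0 \<and> conic_form K (vector [1, - \<i>, 0]) = 0"

text \<open>
  The multiplicity of a place in the pullback of a conic is the order of vanishing of the
  quadratic form along the place.  (It would be infinite for a conic containing the quartic, in
  which case the value below is \<open>0\<close>; a non-degenerate binodal quartic is irreducible, so this does
  not happen.)
\<close>

definition pullback_multiplicity :: "complex^3^3 \<Rightarrow> place \<Rightarrow> nat" where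
  "pullback_multiplicity K P = subdegree (conic_form (\<chi> i j. fps_const (K$i$j)) (representative P))"

definition residual_divisor :: "real \<Rightarrow> real \<Rightarrow> real \<Rightarrow> complex^3^3 \<Rightarrow> place \<Rightarrow> int" where
  "residual_divisor a b c K P = int (pullback_multiplicity K P)
     - (if node (quartic a b c) (center (representative P)) then 1 else 0)"

definition has_residual :: "real \<Rightarrow> real \<Rightarrow> real \<Rightarrow> complex^3^3 \<Rightarrow> place multiset \<Rightarrow> bool" where
  "has_residual a b c K D \<longleftrightarrow> set_mset D \<subseteq> normalization a b c \<and>
     (\<forall>P \<in> normalization a b c. residual_divisor a b c K P = int (count D P))"

end

theory Submission
  imports Defs "HOL-Computational_Algebra.Fundamental_Theorem_Algebra"
begin

text \<open>
  Inversion about \<open>N\<close> turns the quartic into a plane cubic \<open>y\<^sup>2 = g(u)\<close> with \<open>N\<close> at infinity, and the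
  circles through \<open>N\<close> into lines; reflection becomes \<open>y \<mapsto> -y\<close>.  The group law on the cubic comes from
  divisors of functions \<open>A(u) + B(u) y\<close>: three points add up to \<open>0\<close> iff their affine parts form the
  divisor of such a function.  Associativity follows since divisors add under multiplication, pairs
  \<open>P, -P\<close> can be cancelled, and a degree count on the norm \<open>A\<^sup>2 - B\<^sup>2 g\<close> shows that a divisor with at
  most two points is empty or such a pair.  Non-degeneracy of the quartic amounts to
  \<open>a \<noteq> b\<close>, \<open>c \<noteq> 0\<close>, \<open>a\<^sup>2 \<noteq> 4 c\<close>, \<open>b\<^sup>2 \<noteq> 4 c\<close>, which makes \<open>g\<close> a separable cubic.
\<close>

section \<open>Power series solutions of \<open>y\<^sup>2 = g(u)\<close>\<close>

text \<open>Why the inversion gives a cubic: the conics through both circular points are spanned by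
  \<open>U\<close>, \<open>V\<close>, \<open>Y Z\<close> and \<open>Z\<^sup>2\<close>, and these
  four forms map the normalization to an intersection of two quadrics in projective 3-space, the
  equations \<open>chart_eqs\<close>. There the nodes are resolved and N becomes (0 : 0 : 0 : 1).
  Circles are hyperplane sections, and projection from N gives the plane cubic, in which the
  sections through N become lines. Two obstacles shape the rest. Points of the normalization are
  classes of formal parametrizations, so they must be matched one by one with points of the cubic;
  for this each point gets a power series solution through which every other solution factors.
  Moreover \<open>S22_0\<close> asserts non-degeneracy for some equation and some frame of the
  pattern, whereas the theorem receives arbitrary ones. Hence the equation has to be shown unique,
  and the coefficients determined up to exchanging \<open>a\<close> and \<open>b\<close>.\<close>

definition fps_eval :: "'a::comm_ring_1 poly \<Rightarrow> 'a fps \<Rightarrow> 'a fps" where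
  "fps_eval p u = poly (map_poly fps_const p) u"

lemma fps_eval_0 [simp]: "fps_eval 0 u = 0"
  by (simp add: fps_eval_def)

lemma fps_eval_pCons [simp]: "fps_eval (pCons c p) u = fps_const c + u * fps_eval p u"
  by (simp add: fps_eval_def map_poly_pCons)

lemma fps_eval_add [simp]: "fps_eval (p + q) u = fps_eval p u + fps_eval q u"
  by (induction p q rule: poly_induct2) (simp_all add: algebra_simps flip: fps_const_add)

lemma fps_eval_smult [simp]: "fps_eval (smult c p) u = fps_const c * fps_eval p u"
  by (induction p) (simp_all add: algebra_simps flip: fps_const_mult)

lemma fps_eval_minus [simp]: "fps_eval (- p) u = - fps_eval p u"
  by (induction p) (simp_all add: algebra_simps flip: fps_const_neg)

lemma fps_eval_diff [simp]: "fps_eval (p - q) u = fps_eval p u - fps_eval q u"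
  using fps_eval_add[of p "- q" u] by simp

lemma fps_eval_mult [simp]: "fps_eval (p * q) u = fps_eval p u * fps_eval q u"
  by (induction p) (simp_all add: algebra_simps)

lemma fps_eval_1 [simp]: "fps_eval 1 u = 1"
  by (simp add: one_pCons)

lemma fps_eval_power [simp]: "fps_eval (p ^ n) u = fps_eval p u ^ n"
  by (induction n) simp_all

lemma fps_eval_nth_0 [simp]: "fps_nth (fps_eval p u) 0 = poly p (fps_nth u 0)"
  by (induction p) simp_all

lemma fps_eval_nth_1: "fps_nth (fps_eval p u) 1 = poly (pderiv p) (fps_nth u 0) * fps_nth u 1"
  by (induction p) (simp_all add: pderiv_pCons fps_mult_nth_1 algebra_simps)

lemma fps_eval_compose:
  fixes u \<sigma> :: "'a::field fps"
  assumes "fps_nth \<sigma> 0 = 0"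
  shows "fps_eval p u oo \<sigma> = fps_eval p (u oo \<sigma>)"
  by (induction p) (simp_all add: fps_compose_add_distrib fps_compose_mult_distrib[OF assms])

lemma subdegree_compose:
  fixes f \<sigma> :: "'a::field fps"
  assumes "fps_nth \<sigma> 0 = 0"
  shows "subdegree (f oo \<sigma>) = subdegree f * subdegree \<sigma>"
proof (cases "f = 0 \<or> \<sigma> = 0")
  case True
  then show ?thesis by (auto simp: fps_compose_0_right)
next
  case False
  define d h where "d = subdegree f" and "h = fps_shift (subdegree f) f"
  have f: "f = h * fps_X ^ d"
    unfolding d_def h_def by (rule subdegree_decompose)
  have h0: "fps_nth h 0 \<noteq> 0" and d: "subdegree f = d"
    using False by (simp_all add: d_def h_def)
  have "f oo \<sigma> = (h oo \<sigma>) * \<sigma> ^ d"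
    unfolding f using assms by (simp add: fps_compose_mult_distrib fps_X_power_compose)
  moreover have "subdegree (h oo \<sigma>) = 0" "h oo \<sigma> \<noteq> 0"
    using h0 by (metis fps_compose_nth_0 subdegree_eq_0, metis fps_compose_nth_0 fps_zero_nth)
  ultimately show ?thesis
    using False by (simp add: d)
qed

lemma subdegree_eq_1I: "fps_nth f 0 = 0 \<Longrightarrow> fps_nth f 1 \<noteq> 0 \<Longrightarrow> subdegree f = 1"
  by (rule subdegreeI) auto

text \<open>Splitting off the exact power of the linear factor at the constant term of
  \<open>u\<close> leaves a cofactor that evaluates to a unit.\<close>

lemma subdegree_fps_eval:
  fixes u :: "'a::field fps"
  assumes "p \<noteq> 0" "u \<noteq> fps_const (fps_nth u 0)"
  shows "fps_eval p u \<noteq> 0"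
    and "subdegree (fps_eval p u) = order (fps_nth u 0) p * subdegree (u - fps_const (fps_nth u 0))"
proof -
  let ?a = "fps_nth u 0"
  obtain q where q: "p = [:- ?a, 1:] ^ order ?a p * q" "\<not> [:- ?a, 1:] dvd q"
    using order_decomp[OF assms(1)] by blast
  have q0: "fps_nth (fps_eval q u) 0 \<noteq> 0"
    using q(2) by (simp add: poly_eq_0_iff_dvd)
  have e: "fps_eval p u = (u - fps_const ?a) ^ order ?a p * fps_eval q u"
    by (subst q(1)) (simp add: diff_conv_add_uminus add.commute del: add_uminus_conv_diff flip: fps_const_neg)
  have ne: "u - fps_const ?a \<noteq> 0" "fps_eval q u \<noteq> 0" using assms(2) q0 by (auto simp del: fps_eval_nth_0)
  show "fps_eval p u \<noteq> 0" using ne by (simp add: e)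
  show "subdegree (fps_eval p u) = order ?a p * subdegree (u - fps_const ?a)"
    using ne q0 by (simp add: e subdegree_eq_0)
qed

section \<open>Universal local parameters\<close>

text \<open>The last clause is a universal property: every formal solution through \<open>P\<close>,
  however degenerate, is a substitution into \<open>(u, y)\<close>. It later turns any
  parametrization of the quartic into a reparametrization of a fixed one.\<close>

definition local_parameter ::
    "complex poly \<Rightarrow> complex \<times> complex \<Rightarrow> complex fps \<Rightarrow> complex fps \<Rightarrow> bool" where
  "local_parameter g P u y \<longleftrightarrow> fps_nth u 0 = fst P \<and> fps_nth y 0 = snd P \<and> y\<^sup>2 = fps_eval g u \<and>
     (if snd P = 0 then fps_nth y 1 \<noteq> 0 else fps_nth u 1 \<noteq> 0) \<and>
     (\<forall>u' y'. fps_nth u' 0 = fst P \<longrightarrow> fps_nth y' 0 = snd P \<longrightarrow> y'\<^sup>2 = fps_eval g u' \<longrightarrow>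
        (\<exists>\<sigma>. fps_nth \<sigma> 0 = 0 \<and> u' = u oo \<sigma> \<and> y' = y oo \<sigma>))"

text \<open>Where \<open>y\<close> is nonzero, the shifted \<open>u\<close> is the parameter and
  \<open>y\<close> a square root series. Where \<open>y\<close> vanishes, \<open>y\<close> is the
  parameter and \<open>u\<close> comes from inverting \<open>g\<close> near a simple root.\<close>

lemma local_parameter_exists:
  assumes curve: "(snd P)\<^sup>2 = poly g (fst P)"
    and smooth: "snd P \<noteq> 0 \<or> poly (pderiv g) (fst P) \<noteq> 0"
  shows "\<exists>u y. local_parameter g P u y"
proof (cases "snd P = 0")
  case False
  define u :: "complex fps" where "u = fps_const (fst P) + fps_X"
  \<comment> \<open>The first argument of \<open>fps_radical\<close> prescribes the root of the
    constant term and so selects the branch through \<open>P\<close>.\<close>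
  define y where "y = fps_radical (\<lambda>_ _. snd P) 2 (fps_eval g u)"
  have u: "fps_nth u 0 = fst P" "fps_nth u 1 = 1" by (simp_all add: u_def)
  have y0: "fps_nth y 0 = snd P" by (simp add: y_def)
  have y2: "y\<^sup>2 = fps_eval g u"
  proof -
    have "fps_nth (fps_eval g u) 0 \<noteq> 0" using False curve u(1) by (metis fps_eval_nth_0 power_not_zero)
    then show ?thesis
      using power_radical[of "fps_eval g u" "\<lambda>_ _. snd P" 1] curve u(1)
      by (simp add: y_def flip: numeral_2_eq_2)
  qed
  have "\<exists>\<sigma>. fps_nth \<sigma> 0 = 0 \<and> u' = u oo \<sigma> \<and> y' = y oo \<sigma>"
    if h: "fps_nth u' 0 = fst P" "fps_nth y' 0 = snd P" "y'\<^sup>2 = fps_eval g u'" for u' y'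
  proof -
    define \<sigma> where "\<sigma> = u' - fps_const (fst P)"
    have s0: "fps_nth \<sigma> 0 = 0" by (simp add: \<sigma>_def h)
    have us: "u' = u oo \<sigma>"
      using s0 by (simp add: u_def fps_compose_add_distrib fps_X_fps_compose_startby0) (simp add: \<sigma>_def)
    have "(y oo \<sigma>)\<^sup>2 = y'\<^sup>2"
      using h(3) us s0 y2 by (simp add: fps_compose_power fps_eval_compose)
    moreover have "y' \<noteq> - (y oo \<sigma>)"
      using h(2) y0 False by auto
    ultimately have "y' = y oo \<sigma>"
      by (metis power2_eq_iff)
    with s0 us show ?thesis by blast
  qed
  then show ?thesis
    unfolding local_parameter_def using False u y0 y2 by (intro exI[of _ u] exI[of _ y]) auto
next
  case True
  \<comment> \<open>\<open>G\<close> is \<open>g\<close> recentred at its simple root. With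
    parameter t = y, the equation G(s) = t^2 is solved by s = H(t^2).\<close>
  define G where "G = fps_eval g (fps_const (fst P) + fps_X)"
  define H where "H = fps_inv G"
  define u where "u = fps_const (fst P) + (H oo fps_X\<^sup>2)"
  have G0: "fps_nth G 0 = 0" using curve True by (simp add: G_def)
  have G1: "fps_nth G 1 \<noteq> 0" using smooth True by (simp add: G_def fps_eval_nth_1[unfolded One_nat_def])
  have H0: "fps_nth H 0 = 0" by (simp add: H_def fps_inv_def)
  have HG: "H oo G = fps_X" unfolding H_def by (rule fps_inv[OF G0 G1])
  have GH: "G oo H = fps_X" unfolding H_def by (rule fps_inv_right[OF G0 G1])
  have X0: "fps_nth ((fps_X::complex fps)\<^sup>2) 0 = 0" by simp
  have ev: "fps_eval g (fps_const (fst P) + s) = G oo s" if "fps_nth s 0 = 0" for s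
    unfolding G_def by (simp add: fps_eval_compose[OF that] fps_compose_add_distrib
        fps_X_fps_compose_startby0 that)
  have u0: "fps_nth u 0 = fst P" by (simp add: u_def H0)
  have y2: "fps_X\<^sup>2 = fps_eval g u"
    unfolding u_def by (subst ev) (simp_all add: H0 fps_compose_assoc[OF X0 H0] GH fps_X_fps_compose_startby0)
  have "\<exists>\<sigma>. fps_nth \<sigma> 0 = 0 \<and> u' = u oo \<sigma> \<and> y' = fps_X oo \<sigma>"
    if h: "fps_nth u' 0 = fst P" "fps_nth y' 0 = snd P" "y'\<^sup>2 = fps_eval g u'" for u' y'
  proof -
    have y0: "fps_nth y' 0 = 0" using h True by simp
    define s where "s = u' - fps_const (fst P)"
    have s0: "fps_nth s 0 = 0" by (simp add: s_def h)
    have "y'\<^sup>2 = G oo s" using ev[OF s0] h(3) by (simp add: s_def)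
    then have "H oo y'\<^sup>2 = (H oo G) oo s"
      using fps_compose_assoc[OF s0 G0] by simp
    also have "\<dots> = s" by (simp add: HG fps_X_fps_compose_startby0 s0)
    finally have "H oo y'\<^sup>2 = s" .
    moreover have "(H oo fps_X\<^sup>2) oo y' = H oo y'\<^sup>2"
      using fps_compose_assoc[OF y0 X0, of H] fps_X_power_compose[OF y0, of 2] by simp
    ultimately have "u' = u oo y'" by (simp add: u_def fps_compose_add_distrib) (simp add: s_def)
    with y0 show ?thesis by (intro exI[of _ y']) (simp add: fps_X_fps_compose_startby0)
  qed
  then show ?thesis
    unfolding local_parameter_def using True u0 y2 by (intro exI[of _ u] exI[of _ fps_X]) auto
qed

text \<open>At a branch point \<open>y\<^sup>2\<close> has order 2 and \<open>g\<close> a simple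
  root, so comparing orders in \<open>y\<^sup>2 = g(u)\<close> gives order 2 for
  \<open>u\<close>.\<close>

lemma local_parameter_subdegree:
  assumes "local_parameter g P u y" "poly g (fst P) = 0 \<Longrightarrow> poly (pderiv g) (fst P) \<noteq> 0"
  shows "subdegree (u - fps_const (fst P)) = (if snd P = 0 then 2 else 1)"
proof (cases "snd P = 0")
  case False
  then have "fps_nth (u - fps_const (fst P)) 0 = 0" "fps_nth (u - fps_const (fst P)) 1 \<noteq> 0"
    using assms(1) by (auto simp: local_parameter_def)
  then show ?thesis using False by (simp add: subdegree_eq_1I del: One_nat_def)
next
  case True
  have u0: "fps_nth u 0 = fst P" and y2: "y\<^sup>2 = fps_eval g u" and y: "fps_nth y 0 = 0" "fps_nth y 1 \<noteq> 0"
    using assms(1) True by (auto simp: local_parameter_def)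
  have g0: "poly g (fst P) = 0"
    using arg_cong[OF y2, of "\<lambda>f. fps_nth f 0"] y u0 by (simp add: power2_eq_square)
  have "g \<noteq> 0" using assms(2) g0 by auto
  have "u \<noteq> fps_const (fst P)"
  proof
    assume "u = fps_const (fst P)"
    then have "fps_eval g u = fps_const (poly g (fst P))"
      by (induction g) simp_all
    then show False using y2 g0 y by auto
  qed
  then have "subdegree (fps_eval g u) = order (fst P) g * subdegree (u - fps_const (fst P))"
    using subdegree_fps_eval(2)[OF \<open>g \<noteq> 0\<close>, of u] u0 by auto
  moreover have "subdegree (y\<^sup>2) = 2"
    using subdegree_eq_1I[OF y] y by auto
  moreover have "order (fst P) g = 1"
    using order_pderiv[OF \<open>g \<noteq> 0\<close> g0] order_0I[OF assms(2)[OF g0]] by simp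
  ultimately show ?thesis using y2 True by simp
qed

section \<open>The group law on \<open>y\<^sup>2 = g(u)\<close>\<close>

locale separable_cubic =
  fixes g :: "complex poly"
  assumes degree_g: "degree g = 3"
    and separable: "poly g x = 0 \<Longrightarrow> poly (pderiv g) x \<noteq> 0"
begin

definition curve :: "(complex \<times> complex) set" where
  "curve = {P. (snd P)\<^sup>2 = poly g (fst P)}"

definition neg :: "complex \<times> complex \<Rightarrow> complex \<times> complex" where
  "neg P = (fst P, - snd P)"

definition param :: "complex \<times> complex \<Rightarrow> complex fps \<times> complex fps" where
  "param P = (SOME uy. local_parameter g P (fst uy) (snd uy))"

definition expansion :: "complex \<times> complex \<Rightarrow> complex poly \<Rightarrow> complex poly \<Rightarrow> complex fps" where
  "expansion P A B = fps_eval A (fst (param P)) + fps_eval B (fst (param P)) * snd (param P)"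

definition ord :: "complex \<times> complex \<Rightarrow> complex poly \<Rightarrow> complex poly \<Rightarrow> nat" where
  "ord P A B = subdegree (expansion P A B)"

definition Norm :: "complex poly \<Rightarrow> complex poly \<Rightarrow> complex poly" where
  "Norm A B = A\<^sup>2 - B\<^sup>2 * g"

text \<open>The ramification index over the u-line. The value 0 off the curve lets the counting
  formulas for fibres hold for every pair of numbers.\<close>

definition ram :: "complex \<times> complex \<Rightarrow> nat" where
  "ram P = (if P \<in> curve then if snd P = 0 then 2 else 1 else 0)"

lemma neg_neg [simp]: "neg (neg P) = P"
  by (simp add: neg_def)

lemma neg_curve [simp]: "neg P \<in> curve \<longleftrightarrow> P \<in> curve"
  by (simp add: neg_def curve_def)

lemma fst_neg [simp]: "fst (neg P) = fst P"
  by (simp add: neg_def)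

lemma g_nonzero: "g \<noteq> 0"
  using degree_g by auto

lemma param:
  assumes "P \<in> curve"
  shows "local_parameter g P (fst (param P)) (snd (param P))"
proof -
  have "\<exists>uy. local_parameter g P (fst uy) (snd uy)"
    using local_parameter_exists[of P g] assms separable by (fastforce simp: curve_def)
  then show ?thesis unfolding param_def by (rule someI_ex)
qed

lemma param_simps:
  assumes "P \<in> curve"
  shows "fps_nth (fst (param P)) 0 = fst P" "fps_nth (snd (param P)) 0 = snd P"
    "(snd (param P))\<^sup>2 = fps_eval g (fst (param P))"
    "snd P = 0 \<Longrightarrow> fps_nth (snd (param P)) 1 \<noteq> 0"
    "snd P \<noteq> 0 \<Longrightarrow> fps_nth (fst (param P)) 1 \<noteq> 0"
  using param[OF assms] unfolding local_parameter_def by presburger+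

lemma param_nth_1:
  assumes "P \<in> curve"
  shows "2 * snd P * fps_nth (snd (param P)) 1 = poly (pderiv g) (fst P) * fps_nth (fst (param P)) 1"
  using arg_cong[OF param_simps(3)[OF assms], of "\<lambda>f. fps_nth f 1"] param_simps(1,2)[OF assms]
  by (simp only: fps_eval_nth_1 power2_eq_square fps_mult_nth_1) (simp add: algebra_simps)

lemma param_ramified:
  assumes "P \<in> curve" "snd P = 0"
  shows "fps_nth (fst (param P)) 1 = 0"
  using param_nth_1[OF assms(1)] separable[of "fst P"] assms by (simp add: curve_def)

lemma subdegree_param:
  assumes "P \<in> curve"
  shows "subdegree (fst (param P) - fps_const (fst P)) = ram P"
  using local_parameter_subdegree[OF param[OF assms]] separable assms by (auto simp: ram_def)

lemma fps_eval_param: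
  assumes "P \<in> curve" "p \<noteq> 0"
  shows "fps_eval p (fst (param P)) \<noteq> 0"
    and "subdegree (fps_eval p (fst (param P))) = ram P * order (fst P) p"
proof -
  have *: "fst (param P) \<noteq> fps_const (fst P)"
    using subdegree_param[OF assms(1)] assms(1) by (auto simp: ram_def split: if_splits)
  show "fps_eval p (fst (param P)) \<noteq> 0"
    using subdegree_fps_eval(1)[OF assms(2)] * param_simps(1)[OF assms(1)] by metis
  show "subdegree (fps_eval p (fst (param P))) = ram P * order (fst P) p"
    using subdegree_fps_eval(2)[OF assms(2), of "fst (param P)"] * param_simps(1)[OF assms(1)]
      subdegree_param[OF assms(1)] by simp
qed

lemma expansion_conj:
  assumes "P \<in> curve"
  shows "expansion P A B * expansion P A (- B) = fps_eval (Norm A B) (fst (param P))"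
  using param_simps(3)[OF assms]
  by (simp add: expansion_def Norm_def power2_eq_square algebra_simps)

text \<open>Leading terms cannot cancel, since \<open>2 * degree A\<close> and
  \<open>2 * degree B + 3\<close> have different parity. The maximum is the pole order of
  \<open>A(u) + B(u) y\<close> at infinity, where \<open>u\<close> has order 2 and \<open>y\<close>
  order 3.\<close>

lemma degree_Norm:
  assumes "A \<noteq> 0 \<or> B \<noteq> 0"
  shows "Norm A B \<noteq> 0"
    and "degree (Norm A B) = max (2 * degree A) (if B = 0 then 0 else 2 * degree B + 3)"
proof -
  have *: "Norm A B \<noteq> 0 \<and>
    degree (Norm A B) = max (2 * degree A) (if B = 0 then 0 else 2 * degree B + 3)"
  proof (cases "B = 0")
    case True
    then show ?thesis using assms by (simp add: Norm_def degree_power_eq)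
  next
    case False
    have dB: "degree (B\<^sup>2 * g) = 2 * degree B + 3"
      using False g_nonzero by (simp add: degree_mult_eq degree_power_eq degree_g)
    have dA: "degree (A\<^sup>2) = 2 * degree A"
      by (cases "A = 0") (simp_all add: degree_power_eq)
    have "2 * degree A \<noteq> 2 * degree B + 3" by presburger
    then consider "degree (A\<^sup>2) < degree (- (B\<^sup>2 * g))" | "degree (- (B\<^sup>2 * g)) < degree (A\<^sup>2)"
      unfolding degree_minus dA dB by linarith
    then have "degree (A\<^sup>2 + - (B\<^sup>2 * g)) = max (2 * degree A) (2 * degree B + 3)"
      by cases (simp_all add: degree_add_eq_left degree_add_eq_right dA dB del: add_uminus_conv_diff)
    then show ?thesis using False by (auto simp: Norm_def max_def split: if_splits)
  qed
  then show "Norm A B \<noteq> 0"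
    "degree (Norm A B) = max (2 * degree A) (if B = 0 then 0 else 2 * degree B + 3)" by auto
qed

lemma expansion_nonzero:
  assumes "P \<in> curve" "A \<noteq> 0 \<or> B \<noteq> 0"
  shows "expansion P A B \<noteq> 0"
  using expansion_conj[OF assms(1), of A B] fps_eval_param(1)[OF assms(1) degree_Norm(1)[OF assms(2)]]
  by auto

lemma ord_pos_iff:
  assumes "P \<in> curve" "A \<noteq> 0 \<or> B \<noteq> 0"
  shows "ord P A B > 0 \<longleftrightarrow> poly A (fst P) + poly B (fst P) * snd P = 0"
proof -
  have "fps_nth (expansion P A B) 0 = poly A (fst P) + poly B (fst P) * snd P"
    using param_simps[OF assms(1)] by (simp add: expansion_def)
  moreover have "ord P A B > 0 \<longleftrightarrow> fps_nth (expansion P A B) 0 = 0"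
    using expansion_nonzero[OF assms] by (simp add: ord_def subdegree_eq_0_iff flip: neq0_conv)
  ultimately show ?thesis by simp
qed

lemma ord_conj:
  assumes "P \<in> curve" "A \<noteq> 0 \<or> B \<noteq> 0"
  shows "ord P A B + ord P A (- B) = ram P * order (fst P) (Norm A B)"
  using expansion_nonzero[OF assms] expansion_nonzero[OF assms(1), of A "- B"] assms(2)
    arg_cong[OF expansion_conj[OF assms(1), of A B], of subdegree]
    fps_eval_param(2)[OF assms(1) degree_Norm(1)[OF assms(2)]]
  by (simp add: ord_def)

text \<open>A solution with nonzero first-order term is a substitution of order 1 into the chosen
  one, so \<open>ord\<close> does not depend on the choice made in \<open>param\<close>.\<close>

lemma subdegree_eval_local_parameter:
  assumes "P \<in> curve" "fps_nth u 0 = fst P" "fps_nth y 0 = snd P" "y\<^sup>2 = fps_eval g u"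
    and "fps_nth u 1 \<noteq> 0 \<or> fps_nth y 1 \<noteq> 0"
  shows "subdegree (fps_eval A u + fps_eval B u * y) = ord P A B"
proof -
  obtain \<sigma> where s: "fps_nth \<sigma> 0 = 0" and u: "u = fst (param P) oo \<sigma>" and y: "y = snd (param P) oo \<sigma>"
    using param[OF assms(1)] assms(2-4) unfolding local_parameter_def by blast
  have "fps_nth u 1 = fps_nth (fst (param P)) 1 * fps_nth \<sigma> 1"
    "fps_nth y 1 = fps_nth (snd (param P)) 1 * fps_nth \<sigma> 1"
    using s by (simp_all add: u y fps_compose_nth)
  with assms(5) have "fps_nth \<sigma> 1 \<noteq> 0" by auto
  then have "subdegree \<sigma> = 1" using s by (intro subdegree_eq_1I)
  moreover have "fps_eval A u + fps_eval B u * y = expansion P A B oo \<sigma>"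
    by (simp add: expansion_def u y fps_compose_add_distrib fps_compose_mult_distrib[OF s]
        fps_eval_compose[OF s])
  ultimately show ?thesis by (simp add: ord_def subdegree_compose[OF s])
qed

lemma ord_neg:
  assumes "P \<in> curve"
  shows "ord (neg P) A B = ord P A (- B)"
proof -
  have "subdegree (fps_eval A (fst (param P)) + fps_eval B (fst (param P)) * - snd (param P)) = ord (neg P) A B"
    by (rule subdegree_eval_local_parameter)
      (use param_simps[OF assms] assms in \<open>auto simp: neg_def curve_def\<close>)
  then show ?thesis by (simp add: ord_def expansion_def)
qed

section \<open>Divisors of zeros on the affine cubic\<close>

definition divisor :: "complex poly \<Rightarrow> complex poly \<Rightarrow> (complex \<times> complex) multiset" where
  "divisor A B = Abs_multiset (\<lambda>P. if P \<in> curve then ord P A B else 0)"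

text \<open>Over a root of \<open>g\<close> the two entries coincide, which gives the branch point
  its multiplicity 2.\<close>

definition fibre :: "complex \<Rightarrow> (complex \<times> complex) multiset" where
  "fibre r = {#(r, csqrt (poly g r)), (r, - csqrt (poly g r))#}"

lemma count_fibre: "count (fibre r) P = (if r = fst P then ram P else 0)"
proof -
  have "P \<in> curve \<longleftrightarrow> snd P = csqrt (poly g (fst P)) \<or> snd P = - csqrt (poly g (fst P))"
    by (simp add: curve_def flip: power2_eq_iff)
  then show ?thesis by (cases P) (auto simp: fibre_def ram_def)
qed

lemma fibre_curve: "P \<in> curve \<Longrightarrow> fibre (fst P) = {#P, neg P#}"
  by (rule multiset_eqI)
    (use power2_eq_iff in \<open>fastforce simp: count_fibre ram_def neg_def curve_def prod_eq_iff\<close>)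

lemma count_fibres: "count (\<Sum>r\<in>#R. fibre r) P = ram P * count R (fst P)"
  by (induction R) (simp_all add: count_fibre)

text \<open>All zeros lie over roots of the norm, so the support is finite; this is what makes the
  counts of \<open>Abs_multiset\<close> the intended ones.\<close>

lemma count_divisor:
  assumes "A \<noteq> 0 \<or> B \<noteq> 0"
  shows "count (divisor A B) P = (if P \<in> curve then ord P A B else 0)"
proof -
  have "{P. 0 < (if P \<in> curve then ord P A B else 0)} \<subseteq> set_mset (\<Sum>r\<in>#proots (Norm A B). fibre r)"
  proof
    fix P assume "P \<in> {P. 0 < (if P \<in> curve then ord P A B else 0)}"
    then have "P \<in> curve" "ord P A B > 0" by (auto split: if_splits)
    then have "0 < ram P * order (fst P) (Norm A B)"
      using ord_conj[OF _ assms, of P] by (metis add_gr_0)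
    then have "count (\<Sum>r\<in>#proots (Norm A B). fibre r) P > 0"
      using degree_Norm(1)[OF assms] by (simp add: count_fibres)
    then show "P \<in># (\<Sum>r\<in>#proots (Norm A B). fibre r)" by simp
  qed
  then have "finite {P. 0 < (if P \<in> curve then ord P A B else 0)}"
    by (rule finite_subset) simp
  then show ?thesis by (simp add: divisor_def count_Abs_multiset)
qed

lemma divisor_curve: "A \<noteq> 0 \<or> B \<noteq> 0 \<Longrightarrow> set_mset (divisor A B) \<subseteq> curve"
  using count_divisor by (auto simp flip: count_greater_zero_iff split: if_splits)

lemma count_image_neg: "count (image_mset neg M) P = count M (neg P)"
  by (induction M) auto

lemma divisor_neg:
  assumes "A \<noteq> 0 \<or> B \<noteq> 0"
  shows "image_mset neg (divisor A B) = divisor A (- B)"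
  using assms by (intro multiset_eqI) (auto simp: count_image_neg count_divisor ord_neg)

lemma divisor_Norm:
  assumes "A \<noteq> 0 \<or> B \<noteq> 0"
  shows "divisor A B + image_mset neg (divisor A B) = (\<Sum>r\<in>#proots (Norm A B). fibre r)"
  unfolding divisor_neg[OF assms]
  using assms degree_Norm(1)[OF assms]
  by (intro multiset_eqI) (auto simp: count_divisor count_fibres ord_conj ram_def)

text \<open>A divisor and its conjugate have equal size, and together they consist of two points
  over each root of the norm; hence the number of zeros is the degree of the norm.\<close>

lemma size_divisor:
  assumes "A \<noteq> 0 \<or> B \<noteq> 0"
  shows "size (divisor A B) = max (2 * degree A) (if B = 0 then 0 else 2 * degree B + 3)"
proof -
  have "size (\<Sum>r\<in>#R. fibre r) = 2 * size R" for R
    by (induction R) (simp_all add: fibre_def)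
  then have "size (divisor A B + image_mset neg (divisor A B)) = 2 * degree (Norm A B)"
    by (simp add: divisor_Norm[OF assms] size_proots_complex)
  then show ?thesis by (simp add: degree_Norm(2)[OF assms])
qed

lemma divisor_poly:
  assumes "A \<noteq> 0"
  shows "divisor A 0 = (\<Sum>r\<in>#proots A. fibre r)"
  using assms fps_eval_param(2)[of _ A]
  by (intro multiset_eqI) (auto simp: count_divisor count_fibres ord_def expansion_def ram_def)

text \<open>The coefficients are those of the product of the two functions after replacing
  \<open>y\<^sup>2\<close> by \<open>g\<close>. Multiplicativity of the norm shows that the product
  is nonzero.\<close>

lemma divisor_mult:
  assumes "A \<noteq> 0 \<or> B \<noteq> 0" "A' \<noteq> 0 \<or> B' \<noteq> 0"
  shows "A * A' + B * B' * g \<noteq> 0 \<or> A * B' + A' * B \<noteq> 0"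
    and "divisor (A * A' + B * B' * g) (A * B' + A' * B) = divisor A B + divisor A' B'"
proof -
  have "Norm (A * A' + B * B' * g) (A * B' + A' * B) = Norm A B * Norm A' B'"
    by (simp add: Norm_def algebra_simps power2_eq_square)
  then show *: "A * A' + B * B' * g \<noteq> 0 \<or> A * B' + A' * B \<noteq> 0"
    using degree_Norm(1)[OF assms(1)] degree_Norm(1)[OF assms(2)] by (auto simp: Norm_def)
  have "expansion P (A * A' + B * B' * g) (A * B' + A' * B) = expansion P A B * expansion P A' B'"
    if "P \<in> curve" for P
    using param_simps(3)[OF that] by (simp add: expansion_def algebra_simps power2_eq_square)
  then show "divisor (A * A' + B * B' * g) (A * B' + A' * B) = divisor A B + divisor A' B'"
    using assms * expansion_nonzero[of _ A B] expansion_nonzero[of _ A' B']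
    by (intro multiset_eqI) (auto simp: count_divisor ord_def)
qed

section \<open>Effective principal divisors and cancellation\<close>

text \<open>The functions are polynomial in \<open>u\<close> and \<open>y\<close>, so their only
  pole is at infinity and their affine zeros say everything. Staying with effective multisets avoids
  quotients of functions; cancellation of fibres replaces division.\<close>

definition principal :: "(complex \<times> complex) multiset \<Rightarrow> bool" where
  "principal M \<longleftrightarrow> (\<exists>A B. (A \<noteq> 0 \<or> B \<noteq> 0) \<and> M = divisor A B)"

lemma principal_curve: "principal M \<Longrightarrow> set_mset M \<subseteq> curve"
  unfolding principal_def using divisor_curve by blast

lemma principal_add: "principal M \<Longrightarrow> principal M' \<Longrightarrow> principal (M + M')"
  unfolding principal_def using divisor_mult by metis

lemma principal_neg: "principal M \<Longrightarrow> principal (image_mset neg M)"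
  unfolding principal_def using divisor_neg by (metis neg_0_equal_iff_equal)

lemma principal_fibre:
  assumes "P \<in> curve"
  shows "principal {#P, neg P#}"
proof -
  have "divisor [:- fst P, 1:] 0 = {#P, neg P#}"
    using divisor_poly[of "[:- fst P, 1:]"] fibre_curve[OF assms] by simp
  then show ?thesis unfolding principal_def by (metis one_neq_zero pCons_eq_0_iff)
qed

lemma principal_empty: "principal {#}"
  unfolding principal_def using divisor_poly[of 1] by (intro exI[of _ 1] exI[of _ 0]) simp

text \<open>A function vanishing at \<open>P\<close> and \<open>neg P\<close>, doubly if they
  coincide, has both coefficients divisible by the linear factor \<open>[:- fst P, 1:]\<close>.
  Dividing by it removes exactly this fibre.\<close>

lemma principal_cancel_fibre:
  assumes "principal (M + {#P, neg P#})"
  shows "principal M"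
proof -
  obtain A B where AB: "A \<noteq> 0 \<or> B \<noteq> 0" and M: "M + {#P, neg P#} = divisor A B"
    using assms unfolding principal_def by blast
  have P: "P \<in> curve" using principal_curve[OF assms] by simp
  let ?e = "expansion P A B"
  have "count (divisor A B) P > 0" by (simp flip: M)
  then have e0: "poly A (fst P) + poly B (fst P) * snd P = 0"
    using P AB ord_pos_iff[OF P AB] by (simp only: count_divisor if_True)
  have "poly A (fst P) = 0 \<and> poly B (fst P) = 0"
  proof (cases "snd P = 0")
    case True
    then have "neg P = P" by (simp add: neg_def prod_eq_iff)
    then have "count (divisor A B) P \<ge> 2" by (simp flip: M)
    then have "subdegree ?e \<ge> 2"
      using P AB by (simp add: count_divisor ord_def)
    then have "fps_nth ?e 1 = 0" by (intro nth_less_subdegree_zero) simp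
    \<comment> \<open>At a branch point \<open>u\<close> is stationary and \<open>y\<close> moves,
      so the first-order term sees only the value of \<open>B\<close>.\<close>
    moreover have "fps_nth ?e 1 = poly B (fst P) * fps_nth (snd (param P)) 1"
      using param_simps(1,2)[OF P] param_ramified[OF P True] True
      by (simp add: expansion_def fps_eval_nth_1 fps_mult_nth_1 del: One_nat_def)
    ultimately show ?thesis using e0 True param_simps(4)[OF P True] by simp
  next
    case False
    have "count (divisor A B) (neg P) > 0" by (simp flip: M)
    then have "poly A (fst P) - poly B (fst P) * snd P = 0"
      using P AB ord_pos_iff[of "neg P" A B] by (simp only: count_divisor neg_curve if_True) (simp add: neg_def)
    with e0 have "2 * poly A (fst P) = 0" "poly B (fst P) * snd P = poly A (fst P)"
      by (auto simp: algebra_simps add_eq_0_iff2)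
    then show ?thesis using False by auto
  qed
  then obtain A' B' where A': "A = [:- fst P, 1:] * A'" and B': "B = [:- fst P, 1:] * B'"
    by (meson poly_eq_0_iff_dvd dvdE)
  have AB': "A' \<noteq> 0 \<or> B' \<noteq> 0" using AB A' B' by auto
  have "divisor A B = divisor [:- fst P, 1:] 0 + divisor A' B'"
    using divisor_mult(2)[of "[:- fst P, 1:]" 0 A' B'] AB' A' B' by simp
  also have "divisor [:- fst P, 1:] 0 = {#P, neg P#}"
    using divisor_poly[of "[:- fst P, 1:]"] fibre_curve[OF P] by simp
  finally have "M = divisor A' B'" using M by (simp add: add.commute)
  then show ?thesis using AB' unfolding principal_def by blast
qed

lemma principal_cancel: "principal (M + L + image_mset neg L) \<Longrightarrow> principal M"
proof (induction L)
  case (add P L)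
  have "principal ((M + L + image_mset neg L) + {#P, neg P#})"
    using add.prems by (simp add: ac_simps add_mset_commute)
  then show ?case using principal_cancel_fibre add.IH by blast
qed simp

text \<open>Norms of functions with a term in \<open>y\<close> have degree at least \<open>3\<close>, so at most two zeros
  can only come from a polynomial in \<open>u\<close>, whose zeros occur in pairs \<open>P\<close>, \<open>-P\<close>.\<close>

lemma principal_size_le_2:
  assumes "principal M" "size M \<le> 2" "M \<noteq> {#}"
  shows "\<exists>P. M = {#P, neg P#}"
proof -
  obtain A B where AB: "A \<noteq> 0 \<or> B \<noteq> 0" and M: "M = divisor A B"
    using assms unfolding principal_def by blast
  have B: "B = 0" and dA: "degree A \<le> 1"
    using size_divisor[OF AB] assms(2) M by (auto split: if_splits)
  then have A0: "A \<noteq> 0" using AB by simp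
  have "size (proots A) \<le> 1" "proots A \<noteq> {#}"
    using dA divisor_poly[OF A0] assms(3) B M by (auto simp: size_proots_complex)
  then have "size (proots A) = 1" by (cases "size (proots A)") auto
  then obtain r where "proots A = {#r#}" using size_1_singleton_mset by metis
  then have "M = fibre r" using divisor_poly[OF A0] M B by simp
  then show ?thesis by (auto simp: fibre_def neg_def)
qed

section \<open>The chord and tangent law\<close>

definition pts :: "(complex \<times> complex) option set" where
  "pts = insert None (Some ` curve)"

text \<open>\<open>None\<close> is the point at infinity, to which N corresponds. As the future
  neutral element it contributes nothing, so one notion of principal multiset covers three collinear
  points of any kind.\<close>

definition affine_part :: "(complex \<times> complex) option \<Rightarrow> (complex \<times> complex) multiset" where
  "affine_part p = (case p of None \<Rightarrow> {#} | Some P \<Rightarrow> {#P#})"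

definition opp :: "(complex \<times> complex) option \<Rightarrow> (complex \<times> complex) option" where
  "opp = map_option neg"

lemma pts_simps [simp]: "None \<in> pts" "Some P \<in> pts \<longleftrightarrow> P \<in> curve"
  by (auto simp: pts_def)

lemma affine_part_simps [simp]: "affine_part None = {#}" "affine_part (Some P) = {#P#}"
  by (simp_all add: affine_part_def)

lemma opp_simps [simp]: "opp None = None" "opp (Some P) = Some (neg P)"
  by (simp_all add: opp_def)

lemma opp_opp [simp]: "opp (opp p) = p"
  by (cases p) simp_all

lemma opp_pts [simp]: "opp p \<in> pts \<longleftrightarrow> p \<in> pts"
  by (cases p) simp_all

lemma affine_part_opp: "affine_part (opp p) = image_mset neg (affine_part p)"
  by (cases p) simp_all

lemma principal_opp:
  assumes "p \<in> pts" shows "principal (affine_part p + affine_part (opp p))"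
  using assms principal_empty principal_fibre by (cases p) (simp_all add: add_mset_commute)

lemma principal_pair:
  assumes "principal (affine_part p + affine_part q)"
  shows "q = opp p"
proof -
  have "affine_part p + affine_part q = {#} \<or> (\<exists>P. affine_part p + affine_part q = {#P, neg P#})"
    using principal_size_le_2[OF assms] by (cases p; cases q) auto
  then show ?thesis
    by (cases p; cases q) (auto simp: add_eq_conv_ex)
qed

text \<open>Adding the conjugate of the second divisor to the first and cancelling \<open>M\<close>
  against its conjugate leaves \<open>p\<close> together with \<open>opp q\<close>, and a principal
  pair consists of opposite points.\<close>

lemma principal_unique:
  assumes "principal (M + affine_part p)" "principal (M + affine_part q)"
  shows "p = q"
proof -
  have "principal ((M + affine_part p) + image_mset neg (M + affine_part q))"
    using assms principal_add principal_neg by blast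
  then have "principal ((affine_part p + affine_part (opp q)) + M + image_mset neg M)"
    by (simp add: affine_part_opp ac_simps)
  then have "opp q = opp p"
    using principal_cancel principal_pair by blast
  then show ?thesis by (metis opp_opp)
qed

text \<open>The zeros of \<open>A + y\<close> are the intersections with the line
  \<open>y = - A(u)\<close>. The case \<open>Q = neg P\<close> is left out because its line is
  vertical.\<close>

lemma chord_or_tangent:
  assumes P: "P \<in> curve" and Q: "Q \<in> curve" and "Q \<noteq> neg P"
  shows "\<exists>A. degree A \<le> 1 \<and> {#P, Q#} \<subseteq># divisor A 1"
proof (cases "fst P = fst Q")
  case False
  define l where "l = (snd Q - snd P) / (fst Q - fst P)"
  define A where "A = [:l * fst P - snd P, - l:]"
  have lin: "l * (fst Q - fst P) = snd Q - snd P" using False by (simp add: l_def)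
  have "poly A (fst P) + snd P = 0" "poly A (fst Q) + snd Q = 0"
    using lin by (simp_all add: A_def algebra_simps)
  then have "ord P A 1 > 0" "ord Q A 1 > 0"
    using ord_pos_iff[OF P, of A 1] ord_pos_iff[OF Q, of A 1] by simp_all
  then have "{#P, Q#} \<subseteq># divisor A 1"
    using False P Q by (auto simp: mset_subset_eqI count_divisor subseteq_mset_def Suc_le_eq)
  then show ?thesis by (intro exI[of _ A]) (simp add: A_def)
next
  case True
  then have "(snd P)\<^sup>2 = (snd Q)\<^sup>2" using P Q by (simp add: curve_def)
  then have QP: "Q = P" using True assms(3)
    by (auto simp: power2_eq_iff neg_def prod_eq_iff)
  have y0: "snd P \<noteq> 0" using assms(3) QP by (auto simp: neg_def prod_eq_iff)
  \<comment> \<open>The tangent slope, by differentiating \<open>y\<^sup>2 = g(u)\<close>.\<close>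
  define l where "l = poly (pderiv g) (fst P) / (2 * snd P)"
  define A where "A = [:l * fst P - snd P, - l:]"
  let ?e = "expansion P A 1"
  have "fps_nth ?e 0 = 0" using param_simps[OF P] by (simp add: expansion_def A_def)
  moreover have "fps_nth ?e 1 = 0"
    using param_simps[OF P] param_nth_1[OF P] y0
    by (simp add: expansion_def A_def fps_mult_nth_1 l_def field_simps)
  ultimately have "subdegree ?e \<ge> 2"
    using expansion_nonzero[OF P, of A 1]
    by (intro subdegree_geI) (auto simp: less_2_cases_iff)
  then have "{#P, Q#} \<subseteq># divisor A 1"
    using QP P by (auto simp: subseteq_mset_def count_divisor ord_def)
  then show ?thesis by (intro exI[of _ A]) (simp add: A_def)
qed

text \<open>For \<open>A\<close> of degree at most 1 the function \<open>A + y\<close> has exactly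
  three zeros, so one remains besides two given ones. Vertical lines and lines through infinity are
  covered by opposite points.\<close>

lemma third_point:
  assumes "p \<in> pts" "q \<in> pts"
  shows "\<exists>r\<in>pts. principal (affine_part p + affine_part q + affine_part r)"
proof (cases "q = opp p \<or> p = None \<or> q = None")
  case True
  consider "q = opp p" | "p = None" | "q = None" using True by blast
  then show ?thesis
  proof cases
    case 1
    then show ?thesis using principal_opp[OF assms(1)]
      by (intro bexI[of _ None]) simp_all
  next
    case 2
    then show ?thesis using principal_opp[OF assms(2)] assms(2)
      by (intro bexI[of _ "opp q"]) (simp_all)
  next
    case 3
    then show ?thesis using principal_opp[OF assms(1)] assms(1)
      by (intro bexI[of _ "opp p"]) (simp_all)
  qed
next
  case False
  then obtain P Q where pq: "p = Some P" "q = Some Q" "Q \<noteq> neg P"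
    by (cases p; cases q) auto
  then obtain A where A: "degree A \<le> 1" "{#P, Q#} \<subseteq># divisor A 1"
    using chord_or_tangent[of P Q] assms by auto
  then have "size (divisor A 1 - {#P, Q#}) = 1"
    using size_divisor[of A 1] by (simp add: size_Diff_submset)
  then obtain R where "divisor A 1 - {#P, Q#} = {#R#}" using size_1_singleton_mset by metis
  then have R: "divisor A 1 = {#P, Q#} + {#R#}" using A(2) by (metis subset_mset.add_diff_inverse)
  then have "principal ({#P, Q#} + {#R#})" unfolding principal_def by (metis one_neq_zero)
  then show ?thesis using principal_curve[of "{#P, Q#} + {#R#}"] pq
    by (intro bexI[of _ "Some R"]) (auto simp: add_mset_commute)
qed

definition add :: "(complex \<times> complex) option \<Rightarrow> (complex \<times> complex) option \<Rightarrow> (complex \<times> complex) option" where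
  "add p q = (THE r. r \<in> pts \<and> principal (affine_part p + affine_part q + affine_part (opp r)))"

lemma add:
  assumes "p \<in> pts" "q \<in> pts"
  shows "add p q \<in> pts" "principal (affine_part p + affine_part q + affine_part (opp (add p q)))"
proof -
  have "\<exists>!r. r \<in> pts \<and> principal (affine_part p + affine_part q + affine_part (opp r))"
    using third_point[OF assms] principal_unique by (metis opp_opp opp_pts)
  then have "add p q \<in> pts \<and> principal (affine_part p + affine_part q + affine_part (opp (add p q)))"
    unfolding add_def by (rule theI')
  then show "add p q \<in> pts" "principal (affine_part p + affine_part q + affine_part (opp (add p q)))"
    by auto
qed

lemma add_eqI:
  assumes "p \<in> pts" "q \<in> pts" "principal (affine_part p + affine_part q + affine_part (opp r))"
  shows "add p q = r"
  using principal_unique add(2)[OF assms(1,2)] assms(3) by (metis opp_opp)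

lemma add_commute: "add p q = add q p"
  by (simp add: add_def add.commute)

lemma add_None: "p \<in> pts \<Longrightarrow> add None p = p"
  using principal_opp by (intro add_eqI) auto

lemma add_opp: "p \<in> pts \<Longrightarrow> add (opp p) p = None"
  using principal_opp[of p] by (intro add_eqI) (auto simp: add.commute)

text \<open>Multiplying the functions for the two successive additions makes the intermediate sum
  meet its opposite and cancel. What remains is symmetric in \<open>p\<close>, \<open>q\<close>,
  \<open>r\<close> up to the last point, and that point is unique; this gives associativity.\<close>

lemma principal_add_assoc:
  assumes "p \<in> pts" "q \<in> pts" "r \<in> pts"
  shows "principal (affine_part p + affine_part q + affine_part r + affine_part (opp (add (add p q) r)))"
proof -
  let ?s = "add p q"
  note s = add[OF assms(1,2)]
  have "principal ((affine_part p + affine_part q + affine_part (opp ?s)) +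
      (affine_part ?s + affine_part r + affine_part (opp (add ?s r))))"
    using principal_add s(2) add(2)[OF s(1) assms(3)] by blast
  then have "principal ((affine_part p + affine_part q + affine_part r + affine_part (opp (add ?s r)))
      + affine_part ?s + image_mset neg (affine_part ?s))"
    by (simp add: affine_part_opp ac_simps)
  then show ?thesis by (rule principal_cancel)
qed

lemma add_assoc:
  assumes "p \<in> pts" "q \<in> pts" "r \<in> pts"
  shows "add (add p q) r = add p (add q r)"
proof -
  have "principal (affine_part p + affine_part q + affine_part r + affine_part (opp (add p (add q r))))"
    using principal_add_assoc[OF assms(2,3,1)] by (simp add: add_commute[of p] ac_simps)
  then show ?thesis using principal_unique principal_add_assoc[OF assms] by (metis opp_opp)
qed

lemma add_add_eq_None_iff:
  assumes "p \<in> pts" "q \<in> pts" "r \<in> pts"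
  shows "add (add p q) r = None \<longleftrightarrow> principal (affine_part p + affine_part q + affine_part r)"
proof -
  have "principal (affine_part p + affine_part q + affine_part r + affine_part None) \<longleftrightarrow>
      None = opp (add (add p q) r)"
    using principal_add_assoc[OF assms] principal_unique by metis
  then show ?thesis by (cases "add (add p q) r") simp_all
qed

end

section \<open>Points of the quartic\<close>

text \<open>Converts the Weierstrass equation, with \<open>z\<close> in the role of y^2, into a
  quadric. It is applied with \<open>t = 1\<close> at affine points and with \<open>u = 1\<close>,
  \<open>t = r\<close> at N.\<close>

lemma quadric_section_identity:
  fixes n m \<beta> u v z :: "'a::comm_ring_1"
  assumes "(2 * n\<^sup>2 + \<beta>) * u - 2 * n * (n\<^sup>2 + m\<^sup>2 + \<beta>) * v = t"
    and "z = - u * ((u - n * v)\<^sup>2 - m\<^sup>2 * v\<^sup>2)"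
  shows "v\<^sup>2 * t + z = (u - 2 * n * v) * ((\<beta> + n\<^sup>2 + m\<^sup>2) * v\<^sup>2 - u\<^sup>2)"
  unfolding assms(2) assms(1)[symmetric] by (simp add: algebra_simps power2_eq_square)

text \<open>The first quadric makes X^2 + Y^2 a multiple of \<open>k\<close>, so the quartic becomes
  \<open>k\<^sup>2\<close> times a quadratic expression, which the second quadric
  annihilates.\<close>

lemma miquel_form_chart_identity:
  fixes n m \<beta> u v y k :: "'a::comm_ring_1"
  assumes "v\<^sup>2 + y\<^sup>2 = (u - 2 * n * v) * k"
    and "((2 * n\<^sup>2 + \<beta>) * u - 2 * n * (n\<^sup>2 + m\<^sup>2 + \<beta>) * v) * k = (\<beta> + n\<^sup>2 + m\<^sup>2) * v\<^sup>2 - u\<^sup>2"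
  shows "(n * k + v)\<^sup>2 + y\<^sup>2 = k * (n\<^sup>2 * k + u)"
    and "((n * k + v)\<^sup>2 + y\<^sup>2)\<^sup>2 - (n\<^sup>2 + m\<^sup>2) * (n * k + v)\<^sup>2 * k\<^sup>2 + \<beta> * y\<^sup>2 * k\<^sup>2 + n\<^sup>2 * m\<^sup>2 * k ^ 4 = 0"
proof -
  have "(n * k + v)\<^sup>2 + y\<^sup>2 = n\<^sup>2 * k\<^sup>2 + 2 * n * k * v + (v\<^sup>2 + y\<^sup>2)"
    by (simp add: algebra_simps power2_eq_square)
  then show *: "(n * k + v)\<^sup>2 + y\<^sup>2 = k * (n\<^sup>2 * k + u)"
    unfolding assms(1) by (simp add: algebra_simps power2_eq_square)
  have y: "y\<^sup>2 = (u - 2 * n * v) * k - v\<^sup>2" using assms(1) by (simp add: algebra_simps)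
  have "(n\<^sup>2 * k + u)\<^sup>2 - (n\<^sup>2 + m\<^sup>2) * (n * k + v)\<^sup>2 + \<beta> * y\<^sup>2 + n\<^sup>2 * m\<^sup>2 * k\<^sup>2 =
      ((2 * n\<^sup>2 + \<beta>) * u - 2 * n * (n\<^sup>2 + m\<^sup>2 + \<beta>) * v) * k - ((\<beta> + n\<^sup>2 + m\<^sup>2) * v\<^sup>2 - u\<^sup>2)"
    unfolding y by (simp add: algebra_simps power2_eq_square)
  then have "(n\<^sup>2 * k + u)\<^sup>2 - (n\<^sup>2 + m\<^sup>2) * (n * k + v)\<^sup>2 + \<beta> * y\<^sup>2 + n\<^sup>2 * m\<^sup>2 * k\<^sup>2 = 0"
    unfolding assms(2) by simp
  then have "k\<^sup>2 * ((n\<^sup>2 * k + u)\<^sup>2 - (n\<^sup>2 + m\<^sup>2) * (n * k + v)\<^sup>2 + \<beta> * y\<^sup>2 + n\<^sup>2 * m\<^sup>2 * k\<^sup>2) = 0"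
    by simp
  then show "((n * k + v)\<^sup>2 + y\<^sup>2)\<^sup>2 - (n\<^sup>2 + m\<^sup>2) * (n * k + v)\<^sup>2 * k\<^sup>2 + \<beta> * y\<^sup>2 * k\<^sup>2 + n\<^sup>2 * m\<^sup>2 * k ^ 4 = 0"
    unfolding * by (simp add: algebra_simps power2_eq_square power4_eq_xxxx)
qed

text \<open>The first claim is the quartic equation rewritten. Combined with
  \<open>V\<^sup>2 + (Y * Z)\<^sup>2 = Z\<^sup>2 * (U - 2 * n * V)\<close>, valid for all
  \<open>X\<close>, \<open>Y\<close>, \<open>Z\<close>, it gives the homogeneous Weierstrass
  cubic.\<close>

lemma miquel_form_inversion_identity:
  fixes n m \<beta> X Y Z :: "'a::comm_ring_1"
  defines "U \<equiv> X\<^sup>2 + Y\<^sup>2 - n\<^sup>2 * Z\<^sup>2" and "V \<equiv> X * Z - n * Z\<^sup>2"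
  defines "T \<equiv> (2 * n\<^sup>2 + \<beta>) * U - 2 * n * (n\<^sup>2 + m\<^sup>2 + \<beta>) * V"
  assumes "(X\<^sup>2 + Y\<^sup>2)\<^sup>2 - (n\<^sup>2 + m\<^sup>2) * X\<^sup>2 * Z\<^sup>2 + \<beta> * Y\<^sup>2 * Z\<^sup>2 + n\<^sup>2 * m\<^sup>2 * Z ^ 4 = 0"
  shows "Z\<^sup>2 * T = (\<beta> + n\<^sup>2 + m\<^sup>2) * V\<^sup>2 - U\<^sup>2"
    and "(Y * Z)\<^sup>2 * T = - U * ((U - n * V)\<^sup>2 - m\<^sup>2 * V\<^sup>2)"
proof -
  have "Z\<^sup>2 * T - ((\<beta> + n\<^sup>2 + m\<^sup>2) * V\<^sup>2 - U\<^sup>2) =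
      (X\<^sup>2 + Y\<^sup>2)\<^sup>2 - (n\<^sup>2 + m\<^sup>2) * X\<^sup>2 * Z\<^sup>2 + \<beta> * Y\<^sup>2 * Z\<^sup>2 + n\<^sup>2 * m\<^sup>2 * Z ^ 4"
    unfolding T_def U_def V_def by (simp add: algebra_simps power2_eq_square power4_eq_xxxx)
  then show *: "Z\<^sup>2 * T = (\<beta> + n\<^sup>2 + m\<^sup>2) * V\<^sup>2 - U\<^sup>2"
    unfolding assms(4) by simp
  have "V\<^sup>2 + (Y * Z)\<^sup>2 = Z\<^sup>2 * (U - 2 * n * V)"
    unfolding U_def V_def by (simp add: algebra_simps power2_eq_square)
  then have "(V\<^sup>2 + (Y * Z)\<^sup>2) * T = ((\<beta> + n\<^sup>2 + m\<^sup>2) * V\<^sup>2 - U\<^sup>2) * (U - 2 * n * V)"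
    unfolding *[symmetric] by (simp only: mult_ac)
  then have "(Y * Z)\<^sup>2 * T = ((\<beta> + n\<^sup>2 + m\<^sup>2) * V\<^sup>2 - U\<^sup>2) * (U - 2 * n * V) - V\<^sup>2 * T"
    by (simp add: algebra_simps)
  then show "(Y * Z)\<^sup>2 * T = - U * ((U - n * V)\<^sup>2 - m\<^sup>2 * V\<^sup>2)"
    unfolding T_def by (simp add: algebra_simps power2_eq_square)
qed

section \<open>Formal parametrizations and circles along them\<close>

lemma substituted_nth [simp]: "substituted w \<sigma> \<phi> $ i = w * (\<phi> $ i oo \<sigma>)"
  by (simp add: substituted_def)

lemma center_nth [simp]: "center \<phi> $ i = fps_nth (\<phi> $ i) 0"
  by (simp add: center_def)

definition immersed :: "(complex fps)^3 \<Rightarrow> bool" where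
  "immersed \<phi> \<longleftrightarrow> (\<exists>i j. fps_nth (\<phi>$i) 0 * fps_nth (\<phi>$j) 1 \<noteq> fps_nth (\<phi>$j) 0 * fps_nth (\<phi>$i) 1)"

text \<open>After a substitution with vanishing derivative, the constant and the first-order vectors
  of \<open>\<phi>\<close> are both multiples of the centre of \<open>\<psi>\<close>, so all their
  minors vanish.\<close>

lemma immersed_imp_irreducible:
  assumes "immersed \<phi>" "fps_nth \<sigma> 0 = 0" "fps_nth \<sigma> 1 = 0"
  shows "\<phi> \<noteq> substituted w \<sigma> \<psi>"
proof
  assume \<phi>: "\<phi> = substituted w \<sigma> \<psi>"
  have "fps_nth (f oo \<sigma>) 1 = 0" for f :: "complex fps"
    using assms(3) by (simp add: fps_compose_nth)
  then have "fps_nth (\<phi>$i) 0 = fps_nth w 0 * fps_nth (\<psi>$i) 0"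
    "fps_nth (\<phi>$i) 1 = fps_nth w 1 * fps_nth (\<psi>$i) 0" for i
    by (simp_all add: \<phi> fps_mult_nth_1 del: One_nat_def)
  then show False using assms(1) by (simp add: immersed_def del: One_nat_def)
qed

lemma reparametrization_refl: "reparametrization \<phi> \<phi>"
  unfolding reparametrization_def
  by (intro exI[of _ 1] exI[of _ fps_X]) (simp add: vec_eq_iff)

lemma reparametrization_trans:
  assumes "reparametrization \<phi> \<psi>" "reparametrization \<psi> \<omega>"
  shows "reparametrization \<phi> \<omega>"
proof -
  obtain u \<sigma> where s: "fps_nth u 0 \<noteq> 0" "fps_nth \<sigma> 0 = 0" "fps_nth \<sigma> 1 \<noteq> 0" "\<psi> = substituted u \<sigma> \<phi>"
    using assms(1) unfolding reparametrization_def by blast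
  obtain w \<tau> where t: "fps_nth w 0 \<noteq> 0" "fps_nth \<tau> 0 = 0" "fps_nth \<tau> 1 \<noteq> 0" "\<omega> = substituted w \<tau> \<psi>"
    using assms(2) unfolding reparametrization_def by blast
  have "\<omega> = substituted (w * (u oo \<tau>)) (\<sigma> oo \<tau>) \<phi>"
    by (simp add: vec_eq_iff s t fps_compose_mult_distrib fps_compose_assoc mult.assoc)
  moreover have "fps_nth (\<sigma> oo \<tau>) 1 \<noteq> 0" using s t by (simp add: fps_compose_nth)
  ultimately show ?thesis unfolding reparametrization_def
    using s t by (intro exI[of _ "w * (u oo \<tau>)"] exI[of _ "\<sigma> oo \<tau>"]) simp
qed

lemma reparametrization_sym:
  assumes "reparametrization \<phi> \<psi>"
  shows "reparametrization \<psi> \<phi>"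
proof -
  obtain u \<sigma> where s: "fps_nth u 0 \<noteq> 0" "fps_nth \<sigma> 0 = 0" "fps_nth \<sigma> 1 \<noteq> 0" "\<psi> = substituted u \<sigma> \<phi>"
    using assms(1) unfolding reparametrization_def by blast
  let ?\<tau> = "fps_inv \<sigma>"
  have t: "fps_nth ?\<tau> 0 = 0" "fps_nth ?\<tau> 1 \<noteq> 0"
    using s by (simp_all add: fps_inv_def)
  have "\<phi> = substituted (inverse (u oo ?\<tau>)) ?\<tau> \<psi>"
  proof -
    have "inverse (u oo ?\<tau>) * ((u * (f oo \<sigma>)) oo ?\<tau>) = f" for f :: "complex fps"
    proof -
      have "(u * (f oo \<sigma>)) oo ?\<tau> = (u oo ?\<tau>) * (f oo (\<sigma> oo ?\<tau>))"
        by (simp add: fps_compose_mult_distrib[OF t(1)] fps_compose_assoc[OF t(1) s(2)])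
      also have "\<dots> = (u oo ?\<tau>) * f" using fps_inv_right[OF s(2,3)] by simp
      finally show ?thesis using s(1) by (simp add: inverse_mult_eq_1 flip: mult.assoc)
    qed
    then show ?thesis by (simp add: vec_eq_iff s(4))
  qed
  then show ?thesis unfolding reparametrization_def using s t
    by (intro exI[of _ "inverse (u oo ?\<tau>)"] exI[of _ ?\<tau>]) simp
qed

lemma conic_form_circle:
  assumes "complex_circle K"
  shows "conic_form (\<chi> i j. fps_const (K$i$j)) v =
    fps_const (K$1$1) * ((v$1)\<^sup>2 + (v$2)\<^sup>2) + fps_const (2 * K$1$3) * (v$1 * v$3)
    + fps_const (2 * K$2$3) * (v$2 * v$3) + fps_const (K$3$3) * (v$3)\<^sup>2"
    and "K$1$2 = 0" "K$2$1 = 0" "K$2$2 = K$1$1" "K$3$1 = K$1$3" "K$3$2 = K$2$3"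
proof -
  have sym: "K$i$j = K$j$i" for i j
  proof -
    have "transpose K $ i $ j = K $ i $ j" using assms by (simp add: complex_circle_def)
    then show ?thesis by (simp add: transpose_def)
  qed
  have "K$1$1 - K$2$2 + 2 * (\<i> * K$1$2) = 0" "K$1$1 - K$2$2 - 2 * (\<i> * K$1$2) = 0"
  proof -
    have "conic_form K (vector [1, \<i>, 0]) = 0" using assms by (simp add: complex_circle_def)
    then show "K$1$1 - K$2$2 + 2 * (\<i> * K$1$2) = 0"
      using sym[of 2 1] by (simp add: conic_form_def sum_3 algebra_simps)
    have "conic_form K (vector [1, - \<i>, 0]) = 0" using assms by (simp add: complex_circle_def)
    then show "K$1$1 - K$2$2 - 2 * (\<i> * K$1$2) = 0"
      using sym[of 2 1] by (simp add: conic_form_def sum_3 algebra_simps)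
  qed
  moreover have "x = 0 \<and> y = 0" if "x + 2 * (\<i> * y) = 0" "x - 2 * (\<i> * y) = 0" for x y :: complex
  proof -
    have "2 * x = (x + 2 * (\<i> * y)) + (x - 2 * (\<i> * y))" by simp
    then have "x = 0" unfolding that by simp
    then show ?thesis using that(1) by simp
  qed
  ultimately have "K$1$1 - K$2$2 = 0" "K$1$2 = 0" by blast+
  then show *: "K$1$2 = 0" "K$2$1 = 0" "K$2$2 = K$1$1" "K$3$1 = K$1$3" "K$3$2 = K$2$3"
    using sym by auto
  show "conic_form (\<chi> i j. fps_const (K$i$j)) v =
    fps_const (K$1$1) * ((v$1)\<^sup>2 + (v$2)\<^sup>2) + fps_const (2 * K$1$3) * (v$1 * v$3)
    + fps_const (2 * K$2$3) * (v$2 * v$3) + fps_const (K$3$3) * (v$3)\<^sup>2"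
  proof -
    have 2: "fps_const (2 * z) = 2 * fps_const z" for z :: complex
      by (simp add: numeral_fps_const)
    have ring: "k * x * x + 0 * x * y + a * x * z + (0 * y * x + k * y * y + b * y * z)
          + (a * z * x + b * z * y + c * z * z)
        = k * (x\<^sup>2 + y\<^sup>2) + 2 * a * (x * z) + 2 * b * (y * z) + c * z\<^sup>2"
      for k a b c x y z :: "complex fps"
      by (simp add: algebra_simps power2_eq_square)
    show ?thesis
      unfolding 2 ring[symmetric]
      by (simp only: conic_form_def sum_3 * vec_lambda_beta fps_const_0_eq_0)
  qed
qed

lemma conic_form_substituted:
  assumes "fps_nth \<sigma> 0 = 0"
  shows "conic_form (\<chi> i j. fps_const (K$i$j)) (substituted w \<sigma> \<phi>) =
    w\<^sup>2 * (conic_form (\<chi> i j. fps_const (K$i$j)) \<phi> oo \<sigma>)"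
  by (simp add: conic_form_def fps_compose_sum_distrib sum_distrib_left
      fps_compose_mult_distrib[OF assms] power2_eq_square mult_ac)

section \<open>The quartic with a chosen axis point, and its cubic\<close>

text \<open>On the x-axis the quartic factors as (x^2 - n^2)(x^2 - m^2), so the axis points are n,
  -n, m, -m; they are complex in general. The inequalities express \<open>c \<noteq> 0\<close>,
  \<open>a\<^sup>2 \<noteq> 4 * c\<close>, \<open>a \<noteq> b\<close> and
  \<open>b\<^sup>2 \<noteq> 4 * c\<close>.\<close>

locale miquel_quartic =
  fixes a b c :: real and n m :: complex
  assumes a_eq: "complex_of_real a = - (n\<^sup>2 + m\<^sup>2)"
    and c_eq: "complex_of_real c = n\<^sup>2 * m\<^sup>2"
    and n_nonzero: "n \<noteq> 0" and m_nonzero: "m \<noteq> 0" and n_neq_m: "n\<^sup>2 \<noteq> m\<^sup>2"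
    and b_neq_a: "complex_of_real b \<noteq> complex_of_real a"
    and b_sqr: "(complex_of_real b)\<^sup>2 \<noteq> 4 * n\<^sup>2 * m\<^sup>2"
begin

definition \<beta> :: complex where "\<beta> = of_real b"
definition \<eta> :: complex where "\<eta> = 2 * n\<^sup>2 + \<beta>"
definition \<theta> :: complex where "\<theta> = 2 * n * (n\<^sup>2 + m\<^sup>2 + \<beta>)"
definition \<delta> :: complex where "\<delta> = \<beta> + n\<^sup>2 + m\<^sup>2"

text \<open>Inversion about \<open>N = (n : 0 : 1)\<close> turns the quartic into a cubic.  With
  \<open>U = X\<^sup>2 + Y\<^sup>2 - n\<^sup>2 Z\<^sup>2\<close>, \<open>V = X Z - n Z\<^sup>2\<close> and \<open>T = \<eta> U - \<theta> V\<close>, the line \<open>T = 0\<close> is its tangent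
  at the flex \<open>N\<close>, and \<open>u = U / T\<close>, \<open>v = V / T\<close>, \<open>y = Y Z / T\<close> are Weierstrass coordinates.
  Conversely \<open>(X : Y : Z) = (n k + v : y : k)\<close> with \<open>k = Z\<^sup>2 / T\<close>.\<close>

definition v_poly :: "complex poly" where "v_poly = [:- 1 / \<theta>, \<eta> / \<theta>:]"
definition k_poly :: "complex poly" where "k_poly = [:\<delta>:] * v_poly\<^sup>2 - [:0, 1:]\<^sup>2"
definition g :: "complex poly" where
  "g = - [:0, 1:] * (([:0, 1:] - [:n:] * v_poly)\<^sup>2 - [:m:]\<^sup>2 * v_poly\<^sup>2)"

text \<open>The same at \<open>N\<close>, in the coordinates \<open>r = 1 / u\<close> and \<open>w = y / u\<^sup>2\<close>.\<close>

definition v_poly_inf :: "complex poly" where "v_poly_inf = [:\<eta> / \<theta>, - 1 / \<theta>:]"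
definition k_poly_inf :: "complex poly" where "k_poly_inf = [:\<delta>:] * v_poly_inf\<^sup>2 - 1"
definition g_inf :: "complex poly" where
  "g_inf = - [:0, 1:] * ((1 - [:n:] * v_poly_inf)\<^sup>2 - [:m:]\<^sup>2 * v_poly_inf\<^sup>2)"

lemma \<delta>_nonzero: "\<delta> \<noteq> 0"
  using b_neq_a by (simp add: \<delta>_def \<beta>_def a_eq add_eq_0_iff2 add.assoc)

lemma \<theta>_nonzero: "\<theta> \<noteq> 0"
  using \<delta>_nonzero n_nonzero by (simp add: \<theta>_def \<delta>_def add.commute add.left_commute)

text \<open>These inequalities keep the leading coefficients of the two nontrivial linear factors of
  \<open>g\<close> nonzero, and equally make 0 a simple root of \<open>g_inf\<close>.\<close>

lemma \<theta>_neq: "\<theta> \<noteq> (n + m) * \<eta>" "\<theta> \<noteq> (n - m) * \<eta>"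
proof -
  have b: "(\<beta> - 2 * n * m) * (\<beta> + 2 * n * m) \<noteq> 0"
    using b_sqr by (simp add: \<beta>_def algebra_simps power2_eq_square)
  have nm: "(n - m) * (n + m) \<noteq> 0" using n_neq_m by (simp add: algebra_simps power2_eq_square)
  have "\<theta> - (n + m) * \<eta> = (n - m) * (\<beta> - 2 * n * m)" "\<theta> - (n - m) * \<eta> = (n + m) * (\<beta> + 2 * n * m)"
    by (simp_all add: \<theta>_def \<eta>_def algebra_simps power2_eq_square)
  then show "\<theta> \<noteq> (n + m) * \<eta>" "\<theta> \<noteq> (n - m) * \<eta>" using b nm by auto
qed

text \<open>Says that \<open>k_poly_inf\<close> does not vanish at 0: N stays off the line at
  infinity.\<close>

lemma \<theta>_sqr: "\<theta>\<^sup>2 \<noteq> \<delta> * \<eta>\<^sup>2"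
proof -
  have "\<delta> * \<eta>\<^sup>2 - \<theta>\<^sup>2 = \<delta> * (\<beta>\<^sup>2 - 4 * n\<^sup>2 * m\<^sup>2)"
    by (simp add: \<theta>_def \<eta>_def \<delta>_def algebra_simps power2_eq_square)
  then show ?thesis using \<delta>_nonzero b_sqr by (auto simp: \<beta>_def)
qed

text \<open>The roots are the values of \<open>u\<close> at the other three axis points -n, m and
  -m, which are fixed by the reflection and hence become the points of order two.\<close>

lemma g_factors:
  "g = - [:0, 1:] * ([:(n + m) / \<theta>, 1 - (n + m) * \<eta> / \<theta>:] * [:(n - m) / \<theta>, 1 - (n - m) * \<eta> / \<theta>:])"
proof -
  have "g = - [:0, 1:] * (([:0, 1:] - ([:n:] + [:m:]) * v_poly) * ([:0, 1:] - ([:n:] - [:m:]) * v_poly))"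
    by (simp only: g_def power2_eq_square ring_distribs mult_minus_left mult_minus_right ac_simps diff_conv_add_uminus
       minus_add_distrib minus_minus) simp
  then show ?thesis by (simp add: v_poly_def mult.commute)
qed

sublocale separable_cubic g
proof
  let ?p = "[:(n + m) / \<theta>, 1 - (n + m) * \<eta> / \<theta>:]" and ?q = "[:(n - m) / \<theta>, 1 - (n - m) * \<eta> / \<theta>:]"
  have p1: "1 - (n + m) * \<eta> / \<theta> \<noteq> 0" "1 - (n - m) * \<eta> / \<theta> \<noteq> 0"
    using \<theta>_nonzero \<theta>_neq by (simp_all add: field_simps)
  have nm: "n + m \<noteq> 0" "n - m \<noteq> 0" using n_neq_m by (auto simp: add_eq_0_iff2)
  have ne: "[:0, 1:] \<noteq> (0::complex poly)" "?p \<noteq> 0" "?q \<noteq> 0" using p1 by auto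
  have "degree g = degree ([:0, 1:] * (?p * ?q))"
    unfolding g_factors by (simp only: mult_minus_left degree_minus)
  also have "\<dots> = 3"
    using p1 ne by (simp add: degree_mult_eq del: mult_pCons_left mult_pCons_right)
  finally show "degree g = 3" .
  show "poly (pderiv g) x \<noteq> 0" if "poly g x = 0" for x
  proof -
    have pd: "poly (pderiv g) x = - (poly ?p x * poly ?q x)
        - x * ((1 - (n + m) * \<eta> / \<theta>) * poly ?q x + (1 - (n - m) * \<eta> / \<theta>) * poly ?p x)"
    proof -
      have "poly (pderiv (- [:0, 1:] * (p * q))) x =
          - (poly p x * poly q x) - x * (poly (pderiv p) x * poly q x + poly (pderiv q) x * poly p x)"
        for p q :: "complex poly"
        by (simp only: pderiv_minus pderiv_mult mult_minus_left) (simp add: pderiv_pCons algebra_simps)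
      moreover have "poly (pderiv [:z, t:]) x = t" for z t :: complex
        by (simp add: pderiv_pCons)
      ultimately show ?thesis unfolding g_factors by presburger
    qed
    have x: "x = 0 \<or> poly ?p x = 0 \<or> poly ?q x = 0"
    proof -
      have "poly g x = - (x * (poly ?p x * poly ?q x))"
        unfolding g_factors by (simp only: poly_minus poly_mult mult_minus_left) simp
      then show ?thesis using that by (auto simp del: poly_pCons)
    qed
    have res: "\<not> (poly ?p x = 0 \<and> poly ?q x = 0)"
    proof
      assume h: "poly ?p x = 0 \<and> poly ?q x = 0"
      \<comment> \<open>This combination eliminates the constant terms, so a common root could only
        be 0, where neither factor vanishes.\<close>
      have "(n + m) * poly ?q x - (n - m) * poly ?p x = 2 * m * x"
        using \<theta>_nonzero by (simp add: field_simps)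
      then have "x = 0" using h m_nonzero by simp
      then show False using h nm \<theta>_nonzero by simp
    qed
    consider "x = 0" | "x \<noteq> 0" "poly ?p x = 0" | "x \<noteq> 0" "poly ?q x = 0" using x by blast
    then show ?thesis
    proof cases
      case 1
      then show ?thesis unfolding pd using nm \<theta>_nonzero by simp
    next
      case 2
      then show ?thesis unfolding pd using res p1(1) by (simp del: poly_pCons)
    next
      case 3
      then show ?thesis unfolding pd using res p1(2) by (simp del: poly_pCons)
    qed
  qed
qed

lemma pderiv_g_inf: "poly g_inf 0 = 0" "poly (pderiv g_inf) 0 \<noteq> 0"
proof -
  show "poly g_inf 0 = 0" by (simp add: g_inf_def)
  have "poly (pderiv g_inf) 0 = - (1 - n * (\<eta> / \<theta>))\<^sup>2 + m\<^sup>2 * (\<eta> / \<theta>)\<^sup>2"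
    unfolding g_inf_def by (simp only: pderiv_minus pderiv_mult mult_minus_left)
      (simp add: pderiv_pCons v_poly_inf_def mult.commute)
  also have "\<dots> = - ((\<theta> - (n + m) * \<eta>) * (\<theta> - (n - m) * \<eta>)) / \<theta>\<^sup>2"
    using \<theta>_nonzero by (simp add: field_simps power2_eq_square)
  also have "\<dots> \<noteq> 0" using \<theta>_nonzero \<theta>_neq by simp
  finally show "poly (pderiv g_inf) 0 \<noteq> 0" .
qed

definition param_inf :: "complex fps \<times> complex fps" where
  "param_inf = (SOME rw. local_parameter g_inf (0, 0) (fst rw) (snd rw))"

lemma param_inf: "local_parameter g_inf (0, 0) (fst param_inf) (snd param_inf)"
proof -
  have "\<exists>rw. local_parameter g_inf (0, 0) (fst rw) (snd rw)"
    using local_parameter_exists[of "(0, 0)" g_inf] pderiv_g_inf by simp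
  then show ?thesis unfolding param_inf_def by (rule someI_ex)
qed

lemma param_inf_simps:
  "fps_nth (fst param_inf) 0 = 0" "fps_nth (snd param_inf) 0 = 0" "fps_nth (snd param_inf) 1 \<noteq> 0"
  "(snd param_inf)\<^sup>2 = fps_eval g_inf (fst param_inf)"
  using param_inf by (simp_all add: local_parameter_def)

lemma subdegree_param_inf: "subdegree (fst param_inf) = 2"
  using local_parameter_subdegree[OF param_inf] pderiv_g_inf by simp

section \<open>Power series charts of the normalization\<close>

definition chart :: "complex fps \<Rightarrow> complex fps \<Rightarrow> complex fps \<Rightarrow> (complex fps)^3" where
  "chart v y k = vector [fps_const n * k + v, y, k]"

lemma chart_nth [simp]:
  "chart v y k $ 1 = fps_const n * k + v" "chart v y k $ 2 = y" "chart v y k $ 3 = k"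
  by (simp_all add: chart_def)

text \<open>The two quadrics of the space model in coordinates (u : v : y : k). Being homogeneous,
  they serve both scalings: by \<open>T\<close> at affine points and by \<open>u\<^sup>2\<close> in
  addition at N.\<close>

definition chart_eqs :: "complex fps \<Rightarrow> complex fps \<Rightarrow> complex fps \<Rightarrow> complex fps \<Rightarrow> bool" where
  "chart_eqs u v y k \<longleftrightarrow> v\<^sup>2 + y\<^sup>2 = (u - 2 * fps_const n * v) * k \<and>
     (fps_const \<eta> * u - fps_const \<theta> * v) * k = fps_const \<delta> * v\<^sup>2 - u\<^sup>2"

lemma fps_consts:
  "fps_const \<eta> = 2 * (fps_const n)\<^sup>2 + fps_const \<beta>"
  "fps_const \<theta> = 2 * fps_const n * ((fps_const n)\<^sup>2 + (fps_const m)\<^sup>2 + fps_const \<beta>)"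
  "fps_const \<delta> = fps_const \<beta> + (fps_const n)\<^sup>2 + (fps_const m)\<^sup>2"
  "fps_const (complex_of_real a) = - ((fps_const n)\<^sup>2 + (fps_const m)\<^sup>2)"
  "fps_const (complex_of_real b) = fps_const \<beta>"
  "fps_const (complex_of_real c) = (fps_const n)\<^sup>2 * (fps_const m)\<^sup>2"
  by (simp_all add: \<eta>_def \<theta>_def \<delta>_def \<beta>_def a_eq c_eq numeral_fps_const)

abbreviation form_fps :: "(complex fps)^3 \<Rightarrow> complex fps" where
  "form_fps \<equiv> miquel_form (fps_const (of_real a)) (fps_const (of_real b)) (fps_const (of_real c))"

lemma form_fps_expand:
  "form_fps \<phi> = ((\<phi>$1)\<^sup>2 + (\<phi>$2)\<^sup>2)\<^sup>2 - ((fps_const n)\<^sup>2 + (fps_const m)\<^sup>2) * (\<phi>$1)\<^sup>2 * (\<phi>$3)\<^sup>2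
     + fps_const \<beta> * (\<phi>$2)\<^sup>2 * (\<phi>$3)\<^sup>2 + (fps_const n)\<^sup>2 * (fps_const m)\<^sup>2 * (\<phi>$3) ^ 4"
  unfolding miquel_form_def fps_consts(4-6) by (simp only: mult_minus_left add_uminus_conv_diff)

lemma chart_form:
  assumes "chart_eqs u v y k"
  shows "form_fps (chart v y k) = 0"
    and "(chart v y k $ 1)\<^sup>2 + (chart v y k $ 2)\<^sup>2 = k * ((fps_const n)\<^sup>2 * k + u)"
  using miquel_form_chart_identity[of v y u "fps_const n" k "fps_const \<beta>" "fps_const m"] assms
  unfolding chart_eqs_def form_fps_expand chart_nth fps_consts(1-3) by blast+

text \<open>A circle pulls back to \<open>k\<close> times a hyperplane section of the space model;
  the coefficient of \<open>k\<close> inside is the value of the conic at N.\<close>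

lemma conic_form_chart:
  assumes "complex_circle K" "chart_eqs u v y k"
  shows "conic_form (\<chi> i j. fps_const (K$i$j)) (chart v y k) =
    k * (fps_const (n\<^sup>2 * K$1$1 + 2 * n * K$1$3 + K$3$3) * k
      + (fps_const (K$1$1) * u + fps_const (2 * K$1$3) * v + fps_const (2 * K$2$3) * y))"
proof -
  have e: "fps_const (n\<^sup>2 * K$1$1 + 2 * n * K$1$3 + K$3$3) =
      (fps_const n)\<^sup>2 * fps_const (K$1$1) + fps_const n * fps_const (2 * K$1$3) + fps_const (K$3$3)"
    by (simp add: ac_simps)
  show ?thesis
    unfolding conic_form_circle(1)[OF assms(1)]
    unfolding chart_form(2)[OF assms(2)]
    unfolding e chart_nth
    by (simp add: algebra_simps power2_eq_square del: fps_const_mult)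
qed

lemma v_poly_eval: "fps_const \<eta> * u - fps_const \<theta> * fps_eval v_poly u = 1"
proof -
  have "fps_const \<theta> * fps_eval v_poly u = fps_const (\<theta> * (- 1 / \<theta>)) + fps_const (\<theta> * (\<eta> / \<theta>)) * u"
    by (simp add: v_poly_def ring_distribs mult.left_commute mult.commute[of _ u] flip: mult.assoc)
  then show ?thesis using \<theta>_nonzero by simp
qed

lemma v_poly_inf_eval: "fps_const \<eta> - fps_const \<theta> * fps_eval v_poly_inf r = r"
proof -
  have "fps_const \<theta> * fps_eval v_poly_inf r = fps_const (\<theta> * (\<eta> / \<theta>)) + fps_const (\<theta> * (- 1 / \<theta>)) * r"
    by (simp add: v_poly_inf_def ring_distribs mult.left_commute mult.commute[of _ r] flip: mult.assoc)
  then show ?thesis using \<theta>_nonzero by (simp flip: fps_const_neg)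
qed

lemma chart_eqs_affine:
  assumes "y\<^sup>2 = fps_eval g u"
  shows "chart_eqs u (fps_eval v_poly u) y (fps_eval k_poly u)"
proof -
  have y2: "y\<^sup>2 = - u * ((u - fps_const n * fps_eval v_poly u)\<^sup>2 - (fps_const m)\<^sup>2 * (fps_eval v_poly u)\<^sup>2)"
    using assms by (simp add: g_def algebra_simps)
  have k: "fps_eval k_poly u = fps_const \<delta> * (fps_eval v_poly u)\<^sup>2 - u\<^sup>2" by (simp add: k_poly_def)
  show ?thesis
    using quadric_section_identity[OF _ y2, of "fps_const \<beta>" 1] v_poly_eval[of u]
    unfolding chart_eqs_def k fps_consts(1-3) by simp
qed

lemma chart_eqs_inf:
  assumes "w\<^sup>2 = fps_eval g_inf r"
  shows "chart_eqs r (r * fps_eval v_poly_inf r) w (fps_eval k_poly_inf r)"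
proof -
  define v where "v = fps_eval v_poly_inf r"
  define z where "z = - 1 * ((1 - fps_const n * v)\<^sup>2 - (fps_const m)\<^sup>2 * v\<^sup>2)"
  have k: "fps_eval k_poly_inf r = fps_const \<delta> * v\<^sup>2 - 1\<^sup>2" by (simp add: k_poly_inf_def v_def)
  have w: "w\<^sup>2 = r * z" using assms by (simp add: g_inf_def v_def z_def)
  have r: "fps_const \<eta> - fps_const \<theta> * v = r" using v_poly_inf_eval by (simp add: v_def)
  have "v\<^sup>2 * r + z = (1 - 2 * fps_const n * v) * fps_eval k_poly_inf r"
    using quadric_section_identity[OF _ z_def, of "fps_const \<beta>" r] r
    unfolding k fps_consts(1-3) by simp
  then have "r * (v\<^sup>2 * r + z) = r * ((1 - 2 * fps_const n * v) * fps_eval k_poly_inf r)" by simp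
  then have 1: "(r * v)\<^sup>2 + w\<^sup>2 = (r - 2 * fps_const n * (r * v)) * fps_eval k_poly_inf r"
    unfolding w by (simp add: algebra_simps power2_eq_square)
  have "fps_const \<eta> * r - fps_const \<theta> * (r * v) = r * (fps_const \<eta> - fps_const \<theta> * v)"
    by (simp add: algebra_simps)
  then have "(fps_const \<eta> * r - fps_const \<theta> * (r * v)) * fps_eval k_poly_inf r = r * r * (fps_const \<delta> * v\<^sup>2 - 1\<^sup>2)"
    unfolding r k by simp
  then show ?thesis using 1
    unfolding chart_eqs_def v_def[symmetric] by (simp add: algebra_simps power2_eq_square)
qed

definition affine_chart :: "complex fps \<Rightarrow> complex fps \<Rightarrow> (complex fps)^3" where
  "affine_chart u y = chart (fps_eval v_poly u) y (fps_eval k_poly u)"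

definition chart_inf :: "complex fps \<Rightarrow> complex fps \<Rightarrow> (complex fps)^3" where
  "chart_inf r w = chart (r * fps_eval v_poly_inf r) w (fps_eval k_poly_inf r)"

lemma affine_chart_compose:
  "fps_nth \<sigma> 0 = 0 \<Longrightarrow> affine_chart (u oo \<sigma>) (y oo \<sigma>) $ i = affine_chart u y $ i oo \<sigma>"
  using exhaust_3[of i] by (auto simp: affine_chart_def fps_eval_compose fps_compose_add_distrib fps_compose_mult_distrib)

lemma chart_inf_compose:
  "fps_nth \<sigma> 0 = 0 \<Longrightarrow> chart_inf (u oo \<sigma>) (y oo \<sigma>) $ i = chart_inf u y $ i oo \<sigma>"
  using exhaust_3[of i] by (auto simp: chart_inf_def fps_eval_compose fps_compose_add_distrib fps_compose_mult_distrib)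

definition point_chart :: "(complex \<times> complex) option \<Rightarrow> (complex fps)^3" where
  "point_chart p = (case p of None \<Rightarrow> chart_inf (fst param_inf) (snd param_inf)
     | Some P \<Rightarrow> affine_chart (fst (param P)) (snd (param P)))"

lemma point_chart_simps [simp]:
  "point_chart None = chart_inf (fst param_inf) (snd param_inf)"
  "point_chart (Some P) = affine_chart (fst (param P)) (snd (param P))"
  by (simp_all add: point_chart_def)

lemma point_chart_form: "p \<in> pts \<Longrightarrow> form_fps (point_chart p) = 0"
  using chart_form(1)[OF chart_eqs_inf[OF param_inf_simps(4)]]
    chart_form(1)[OF chart_eqs_affine[OF param_simps(3)]]
  by (cases p) (simp_all add: affine_chart_def chart_inf_def)

lemma v_poly_poly: "\<eta> * x - \<theta> * poly v_poly x = 1"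
  using \<theta>_nonzero by (simp add: v_poly_def field_simps)

text \<open>If \<open>v\<close> and \<open>k\<close> both vanish then so does \<open>u\<close>,
  against the scaling \<open>\<eta> u - \<theta> v = 1\<close>.\<close>

lemma affine_chart_center:
  assumes "y\<^sup>2 = fps_eval g u"
  shows "center (affine_chart u y) \<noteq> 0"
proof
  assume "center (affine_chart u y) = 0"
  then have "center (affine_chart u y) $ i = 0" for i by simp
  from this[of 1] this[of 2] this[of 3]
  have h: "fps_nth y 0 = 0" "poly k_poly (fps_nth u 0) = 0" "poly v_poly (fps_nth u 0) = 0"
    by (simp_all add: affine_chart_def)
  then have "fps_nth u 0 = 0" by (simp add: k_poly_def)
  then show False using h(3) v_poly_poly[of 0] by simp
qed

lemma k_poly_inf_0: "poly k_poly_inf 0 \<noteq> 0"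
  using \<theta>_nonzero \<theta>_sqr by (simp add: k_poly_inf_def v_poly_inf_def field_simps)

lemma chart_inf_center:
  assumes "fps_nth r 0 = 0"
  shows "center (chart_inf r w) $ 3 \<noteq> 0"
  using assms k_poly_inf_0 by (simp add: chart_inf_def)

lemma point_chart_center: "p \<in> pts \<Longrightarrow> center (point_chart p) \<noteq> 0"
  using affine_chart_center[OF param_simps(3)] chart_inf_center[OF param_inf_simps(1)]
  by (cases p) (simp_all del: center_nth, metis zero_index)

end

section \<open>Every parametrization comes from a point of the cubic\<close>

text \<open>Each vector has a coordinate that is a unit, so \<open>T\<close> and \<open>Z\<close>
  divide each other and differ by a unit.\<close>

lemma proportional_series:
  fixes f \<phi> :: "(complex fps)^3"
  assumes "\<And>i. T * f$i = Z * \<phi>$i" "T \<noteq> 0" "center f \<noteq> 0" "center \<phi> \<noteq> 0"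
  shows "\<exists>w. fps_nth w 0 \<noteq> 0 \<and> (\<forall>i. \<phi>$i = w * f$i)"
proof -
  have dvd: "B dvd A" if eq: "\<And>i. A * h$i = B * k$i" and ne: "center h \<noteq> 0" for A B and h k :: "(complex fps)^3"
  proof -
    obtain i where i: "fps_nth (h$i) 0 \<noteq> 0" using ne by (auto simp: vec_eq_iff)
    have "A = A * h$i * inverse (h$i)" using inverse_mult_eq_1'[OF i] by (simp add: mult.assoc)
    then have "A = B * (k$i * inverse (h$i))" unfolding eq by (simp add: mult.assoc)
    then show ?thesis by simp
  qed
  have "Z dvd T" using dvd[of T f Z \<phi>] assms by blast
  moreover have "T dvd Z" using dvd[of Z \<phi> T f] assms by metis
  ultimately obtain w w' where w: "T = Z * w" "Z = T * w'" by (elim dvdE)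
  then have "T * (w' * w) = T * 1" by (metis mult.assoc mult.right_neutral)
  then have "w' * w = 1" using assms(2) by simp
  then have "fps_nth w' 0 * fps_nth w 0 = 1" by (metis fps_mult_nth_0 fps_one_nth)
  then have "fps_nth w 0 \<noteq> 0" by auto
  moreover have "\<phi>$i = w * f$i" for i
  proof -
    have "Z * (w * f$i) = Z * \<phi>$i" using assms(1)[of i] w(1) by (simp add: ac_simps)
    moreover have "Z \<noteq> 0" using w(1) assms(2) by auto
    ultimately show ?thesis by simp
  qed
  ultimately show ?thesis by blast
qed

context miquel_quartic
begin

lemma fps_eval_g:
  "fps_eval g u = - u * ((u - fps_const n * fps_eval v_poly u)\<^sup>2 - (fps_const m)\<^sup>2 * (fps_eval v_poly u)\<^sup>2)"
  unfolding g_def fps_eval_mult fps_eval_minus fps_eval_diff fps_eval_power by simp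

lemma fps_eval_g_inf:
  "fps_eval g_inf r =
     - r * ((1 - fps_const n * fps_eval v_poly_inf r)\<^sup>2 - (fps_const m)\<^sup>2 * (fps_eval v_poly_inf r)\<^sup>2)"
  unfolding g_inf_def fps_eval_mult fps_eval_minus fps_eval_diff fps_eval_power by simp

lemma fps_nth_1_power2: "fps_nth (f\<^sup>2) 1 = 2 * fps_nth f 0 * fps_nth f 1" for f :: "complex fps"
  by (simp add: power2_eq_square fps_mult_nth_1)

text \<open>If the first-order term of \<open>(v, y, k)\<close> is \<open>l\<close> times its value,
  the quadrics force the same for \<open>u\<close>. The scaling
  \<open>\<eta> u - \<theta> v = 1\<close> has derivative 0, so \<open>l = 0\<close>, and then
  \<open>u\<close> and \<open>y\<close> are both stationary.\<close>

lemma immersed_affine_chart: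
  assumes y2: "y\<^sup>2 = fps_eval g u" and nz: "fps_nth u 1 \<noteq> 0 \<or> fps_nth y 1 \<noteq> 0"
  shows "immersed (affine_chart u y)"
proof (rule ccontr)
  assume ni: "\<not> immersed (affine_chart u y)"
  define v k where "v = fps_eval v_poly u" and "k = fps_eval k_poly u"
  define u0 u1 y0 y1 v0 v1 k0 k1 where d: "u0 = fps_nth u 0" "u1 = fps_nth u 1" "y0 = fps_nth y 0"
    "y1 = fps_nth y 1" "v0 = fps_nth v 0" "v1 = fps_nth v 1" "k0 = fps_nth k 0" "k1 = fps_nth k 1"
  let ?\<phi> = "affine_chart u y"
  have \<phi>: "?\<phi> = chart v y k" by (simp add: affine_chart_def v_def k_def)
  obtain i where i: "fps_nth (?\<phi>$i) 0 \<noteq> 0"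
    using affine_chart_center[OF y2] by (auto simp: vec_eq_iff)
  define l where "l = fps_nth (?\<phi>$i) 1 / fps_nth (?\<phi>$i) 0"
  have l: "fps_nth (?\<phi>$j) 1 = l * fps_nth (?\<phi>$j) 0" for j
    using ni i unfolding immersed_def l_def by (simp add: field_simps)
  have y1: "y1 = l * y0" and k1: "k1 = l * k0" and v1: "v1 = l * v0"
    using l[of 1] l[of 2] l[of 3] unfolding \<phi> by (simp_all add: d algebra_simps)
  have l1: "fps_const \<eta> * u - fps_const \<theta> * v = 1" unfolding v_def by (rule v_poly_eval)
  have e0: "\<eta> * u0 - \<theta> * v0 = 1" using arg_cong[OF l1, of "\<lambda>f. fps_nth f 0"] by (simp add: d)
  have e1: "\<eta> * u1 = \<theta> * v1" using arg_cong[OF l1, of "\<lambda>f. fps_nth f 1"] by (simp add: d)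
  have two: "2 * fps_const n = fps_const (2 * n)" by (simp add: numeral_fps_const)
  have ce: "v\<^sup>2 + y\<^sup>2 = (u - fps_const (2 * n) * v) * k"
    using chart_eqs_affine[OF y2] unfolding chart_eqs_def two v_def k_def by blast
  have c0: "v0\<^sup>2 + y0\<^sup>2 = (u0 - 2 * n * v0) * k0"
    using arg_cong[OF ce, of "\<lambda>f. fps_nth f 0"] by (simp add: d power2_eq_square)
  have c1: "2 * v0 * v1 + 2 * y0 * y1 = (u0 - 2 * n * v0) * k1 + (u1 - 2 * n * v1) * k0"
    using arg_cong[OF ce, of "\<lambda>f. fps_nth f 1"]
    by (simp add: d fps_nth_1_power2 fps_mult_nth_1 del: One_nat_def)
  have ke: "k = fps_const \<delta> * v\<^sup>2 - u\<^sup>2" by (simp add: k_def v_def k_poly_def)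
  have k0: "k0 = \<delta> * v0\<^sup>2 - u0\<^sup>2"
    using arg_cong[OF ke, of "\<lambda>f. fps_nth f 0"] by (simp add: d power2_eq_square)
  have k1': "k1 = \<delta> * (2 * v0 * v1) - 2 * u0 * u1"
    using arg_cong[OF ke, of "\<lambda>f. fps_nth f 1"] by (simp add: d fps_nth_1_power2 del: One_nat_def)
  \<comment> \<open>Over a node \<open>k0\<close> vanishes and the first quadric no longer involves
    \<open>u1\<close>; there the definition of \<open>k\<close> takes over.\<close>
  have u1: "u1 = l * u0"
  proof (cases "k0 = 0")
    case False
    have "2 * l * (v0\<^sup>2 + y0\<^sup>2) = (u0 - 2 * n * v0) * (l * k0) + (u1 - 2 * n * (l * v0)) * k0"
      using c1 unfolding y1 k1 v1 by (simp add: algebra_simps power2_eq_square)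
    then have "k0 * (2 * l * (u0 - 2 * n * v0)) = k0 * ((u0 - 2 * n * v0) * l + (u1 - 2 * n * (l * v0)))"
      unfolding c0 by (simp add: algebra_simps)
    then have "2 * l * (u0 - 2 * n * v0) = (u0 - 2 * n * v0) * l + (u1 - 2 * n * (l * v0))"
      using False by simp
    then show ?thesis by (simp add: algebra_simps)
  next
    case True
    have "v0 \<noteq> 0"
      using True k0 e0 by auto
    then have "u0 \<noteq> 0" using True k0 \<delta>_nonzero by auto
    moreover have "u0 * u1 = u0 * (l * u0)"
      using k1' k0 True unfolding k1 v1 by (simp add: algebra_simps power2_eq_square)
    ultimately show ?thesis by simp
  qed
  have "\<eta> * u1 = l * (\<theta> * v0)" using e1 v1 by simp
  also have "\<theta> * v0 = \<eta> * u0 - 1" using e0 by (simp add: algebra_simps)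
  finally have "l = 0" unfolding u1 by (simp add: algebra_simps)
  then show False using nz u1 y1 by (simp add: d)
qed

lemma param_immersed:
  assumes "P \<in> curve"
  shows "fps_nth (fst (param P)) 1 \<noteq> 0 \<or> fps_nth (snd (param P)) 1 \<noteq> 0"
  using param_simps(4,5)[OF assms] by blast

lemma immersed_point_chart:
  assumes "p \<in> pts"
  shows "immersed (point_chart p)"
proof (cases p)
  case None
  have "fps_nth (point_chart p $ 3) 0 * fps_nth (point_chart p $ 2) 1
      \<noteq> fps_nth (point_chart p $ 2) 0 * fps_nth (point_chart p $ 3) 1"
    using None param_inf_simps k_poly_inf_0 by (simp add: chart_inf_def)
  then show ?thesis unfolding immersed_def by blast
next
  case (Some P)
  then show ?thesis using assms immersed_affine_chart[OF param_simps(3) param_immersed] by simp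
qed

lemma parametrizationI:
  "form_fps \<phi> = 0 \<Longrightarrow> center \<phi> \<noteq> 0 \<Longrightarrow> immersed \<phi> \<Longrightarrow> parametrization a b c \<phi>"
  unfolding parametrization_def using immersed_imp_irreducible by metis

lemma parametrization_point_chart: "p \<in> pts \<Longrightarrow> parametrization a b c (point_chart p)"
  by (intro parametrizationI point_chart_form point_chart_center immersed_point_chart)

lemma parametrization_nonconstant:
  assumes "parametrization a b c \<phi>"
  shows "\<phi> \<noteq> substituted w 0 \<psi>"
  using assms unfolding parametrization_def by (metis fps_zero_nth)

text \<open>The universal property only yields \<open>\<sigma>\<close> vanishing at 0;
  irreducibility of \<open>\<phi>\<close> supplies the nonzero derivative.\<close>

lemma reparametrizationI:
  assumes "parametrization a b c \<phi>" "fps_nth w 0 \<noteq> 0" "fps_nth \<sigma> 0 = 0" "\<And>i. \<phi>$i = w * (\<psi>$i oo \<sigma>)"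
  shows "reparametrization \<psi> \<phi>"
proof -
  have \<phi>: "\<phi> = substituted w \<sigma> \<psi>" using assms(4) by (simp add: vec_eq_iff)
  then have "fps_nth \<sigma> 1 \<noteq> 0" using assms(1,3) unfolding parametrization_def by blast
  then show ?thesis using \<phi> assms unfolding reparametrization_def by blast
qed

lemma fps_power2_dvd_iff: "f\<^sup>2 dvd h\<^sup>2 \<longleftrightarrow> f dvd h" for f h :: "complex fps"
  by (rule pow_divides_pow_iff) simp

text \<open>Power series form a valuation ring: either \<open>T\<close> divides \<open>U\<close>,
  and \<open>u = U / T\<close> leads to an affine point, or \<open>r = T / U\<close> is a non-unit
  and leads to N. The Weierstrass equation shows that the square of the second coordinate is a power
  series, and hence so is the coordinate itself.\<close>

lemma parametrization_at_point:
  assumes par: "parametrization a b c \<phi>"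
  shows "\<exists>p\<in>pts. reparametrization (point_chart p) \<phi>"
proof -
  define X Y Z where "X = \<phi>$1" and "Y = \<phi>$2" and "Z = \<phi>$3"
  define N M where "N = fps_const n" and "M = fps_const m"
  define U V where "U = X\<^sup>2 + Y\<^sup>2 - N\<^sup>2 * Z\<^sup>2" and "V = X * Z - N * Z\<^sup>2"
  define T where "T = fps_const \<eta> * U - fps_const \<theta> * V"
  have cen: "center \<phi> \<noteq> 0" using par by (simp add: parametrization_def)
  have "(X\<^sup>2 + Y\<^sup>2)\<^sup>2 - (N\<^sup>2 + M\<^sup>2) * X\<^sup>2 * Z\<^sup>2 + fps_const \<beta> * Y\<^sup>2 * Z\<^sup>2 + N\<^sup>2 * M\<^sup>2 * Z ^ 4 = 0"
    using par unfolding parametrization_def form_fps_expand X_def Y_def Z_def N_def M_def by blast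
  from miquel_form_inversion_identity[OF this]
  have i1: "Z\<^sup>2 * T = fps_const \<delta> * V\<^sup>2 - U\<^sup>2" and i2: "(Y * Z)\<^sup>2 * T = - U * ((U - N * V)\<^sup>2 - M\<^sup>2 * V\<^sup>2)"
    unfolding T_def U_def V_def N_def M_def fps_consts(1-3) by blast+
  have i3: "N * Z\<^sup>2 + V = X * Z" by (simp add: V_def)
  \<comment> \<open>If \<open>T = 0\<close> then \<open>U = V = 0\<close>, and the parametrization
    would be constant at a circular point or at N.\<close>
  have T0: "T \<noteq> 0"
  proof
    assume T: "T = 0"
    have "V = 0"
    proof -
      have UV: "fps_const \<eta> * U = fps_const \<theta> * V" using T by (simp add: T_def)
      have "U * ((U - (N + M) * V) * (U - (N - M) * V)) = 0"
        using i2 T by (simp add: algebra_simps power2_eq_square)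
      then consider "U = 0" | "U = (N + M) * V" | "U = (N - M) * V" by auto
      then show ?thesis
      proof cases
        case 1
        then show ?thesis using UV \<theta>_nonzero by simp
      next
        case 2
        then have "fps_const (\<theta> - (n + m) * \<eta>) * V = 0"
          using UV by (auto simp: N_def M_def algebra_simps)
        then show ?thesis using \<theta>_neq by simp
      next
        case 3
        then have "fps_const (\<theta> - (n - m) * \<eta>) * V = 0"
          using UV by (auto simp: N_def M_def algebra_simps)
        then show ?thesis using \<theta>_neq by simp
      qed
    qed
    moreover from this have U: "U = 0" using i1 T by simp
    ultimately have "Z * (X - N * Z) = 0" by (simp add: V_def algebra_simps power2_eq_square)
    then consider "Z = 0" | "X = N * Z" by auto
    then show False
    proof cases
      case 1
      have "(fps_const \<i> * X)\<^sup>2 = - (X\<^sup>2)"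
        by (simp add: power_mult_distrib flip: fps_const_neg)
      then have "Y\<^sup>2 = (fps_const \<i> * X)\<^sup>2"
        using 1 U by (simp add: U_def add_eq_0_iff2)
      then have "Y = fps_const \<i> * X \<or> Y = fps_const (- \<i>) * X"
        by (simp only: power2_eq_iff) (simp flip: fps_const_neg)
      then obtain e where "Y = fps_const e * X" by blast
      then have "\<phi> = substituted X 0 (vector [1, fps_const e, 0])"
        using 1 by (simp add: vec_eq_iff forall_3 X_def Y_def Z_def)
      then show False using parametrization_nonconstant[OF par] by blast
    next
      case 2
      then have "Y = 0" using U by (simp add: U_def power_mult_distrib)
      then have "\<phi> = substituted Z 0 (vector [fps_const n, 0, 1])"
        using 2 by (simp add: vec_eq_iff forall_3 X_def Y_def Z_def N_def)
      then show False using parametrization_nonconstant[OF par] by blast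
    qed
  qed
  show ?thesis
  proof (cases "T dvd U")
    case True
    then obtain u where u: "U = T * u" by (elim dvdE)
    define v where "v = fps_eval v_poly u"
    have "fps_const \<theta> * V = fps_const \<eta> * U - T" by (simp add: T_def)
    also have "\<dots> = T * (fps_const \<eta> * u - 1)" unfolding u by (simp add: algebra_simps)
    also have "fps_const \<eta> * u - 1 = fps_const \<theta> * v"
      using v_poly_eval[of u] by (simp add: v_def algebra_simps)
    finally have V: "V = T * v" using \<theta>_nonzero by (simp add: mult.left_commute)
    have "T * (Y * Z)\<^sup>2 = T * (T\<^sup>2 * fps_eval g u)"
      using i2 unfolding u V fps_eval_g v_def[symmetric] N_def[symmetric] M_def[symmetric]
      by (simp add: algebra_simps power2_eq_square)
    then have YZ2: "(Y * Z)\<^sup>2 = T\<^sup>2 * fps_eval g u" using T0 by simp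
    then have "T\<^sup>2 dvd (Y * Z)\<^sup>2" by simp
    then have "T dvd Y * Z" by (simp only: fps_power2_dvd_iff)
    then obtain y where y: "Y * Z = T * y" by (elim dvdE)
    have y2: "y\<^sup>2 = fps_eval g u" using YZ2 T0 unfolding y by (simp add: power_mult_distrib)
    define P where "P = (fps_nth u 0, fps_nth y 0)"
    have P: "P \<in> curve" using arg_cong[OF y2, of "\<lambda>f. fps_nth f 0"] by (simp add: P_def curve_def power2_eq_square)
    have "fps_nth u 0 = fst P" "fps_nth y 0 = snd P" by (simp_all add: P_def)
    then obtain \<sigma> where s: "fps_nth \<sigma> 0 = 0" and us: "u = fst (param P) oo \<sigma>" and ys: "y = snd (param P) oo \<sigma>"
      using param[OF P] y2 unfolding local_parameter_def by blast
    have "T * (T * fps_eval k_poly u) = T * Z\<^sup>2"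
      using i1 unfolding u V by (simp add: k_poly_def v_def algebra_simps power2_eq_square)
    then have k: "T * fps_eval k_poly u = Z\<^sup>2" using T0 by simp
    have "T * (N * fps_eval k_poly u + v) = Z * X"
      using i3 k V by (simp add: algebra_simps)
    then have eq: "T * affine_chart u y $ i = Z * \<phi> $ i" for i
      using exhaust_3[of i] k y
      by (auto simp: affine_chart_def v_def N_def X_def Y_def Z_def power2_eq_square ac_simps)
    then obtain w where w: "fps_nth w 0 \<noteq> 0" "\<And>i. \<phi>$i = w * affine_chart u y $ i"
      using proportional_series[OF eq T0 affine_chart_center[OF y2] cen] by blast
    have "reparametrization (point_chart (Some P)) \<phi>"
      by (rule reparametrizationI[OF par w(1) s]) (simp add: w(2) us ys affine_chart_compose[OF s])
    then show ?thesis using P by (intro bexI[of _ "Some P"]) simp_all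
  next
    case False
    then have U0: "U \<noteq> 0" by auto
    then have "U dvd T" using False T0 by (simp add: fps_dvd_iff)
    then obtain r where r: "T = U * r" by (elim dvdE)
    have r0: "fps_nth r 0 = 0"
    proof (rule ccontr)
      assume "fps_nth r 0 \<noteq> 0"
      then have "U = T * inverse r" unfolding r by (simp add: mult.assoc inverse_mult_eq_1')
      then show False using False by (metis dvd_triv_left)
    qed
    define v where "v = fps_eval v_poly_inf r"
    have "fps_const \<theta> * V = fps_const \<eta> * U - T" by (simp add: T_def)
    also have "\<dots> = U * (fps_const \<eta> - r)" unfolding r by (simp add: algebra_simps)
    also have "fps_const \<eta> - r = fps_const \<theta> * v"
      using v_poly_inf_eval[of r] by (simp add: v_def algebra_simps)
    finally have V: "V = U * v" using \<theta>_nonzero by (simp add: mult.left_commute)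
    have "U * (Y * Z * r)\<^sup>2 = (Y * Z)\<^sup>2 * T * r" unfolding r by (simp add: power2_eq_square ac_simps)
    also have "\<dots> = U * (U\<^sup>2 * fps_eval g_inf r)"
      unfolding i2 V fps_eval_g_inf v_def[symmetric] N_def[symmetric] M_def[symmetric]
      by (simp add: algebra_simps power2_eq_square)
    finally have YZ2: "(Y * Z * r)\<^sup>2 = U\<^sup>2 * fps_eval g_inf r" using U0 by simp
    then have "U\<^sup>2 dvd (Y * Z * r)\<^sup>2" by simp
    then have "U dvd Y * Z * r" by (simp only: fps_power2_dvd_iff)
    then obtain y where y: "Y * Z * r = U * y" by (elim dvdE)
    have y2: "y\<^sup>2 = fps_eval g_inf r" using YZ2 U0 unfolding y by (simp add: power_mult_distrib)
    have y0: "fps_nth y 0 = 0"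
      using arg_cong[OF y2, of "\<lambda>f. fps_nth f 0"] pderiv_g_inf(1) r0 by simp
    obtain \<sigma> where s: "fps_nth \<sigma> 0 = 0" and us: "r = fst param_inf oo \<sigma>" and ys: "y = snd param_inf oo \<sigma>"
      using param_inf y2 r0 y0 unfolding local_parameter_def fst_conv snd_conv by blast
    have "U * (U * fps_eval k_poly_inf r) = U * (Z\<^sup>2 * r)"
      using i1 unfolding r V by (simp add: k_poly_inf_def v_def algebra_simps power2_eq_square)
    then have k: "U * fps_eval k_poly_inf r = Z\<^sup>2 * r" using U0 by simp
    have "U * (N * fps_eval k_poly_inf r + r * v) = N * (U * fps_eval k_poly_inf r) + V * r"
      unfolding V by (simp add: algebra_simps)
    also have "\<dots> = (N * Z\<^sup>2 + V) * r" unfolding k by (simp add: algebra_simps)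
    also have "\<dots> = Z * r * X" unfolding i3 by (simp add: ac_simps)
    finally have eq: "U * chart_inf r y $ i = (Z * r) * \<phi> $ i" for i
      using exhaust_3[of i] k y
      by (auto simp: chart_inf_def v_def N_def X_def Y_def Z_def power2_eq_square ac_simps)
    have "center (chart_inf r y) \<noteq> 0"
      using chart_inf_center[OF r0, of y] by (metis zero_index)
    then obtain w where w: "fps_nth w 0 \<noteq> 0" "\<And>i. \<phi>$i = w * chart_inf r y $ i"
      using proportional_series[OF eq U0 _ cen] by blast
    have "reparametrization (point_chart None) \<phi>"
      by (rule reparametrizationI[OF par w(1) s]) (simp add: w(2) us ys chart_inf_compose[OF s])
    then show ?thesis by (intro bexI[of _ None]) simp_all
  qed
qed

end

section \<open>Singular points of the quartic\<close>

definition quartic_derivative :: "real \<Rightarrow> real \<Rightarrow> real \<Rightarrow> complex^3 \<Rightarrow> complex^3 \<Rightarrow> complex" where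
  "quartic_derivative a b c p h = 4 * ((p$1)\<^sup>2 + (p$2)\<^sup>2) * (p$1 * h$1 + p$2 * h$2)
     + 2 * of_real a * (p$1 * h$1 * (p$3)\<^sup>2 + (p$1)\<^sup>2 * p$3 * h$3)
     + 2 * of_real b * (p$2 * h$2 * (p$3)\<^sup>2 + (p$2)\<^sup>2 * p$3 * h$3) + 4 * of_real c * (p$3) ^ 3 * h$3"

lemma has_derivative_quartic: "(quartic a b c has_derivative quartic_derivative a b c p) (at p)"
proof -
  have "((\<lambda>v. ((v$1)\<^sup>2 + (v$2)\<^sup>2)\<^sup>2 + of_real a * (v$1)\<^sup>2 * (v$3)\<^sup>2 + of_real b * (v$2)\<^sup>2 * (v$3)\<^sup>2
      + of_real c * (v$3) ^ 4 :: complex) has_derivative quartic_derivative a b c p) (at p)"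
    by (rule derivative_eq_intros bounded_linear.has_derivative[OF bounded_linear_vec_nth] refl)+
      (simp add: quartic_derivative_def fun_eq_iff algebra_simps power2_eq_square power3_eq_cube)
  moreover have "quartic a b c = (\<lambda>v. ((v$1)\<^sup>2 + (v$2)\<^sup>2)\<^sup>2 + of_real a * (v$1)\<^sup>2 * (v$3)\<^sup>2
      + of_real b * (v$2)\<^sup>2 * (v$3)\<^sup>2 + of_real c * (v$3) ^ 4)"
    by (simp add: fun_eq_iff quartic_def miquel_form_def)
  ultimately show ?thesis by simp
qed

lemma singular_point_quartic_iff:
  "singular_point (quartic a b c) p \<longleftrightarrow> p \<noteq> 0 \<and> quartic a b c p = 0 \<and> (\<forall>h. quartic_derivative a b c p h = 0)"
proof -
  have "(quartic a b c has_derivative (\<lambda>_. 0)) (at p) \<longleftrightarrow> quartic_derivative a b c p = (\<lambda>_. 0)"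
    using has_derivative_quartic[of a b c p] has_derivative_unique by metis
  then show ?thesis by (auto simp: singular_point_def)
qed

lemma circular_point_singular:
  assumes "p \<noteq> 0" "p$3 = 0" "(p$1)\<^sup>2 + (p$2)\<^sup>2 = 0"
  shows "singular_point (quartic a b c) p"
  unfolding singular_point_quartic_iff
  using assms by (simp add: quartic_def miquel_form_def quartic_derivative_def)

lemma quartic_at_infinity:
  assumes "quartic a b c p = 0" "p$3 = 0"
  shows "(p$1)\<^sup>2 + (p$2)\<^sup>2 = 0"
  using assms by (simp add: quartic_def miquel_form_def)

text \<open>At a finite singular point the partial derivatives leave four cases, each refuted by one
  hypothesis: the origin by \<open>c\<close>, the rest of the y-axis by
  \<open>b\<^sup>2 \<noteq> 4 * c\<close>, of the x-axis by \<open>a\<^sup>2 \<noteq> 4 * c\<close>,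
  and all other points by \<open>a \<noteq> b\<close>.\<close>

lemma singular_point_at_infinity:
  assumes "a \<noteq> b" "c \<noteq> 0" "a\<^sup>2 \<noteq> 4 * c" "b\<^sup>2 \<noteq> 4 * c" and sing: "singular_point (quartic a b c) p"
  shows "p$3 = 0"
proof (rule ccontr)
  assume z: "p$3 \<noteq> 0"
  define A B C where "A = complex_of_real a" and "B = complex_of_real b" and "C = complex_of_real c"
  have AB: "A \<noteq> B" "C \<noteq> 0" using assms by (simp_all add: A_def B_def C_def)
  have AC: "A\<^sup>2 \<noteq> 4 * C" "B\<^sup>2 \<noteq> 4 * C"
    using assms(3,4) unfolding A_def B_def C_def by (metis of_real_eq_iff of_real_mult of_real_numeral of_real_power)+
  define x y z where "x = p$1" and "y = p$2" and "z = p$3"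
  have z: "z \<noteq> 0" using z by (simp add: z_def)
  have D: "quartic_derivative a b c p h = 0" for h
    using sing by (simp add: singular_point_quartic_iff)
  have x: "x * (2 * (x\<^sup>2 + y\<^sup>2) + A * z\<^sup>2) = 0"
    using D[of "axis 1 1"] by (simp add: quartic_derivative_def axis_def x_def y_def z_def A_def)
      (simp add: algebra_simps; algebra)
  have y: "y * (2 * (x\<^sup>2 + y\<^sup>2) + B * z\<^sup>2) = 0"
    using D[of "axis 2 1"] by (simp add: quartic_derivative_def axis_def x_def y_def z_def B_def)
      (simp add: algebra_simps; algebra)
  have w: "A * x\<^sup>2 + B * y\<^sup>2 + 2 * C * z\<^sup>2 = 0"
  proof -
    have "2 * z * (A * x\<^sup>2 + B * y\<^sup>2 + 2 * C * z\<^sup>2) = 0"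
      using D[of "axis 3 1"]
      by (simp add: quartic_derivative_def axis_def x_def y_def z_def A_def B_def C_def
          algebra_simps power2_eq_square power3_eq_cube)
    then show ?thesis using z by simp
  qed
  have C: "C * z\<^sup>2 \<noteq> 0" using AB z by simp
  show False
  proof (cases "x = 0")
    case True
    then have "y \<noteq> 0" using w C by auto
    then have "2 * y\<^sup>2 + B * z\<^sup>2 = 0" using y True by simp
    moreover have "B * y\<^sup>2 + 2 * C * z\<^sup>2 = 0" using w True by simp
    ultimately have "(B\<^sup>2 - 4 * C) * z\<^sup>2 = 0" by algebra
    then show False using AC z by simp
  next
    case False
    then have x': "2 * (x\<^sup>2 + y\<^sup>2) + A * z\<^sup>2 = 0" using x by simp
    show False
    proof (cases "y = 0")
      case True
      then have "2 * x\<^sup>2 + A * z\<^sup>2 = 0" "A * x\<^sup>2 + 2 * C * z\<^sup>2 = 0" using x' w by simp_all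
      then have "(A\<^sup>2 - 4 * C) * z\<^sup>2 = 0" by algebra
      then show False using AC z by simp
    next
      case False
      then have "2 * (x\<^sup>2 + y\<^sup>2) + B * z\<^sup>2 = 0" using y by simp
      then have "(A - B) * z\<^sup>2 = 0" using x' by algebra
      then show False using AB z by simp
    qed
  qed
qed

text \<open>At a circular point X^2 + Y^2 is divisible by \<open>t\<close> along each line, so
  \<open>t\<^sup>2\<close> divides out exactly and the limit is the value of a polynomial at
  0.\<close>

lemma quartic_tangent_cone:
  assumes "p$3 = 0" "(p$1)\<^sup>2 + (p$2)\<^sup>2 = 0"
  shows "((\<lambda>t. quartic a b c (p + t *s h) / t\<^sup>2) \<longlongrightarrow>
      4 * (p$1 * h$1 + p$2 * h$2)\<^sup>2 + of_real (a - b) * (p$1)\<^sup>2 * (h$3)\<^sup>2) (at 0)"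
proof -
  let ?f = "\<lambda>t. (2 * (p$1 * h$1 + p$2 * h$2) + t * ((h$1)\<^sup>2 + (h$2)\<^sup>2))\<^sup>2
    + (of_real a * (p$1 + t * h$1)\<^sup>2 + of_real b * (p$2 + t * h$2)\<^sup>2) * (h$3)\<^sup>2 + of_real c * t\<^sup>2 * (h$3) ^ 4"
  have p2: "(p$2)\<^sup>2 = - (p$1)\<^sup>2" using assms(2) by (simp add: add_eq_0_iff)
  have "(?f \<longlongrightarrow> ?f 0) (at 0)" by (intro tendsto_intros)
  moreover have "?f 0 = 4 * (p$1 * h$1 + p$2 * h$2)\<^sup>2 + of_real (a - b) * (p$1)\<^sup>2 * (h$3)\<^sup>2"
    by (simp add: p2) (simp add: algebra_simps power2_eq_square)
  ultimately have lim: "(?f \<longlongrightarrow> 4 * (p$1 * h$1 + p$2 * h$2)\<^sup>2 + of_real (a - b) * (p$1)\<^sup>2 * (h$3)\<^sup>2) (at 0)"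
    by simp
  have "?f t = quartic a b c (p + t *s h) / t\<^sup>2" if "t \<noteq> 0" for t
  proof -
    have sq: "(p$1 + t * h$1)\<^sup>2 + (p$2 + t * h$2)\<^sup>2 =
        t * (2 * (p$1 * h$1 + p$2 * h$2) + t * ((h$1)\<^sup>2 + (h$2)\<^sup>2))"
      using assms(2) by (simp add: algebra_simps power2_eq_square)
    have "quartic a b c (p + t *s h) = t\<^sup>2 * ?f t"
      unfolding quartic_def miquel_form_def using assms(1)
      by (simp add: sq power_mult_distrib) (simp add: algebra_simps power2_eq_square power4_eq_xxxx)
    then show ?thesis using that by simp
  qed
  then have "eventually (\<lambda>t. ?f t = quartic a b c (p + t *s h) / t\<^sup>2) (at 0)"
    by (auto simp: eventually_at_filter)
  then show ?thesis using lim by (rule Lim_transform_eventually[rotated])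
qed

lemma circular_point_node:
  assumes "a \<noteq> b" and p: "p \<noteq> 0" "p$3 = 0" "(p$1)\<^sup>2 + (p$2)\<^sup>2 = 0"
  shows "node (quartic a b c) p"
proof -
  have p1: "p$1 \<noteq> 0"
  proof
    assume "p$1 = 0"
    then have "p = 0" using p by (simp add: vec_eq_iff forall_3)
    then show False using p by simp
  qed
  \<comment> \<open>The cone is a difference of two squares, 4 (p.h)^2 - d^2 h_3^2; \<open>l\<close>
    and \<open>m\<close> are its factors.\<close>
  define d where "d = csqrt (of_real (b - a) * (p$1)\<^sup>2)"
  have d2: "d\<^sup>2 = of_real (b - a) * (p$1)\<^sup>2" by (simp add: d_def)
  have d0: "d \<noteq> 0" using p1 assms(1) by (simp add: d_def)
  define l :: "complex^3" where "l = vector [2 * p$1, 2 * p$2, d]"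
  define m :: "complex^3" where "m = vector [2 * p$1, 2 * p$2, - d]"
  have "(\<Sum>i\<in>UNIV. l$i * h$i) * (\<Sum>i\<in>UNIV. m$i * h$i) =
      4 * (p$1 * h$1 + p$2 * h$2)\<^sup>2 + of_real (a - b) * (p$1)\<^sup>2 * (h$3)\<^sup>2" for h
  proof -
    have "(\<Sum>i\<in>UNIV. l$i * h$i) * (\<Sum>i\<in>UNIV. m$i * h$i) = 4 * (p$1 * h$1 + p$2 * h$2)\<^sup>2 - d\<^sup>2 * (h$3)\<^sup>2"
      by (simp add: sum_3 l_def m_def algebra_simps power2_eq_square)
    then show ?thesis unfolding d2 by (simp add: algebra_simps)
  qed
  then have cone: "((\<lambda>t. quartic a b c (p + t *s h) / t\<^sup>2) \<longlongrightarrow>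
      (\<Sum>i\<in>UNIV. l$i * h$i) * (\<Sum>i\<in>UNIV. m$i * h$i)) (at 0)" for h
    using quartic_tangent_cone[OF p(2,3)] by simp
  have "l \<noteq> 0" "m \<noteq> 0" using d0 by (auto simp: l_def m_def vec_eq_iff forall_3)
  moreover have "\<not> same_point l m"
    using d0 p1 by (auto simp: same_point_def l_def m_def vec_eq_iff forall_3)
  ultimately show ?thesis
    unfolding node_def using circular_point_singular[OF p] cone by blast
qed

text \<open>For equal coefficients the cone is the square of a linear form. Comparing coefficients,
  \<open>l\<close> and \<open>m\<close> have no third entry, and the vanishing discriminant of the
  remaining binary form makes them proportional.\<close>

lemma double_line_not_node:
  assumes p: "p$3 = 0" "(p$1)\<^sup>2 + (p$2)\<^sup>2 = 0"
  shows "\<not> node (quartic a a c) p"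
proof
  assume "node (quartic a a c) p"
  then obtain l m where lm: "l \<noteq> 0" "m \<noteq> 0" "\<not> same_point l m" and
    lim: "\<And>h. ((\<lambda>t. quartic a a c (p + t *s h) / t\<^sup>2) \<longlongrightarrow>
      (\<Sum>i\<in>UNIV. l$i * h$i) * (\<Sum>i\<in>UNIV. m$i * h$i)) (at 0)"
    unfolding node_def by blast
  define l1 l2 l3 m1 m2 m3 where d: "l1 = l$1" "l2 = l$2" "l3 = l$3" "m1 = m$1" "m2 = m$2" "m3 = m$3"
  define x y where xy: "x = p$1" "y = p$2"
  have eq_vec: "(l1 * h$1 + l2 * h$2 + l3 * h$3) * (m1 * h$1 + m2 * h$2 + m3 * h$3) = 4 * (x * h$1 + y * h$2)\<^sup>2" for h :: "complex^3"
    using tendsto_unique[OF _ lim quartic_tangent_cone[OF p, of a a c], of h] by (simp add: sum_3 d xy)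
  have eq: "(l1 * r + l2 * s + l3 * t) * (m1 * r + m2 * s + m3 * t) = 4 * (x * r + y * s)\<^sup>2" for r s t
    using eq_vec[of "vector [r, s, t]"] by simp
  have xx: "x\<^sup>2 + y\<^sup>2 = 0" using p by (simp add: xy)
  have e1: "l1 * m1 = 4 * x\<^sup>2" and e2: "l2 * m2 = 4 * y\<^sup>2" and e3: "l3 * m3 = 0"
    using eq[of 1 0 0] eq[of 0 1 0] eq[of 0 0 1] by simp_all
  have e4: "l1 * m2 + l2 * m1 = 8 * x * y"
    using eq[of 1 1 0] e1 e2 by (simp add: algebra_simps power2_eq_square)
  have e5: "l1 * m3 + l3 * m1 = 0" using eq[of 1 0 1] e1 e3 by (simp add: algebra_simps power2_eq_square)
  have e6: "l2 * m3 + l3 * m2 = 0" using eq[of 0 1 1] e2 e3 by (simp add: algebra_simps power2_eq_square)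
  have l: "l1 \<noteq> 0 \<or> l2 \<noteq> 0 \<or> l3 \<noteq> 0" and m: "m1 \<noteq> 0 \<or> m2 \<noteq> 0 \<or> m3 \<noteq> 0"
    using lm(1,2) by (auto simp: d vec_eq_iff forall_3)
  have z: "l3 = 0" "m3 = 0" using e3 e5 e6 l m by auto
  have "(l1 * m2 - l2 * m1)\<^sup>2 = (l1 * m2 + l2 * m1)\<^sup>2 - 4 * (l1 * m1) * (l2 * m2)"
    by (simp add: algebra_simps power2_eq_square)
  also have "\<dots> = 0" unfolding e1 e2 e4 by (simp add: algebra_simps power2_eq_square)
  finally have e7: "l1 * m2 = l2 * m1" by simp
  have "\<exists>k. k \<noteq> 0 \<and> m1 = k * l1 \<and> m2 = k * l2"
  proof (cases "l1 = 0")
    case True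
    then have "m1 = 0" "l2 \<noteq> 0" using e7 l z by auto
    then show ?thesis using m z True by (intro exI[of _ "m2 / l2"]) auto
  next
    case False
    then have "m1 \<noteq> 0" using e7 m z by auto
    then show ?thesis using False e7 by (intro exI[of _ "m1 / l1"]) (auto simp: field_simps)
  qed
  then have "same_point l m" using z by (auto simp: same_point_def vec_eq_iff forall_3 d)
  then show False using lm by simp
qed

text \<open>Both circular points are always singular, so they exhaust the two nodes. A failing
  inequality would give a finite singular point or, for \<open>a = b\<close>, a double tangent at a
  node.\<close>

lemma nondegenerate_binodal_imp:
  assumes "nondegenerate_binodal (quartic a b c)"
  shows "a \<noteq> b" "c \<noteq> 0" "a\<^sup>2 \<noteq> 4 * c" "b\<^sup>2 \<noteq> 4 * c"
proof -
  obtain p1 p2 where n: "node (quartic a b c) p1" "node (quartic a b c) p2" "\<not> same_point p1 p2"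
    and all: "\<And>p. singular_point (quartic a b c) p \<Longrightarrow> same_point p1 p \<or> same_point p2 p"
    using assms unfolding nondegenerate_binodal_def by blast
  define I J :: "complex^3" where "I = vector [1, \<i>, 0]" and "J = vector [1, - \<i>, 0]"
  have "singular_point (quartic a b c) I" "singular_point (quartic a b c) J"
    by (rule circular_point_singular; simp add: I_def J_def vec_eq_iff forall_3)+
  then have IJ: "same_point p1 I \<or> same_point p2 I" "same_point p1 J \<or> same_point p2 J" using all by auto
  have nIJ: "\<not> (same_point q I \<and> same_point q J)" for q
  proof
    assume "same_point q I \<and> same_point q J"
    then obtain k k' where "k * q$1 = 1" "k * q$2 = \<i>" "k' * q$1 = 1" "k' * q$2 = - \<i>"
      by (auto simp: same_point_def I_def J_def vec_eq_iff forall_3)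
    then have "k * q$2 * (k' * q$1) = \<i>" "k' * q$2 * (k * q$1) = - \<i>" by simp_all
    then show False by (simp add: ac_simps)
  qed
  have at_inf: "q$3 = 0 \<and> (q$1)\<^sup>2 + (q$2)\<^sup>2 = 0" if q: "same_point q I \<or> same_point q J" for q
  proof -
    obtain e where "e = \<i> \<or> e = - \<i>" and "same_point q (vector [1, e, 0])"
      using q unfolding I_def J_def by blast
    then obtain k where e: "e\<^sup>2 = - 1" and k: "k \<noteq> 0" "k * q$1 = 1" "k * q$2 = e" "k * q$3 = 0"
      by (auto simp: same_point_def vec_eq_iff forall_3)
    have "k\<^sup>2 * ((q$1)\<^sup>2 + (q$2)\<^sup>2) = (k * q$1)\<^sup>2 + (k * q$2)\<^sup>2"
      by (simp add: algebra_simps power2_eq_square)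
    then show ?thesis using k(1,4) e unfolding k(2,3) by simp
  qed
  have p: "p1$3 = 0" "(p1$1)\<^sup>2 + (p1$2)\<^sup>2 = 0" "p2$3 = 0"
    using IJ nIJ at_inf by blast+
  show "a \<noteq> b" using double_line_not_node[OF p(1,2)] n(1) by auto
  have inf: "q$3 = 0" if "singular_point (quartic a b c) q" for q
    using all[OF that] p by (auto simp: same_point_def)
  show "c \<noteq> 0"
  proof
    assume "c = 0"
    then have "singular_point (quartic a b c) (vector [0, 0, 1])"
      unfolding singular_point_quartic_iff
      by (simp add: quartic_def miquel_form_def quartic_derivative_def vec_eq_iff forall_3)
    then show False using inf by fastforce
  qed
  show "a\<^sup>2 \<noteq> 4 * c"
  proof
    assume ac: "a\<^sup>2 = 4 * c"
    \<comment> \<open>If \<open>a\<^sup>2 = 4 * c\<close>, the restriction to the x-axis is (x^2 +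
      a/2)^2, which has double roots.\<close>
    define x where "x = csqrt (- of_real a / 2)"
    have x: "x\<^sup>2 = - of_real a / 2" by (simp add: x_def)
    have c: "complex_of_real c = (of_real a)\<^sup>2 / 4" using ac by (simp flip: of_real_power)
    have "singular_point (quartic a b c) (vector [x, 0, 1])"
      unfolding singular_point_quartic_iff
      by (simp add: quartic_def miquel_form_def quartic_derivative_def vec_eq_iff forall_3 c x)
        (simp add: algebra_simps power2_eq_square)
    then show False using inf by fastforce
  qed
  show "b\<^sup>2 \<noteq> 4 * c"
  proof
    assume bc: "b\<^sup>2 = 4 * c"
    define y where "y = csqrt (- of_real b / 2)"
    have y: "y\<^sup>2 = - of_real b / 2" by (simp add: y_def)
    have c: "complex_of_real c = (of_real b)\<^sup>2 / 4" using bc by (simp flip: of_real_power)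
    have "singular_point (quartic a b c) (vector [0, y, 1])"
      unfolding singular_point_quartic_iff
      by (simp add: quartic_def miquel_form_def quartic_derivative_def vec_eq_iff forall_3 c y)
        (simp add: algebra_simps power2_eq_square)
    then show False using inf by fastforce
  qed
qed

lemma node_quartic_iff:
  assumes "a \<noteq> b" "c \<noteq> 0" "a\<^sup>2 \<noteq> 4 * c" "b\<^sup>2 \<noteq> 4 * c" "p \<noteq> 0" "quartic a b c p = 0"
  shows "node (quartic a b c) p \<longleftrightarrow> p$3 = 0"
  using circular_point_node[OF assms(1,5) _ quartic_at_infinity[OF assms(6)], of c]
    singular_point_at_infinity[OF assms(1-4)] by (auto simp: node_def)

section \<open>Places and circles\<close>

lemma count_image_mset_inj_on:
  assumes "inj_on f A" "set_mset M \<subseteq> A" "x \<in> A"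
  shows "count (image_mset f M) (f x) = count M x"
  using assms(2) by (induction M) (use assms(1,3) in \<open>auto dest: inj_onD\<close>)

lemma size_3_mset:
  assumes "size M = 3"
  shows "\<exists>x y z. M = {#x, y, z#}"
proof -
  obtain x M1 where "M = add_mset x M1" "size M1 = 2"
    using assms size_eq_Suc_imp_eq_union[of M 2] by auto
  moreover from this obtain y M2 where "M1 = add_mset y M2" "size M2 = 1"
    using size_eq_Suc_imp_eq_union[of M1 1] by auto
  moreover from this obtain z where "M2 = {#z#}" using size_1_singleton_mset by metis
  ultimately show ?thesis by blast
qed

definition flip :: "(complex fps)^3 \<Rightarrow> (complex fps)^3" where
  "flip \<phi> = vector [\<phi>$1, - \<phi>$2, \<phi>$3]"

lemma flip_nth [simp]: "flip \<phi> $ 1 = \<phi>$1" "flip \<phi> $ 2 = - \<phi>$2" "flip \<phi> $ 3 = \<phi>$3"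
  by (simp_all add: flip_def)

lemma flip_flip [simp]: "flip (flip \<phi>) = \<phi>"
  by (simp add: vec_eq_iff forall_3)

lemma flip_substituted: "flip (substituted w \<sigma> \<phi>) = substituted w \<sigma> (flip \<phi>)"
  by (simp add: vec_eq_iff forall_3 fps_compose_uminus)

lemma reflection_eq: "reflection P = flip ` P"
  by (simp add: reflection_def flip_def[abs_def])

lemma parametrization_flip:
  assumes "parametrization a b c \<phi>"
  shows "parametrization a b c (flip \<phi>)"
  unfolding parametrization_def
proof (intro conjI)
  show "center (flip \<phi>) \<noteq> 0"
    using assms by (simp add: parametrization_def vec_eq_iff forall_3)
  show "miquel_form (fps_const (complex_of_real a)) (fps_const (of_real b)) (fps_const (of_real c)) (flip \<phi>) = 0"
    using assms by (simp add: parametrization_def miquel_form_def)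
  show "\<not> (\<exists>\<psi> u \<sigma>. fps_nth \<sigma> 0 = 0 \<and> fps_nth \<sigma> 1 = 0 \<and> flip \<phi> = substituted u \<sigma> \<psi>)"
    using assms unfolding parametrization_def by (metis flip_flip flip_substituted)
qed

lemma reparametrization_flip:
  "reparametrization \<phi> \<psi> \<Longrightarrow> reparametrization (flip \<phi>) (flip \<psi>)"
  unfolding reparametrization_def using flip_substituted by metis

context miquel_quartic
begin

lemma real_nondegenerate: "a \<noteq> b" "c \<noteq> 0" "a\<^sup>2 \<noteq> 4 * c" "b\<^sup>2 \<noteq> 4 * c"
proof -
  show "a \<noteq> b" using b_neq_a by auto
  show "c \<noteq> 0" using c_eq n_nonzero m_nonzero by auto
  show "a\<^sup>2 \<noteq> 4 * c"
  proof
    assume "a\<^sup>2 = 4 * c"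
    then have "(complex_of_real a)\<^sup>2 = 4 * of_real c" by (metis of_real_mult of_real_numeral of_real_power)
    then have "(n\<^sup>2 - m\<^sup>2)\<^sup>2 = 0" unfolding a_eq c_eq by (simp add: algebra_simps power2_eq_square)
    then show False using n_neq_m by simp
  qed
  show "b\<^sup>2 \<noteq> 4 * c"
  proof
    assume "b\<^sup>2 = 4 * c"
    then have "(complex_of_real b)\<^sup>2 = 4 * of_real c" by (metis of_real_mult of_real_numeral of_real_power)
    then show False using b_sqr unfolding c_eq by simp
  qed
qed

text \<open>Both forms are quadratic, so a unit factor \<open>w\<close> changes each by
  \<open>w\<^sup>2\<close>; their ratio \<open>u\<close> is therefore attached to the place, up to
  the change of parameter.\<close>

definition U_form :: "(complex fps)^3 \<Rightarrow> complex fps" where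
  "U_form \<phi> = (\<phi>$1)\<^sup>2 + (\<phi>$2)\<^sup>2 - (fps_const n)\<^sup>2 * (\<phi>$3)\<^sup>2"

definition T_form :: "(complex fps)^3 \<Rightarrow> complex fps" where
  "T_form \<phi> = fps_const \<eta> * U_form \<phi> - fps_const \<theta> * (\<phi>$1 * \<phi>$3 - fps_const n * (\<phi>$3)\<^sup>2)"

lemma U_form_chart: "chart_eqs u v y k \<Longrightarrow> U_form (chart v y k) = k * u"
  unfolding U_form_def chart_form(2) chart_nth(3) by (simp add: algebra_simps power2_eq_square)

lemma T_form_chart: "chart_eqs u v y k \<Longrightarrow> T_form (chart v y k) = k * (fps_const \<eta> * u - fps_const \<theta> * v)"
  unfolding T_form_def U_form_chart chart_nth by (simp add: algebra_simps power2_eq_square)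

lemma forms_substituted:
  assumes "fps_nth \<sigma> 0 = 0"
  shows "U_form (substituted w \<sigma> \<phi>) = w\<^sup>2 * (U_form \<phi> oo \<sigma>)"
    "T_form (substituted w \<sigma> \<phi>) = w\<^sup>2 * (T_form \<phi> oo \<sigma>)"
proof -
  show "U_form (substituted w \<sigma> \<phi>) = w\<^sup>2 * (U_form \<phi> oo \<sigma>)"
    by (simp add: U_form_def fps_compose_add_distrib fps_compose_sub_distrib
      fps_compose_mult_distrib[OF assms] power2_eq_square) (simp add: algebra_simps)
  then show "T_form (substituted w \<sigma> \<phi>) = w\<^sup>2 * (T_form \<phi> oo \<sigma>)"
    by (simp add: T_form_def fps_compose_sub_distrib fps_compose_mult_distrib[OF assms] power2_eq_square)
      (simp add: algebra_simps)
qed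

lemma forms_affine:
  assumes "P \<in> curve"
  shows "T_form (point_chart (Some P)) = fps_eval k_poly (fst (param P))"
    and "U_form (point_chart (Some P)) = fps_eval k_poly (fst (param P)) * fst (param P)"
  using T_form_chart[OF chart_eqs_affine[OF param_simps(3)[OF assms]]]
    U_form_chart[OF chart_eqs_affine[OF param_simps(3)[OF assms]]] v_poly_eval
  by (simp_all add: affine_chart_def)

lemma forms_inf:
  "T_form (point_chart None) = U_form (point_chart None) * fst param_inf"
proof -
  let ?r = "fst param_inf"
  have "fps_const \<eta> * ?r - fps_const \<theta> * (?r * fps_eval v_poly_inf ?r) =
      ?r * (fps_const \<eta> - fps_const \<theta> * fps_eval v_poly_inf ?r)"
    by (simp add: algebra_simps)
  then have "fps_const \<eta> * ?r - fps_const \<theta> * (?r * fps_eval v_poly_inf ?r) = ?r * ?r"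
    unfolding v_poly_inf_eval .
  then show ?thesis
    using T_form_chart[OF chart_eqs_inf[OF param_inf_simps(4)]]
      U_form_chart[OF chart_eqs_inf[OF param_inf_simps(4)]]
    by (simp add: chart_inf_def)
qed

lemma k_poly_nonzero: "k_poly \<noteq> 0"
proof
  assume "k_poly = 0"
  then have "poly k_poly 0 = 0" by simp
  then show False using \<delta>_nonzero \<theta>_nonzero by (simp add: k_poly_def v_poly_def)
qed

lemma k_nonzero: "P \<in> curve \<Longrightarrow> fps_eval k_poly (fst (param P)) \<noteq> 0"
  using fps_eval_param(1) k_poly_nonzero by blast

text \<open>The coordinates \<open>u\<close> and \<open>y\<close> are free of the unit factor, so
  equivalent charts have the same constant terms. An affine point cannot be equivalent to N, where
  \<open>T = U r\<close> with \<open>r\<close> vanishing.\<close>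

lemma point_chart_inj:
  assumes "p \<in> pts" "q \<in> pts" "reparametrization (point_chart p) (point_chart q)"
  shows "p = q"
proof -
  have mixed: "\<not> reparametrization (point_chart None) (point_chart (Some Q))" if Q: "Q \<in> curve" for Q
  proof
    assume "reparametrization (point_chart None) (point_chart (Some Q))"
    then obtain w \<sigma> where s: "fps_nth \<sigma> 0 = 0"
      and eq: "point_chart (Some Q) = substituted w \<sigma> (point_chart None)"
      unfolding reparametrization_def by blast
    have "T_form (point_chart (Some Q)) = U_form (point_chart (Some Q)) * (fst param_inf oo \<sigma>)"
      unfolding eq forms_substituted[OF s] forms_inf by (simp add: fps_compose_mult_distrib[OF s] mult.assoc)
    then have "fps_eval k_poly (fst (param Q)) * 1 =
        fps_eval k_poly (fst (param Q)) * (fst (param Q) * (fst param_inf oo \<sigma>))"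
      unfolding forms_affine[OF Q] by (simp add: mult.assoc)
    then have "1 = fst (param Q) * (fst param_inf oo \<sigma>)" using k_nonzero[OF Q] by simp
    from arg_cong[OF this, of "\<lambda>f. fps_nth f 0"] show False using param_inf_simps(1) by simp
  qed
  show ?thesis
  proof (cases p; cases q)
    fix P Q assume pq: "p = Some P" "q = Some Q"
    then have P: "P \<in> curve" and Q: "Q \<in> curve" using assms by auto
    obtain w \<sigma> where s: "fps_nth \<sigma> 0 = 0"
      and eq: "point_chart (Some Q) = substituted w \<sigma> (point_chart (Some P))"
      using assms(3) pq unfolding reparametrization_def by blast
    let ?kP = "fps_eval k_poly (fst (param P)) oo \<sigma>" and ?kQ = "fps_eval k_poly (fst (param Q))"
    have k: "?kQ = w\<^sup>2 * ?kP"
      using forms_substituted(2)[OF s, of w "point_chart (Some P)"]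
      unfolding eq[symmetric] forms_affine[OF P] forms_affine[OF Q] .
    have "?kQ * fst (param Q) = w\<^sup>2 * ?kP * (fst (param P) oo \<sigma>)"
      using forms_substituted(1)[OF s, of w "point_chart (Some P)"]
      unfolding eq[symmetric] forms_affine[OF P] forms_affine[OF Q] fps_compose_mult_distrib[OF s]
      by (simp add: mult.assoc)
    then have u: "fst (param Q) = fst (param P) oo \<sigma>" using k_nonzero[OF Q] unfolding k[symmetric] by simp
    have "snd (param Q) * ?kQ = w * (snd (param P) oo \<sigma>) * (w * ?kP)"
      using eq by (simp add: vec_eq_iff forall_3 affine_chart_def)
    also have "\<dots> = (snd (param P) oo \<sigma>) * ?kQ" unfolding k by (simp add: power2_eq_square)
    finally have y: "snd (param Q) = snd (param P) oo \<sigma>" using k_nonzero[OF Q] by simp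
    have "P = Q"
      using arg_cong[OF u, of "\<lambda>f. fps_nth f 0"] arg_cong[OF y, of "\<lambda>f. fps_nth f 0"]
        param_simps(1,2)[OF P] param_simps(1,2)[OF Q] by (simp add: prod_eq_iff)
    then show ?thesis using pq by simp
  qed (use assms mixed reparametrization_sym in auto)
qed

section \<open>The normalization as the set of points of the cubic\<close>

definition place :: "(complex \<times> complex) option \<Rightarrow> place" where
  "place p = {\<phi>. parametrization a b c \<phi> \<and> reparametrization (point_chart p) \<phi>}"

lemma point_chart_in_place: "p \<in> pts \<Longrightarrow> point_chart p \<in> place p"
  by (simp add: place_def parametrization_point_chart reparametrization_refl)

lemma inj_place: "inj_on place pts"
proof (rule inj_onI)
  fix p q assume "p \<in> pts" "q \<in> pts" "place p = place q"
  then have "reparametrization (point_chart p) (point_chart q)"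
    using point_chart_in_place unfolding place_def by blast
  then show "p = q" using point_chart_inj \<open>p \<in> pts\<close> \<open>q \<in> pts\<close> by blast
qed

lemma normalization_eq: "normalization a b c = place ` pts"
proof -
  let ?E = "{(\<phi>, \<psi>). parametrization a b c \<phi> \<and> parametrization a b c \<psi> \<and> reparametrization \<phi> \<psi>}"
  have E: "?E `` {\<phi>} = place p" if "p \<in> pts" "parametrization a b c \<phi>" "reparametrization (point_chart p) \<phi>" for p \<phi>
  proof -
    have "reparametrization \<phi> \<psi> \<longleftrightarrow> reparametrization (point_chart p) \<psi>" for \<psi>
      using that(3) reparametrization_trans reparametrization_sym by blast
    then show ?thesis using that by (auto simp: place_def)
  qed
  show ?thesis
  proof
    show "normalization a b c \<subseteq> place ` pts"
    proof
      fix P assume "P \<in> normalization a b c"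
      then obtain \<phi> where "parametrization a b c \<phi>" "P = ?E `` {\<phi>}"
        unfolding normalization_def by (auto elim!: quotientE)
      then show "P \<in> place ` pts" using E parametrization_at_point by blast
    qed
    show "place ` pts \<subseteq> normalization a b c"
    proof
      fix P assume "P \<in> place ` pts"
      then obtain p where p: "p \<in> pts" "P = place p" by blast
      have P: "P = ?E `` {point_chart p}"
        using E[OF p(1) parametrization_point_chart[OF p(1)] reparametrization_refl] p(2) by simp
      show "P \<in> normalization a b c"
        unfolding normalization_def P
        by (rule quotientI) (simp add: parametrization_point_chart[OF p(1)])
    qed
  qed
qed

lemma representative_place:
  assumes "p \<in> pts"
  obtains w \<sigma> where "fps_nth w 0 \<noteq> 0" "fps_nth \<sigma> 0 = 0" "fps_nth \<sigma> 1 \<noteq> 0"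
    "representative (place p) = substituted w \<sigma> (point_chart p)" "parametrization a b c (representative (place p))"
proof -
  have "representative (place p) \<in> place p"
    unfolding representative_def using point_chart_in_place[OF assms] by (rule someI)
  then show ?thesis using that unfolding place_def reparametrization_def by blast
qed

text \<open>Reflection negates \<open>y\<close> and yields a formal solution through the opposite
  point; the universal property there provides the substitution.\<close>

lemma reparametrization_flip_chart:
  assumes "p \<in> pts"
  shows "reparametrization (point_chart (opp p)) (flip (point_chart p))"
proof -
  have par: "parametrization a b c (flip (point_chart p))"
    using parametrization_flip parametrization_point_chart[OF assms] by blast
  show ?thesis
  proof (cases p)
    case None
    have "fps_nth (fst param_inf) 0 = 0" "fps_nth (- snd param_inf) 0 = 0"
      "(- snd param_inf)\<^sup>2 = fps_eval g_inf (fst param_inf)"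
      by (simp_all add: param_inf_simps)
    then obtain \<sigma> where s: "fps_nth \<sigma> 0 = 0" "fst param_inf = fst param_inf oo \<sigma>"
        "- snd param_inf = snd param_inf oo \<sigma>"
      using param_inf unfolding local_parameter_def fst_conv snd_conv by blast
    have "flip (point_chart p) $ i = chart_inf (fst param_inf) (- snd param_inf) $ i" for i
      using None exhaust_3[of i] by (auto simp: chart_inf_def)
    moreover have "chart_inf (fst param_inf) (- snd param_inf) $ i =
        chart_inf (fst param_inf) (snd param_inf) $ i oo \<sigma>" for i
      using chart_inf_compose[OF s(1), of "fst param_inf" "snd param_inf" i]
      unfolding s(2,3)[symmetric] .
    ultimately show ?thesis
      using reparametrizationI[OF par _ s(1), of 1 "point_chart (opp p)"] None by simp
  next
    case (Some P)
    then have P: "P \<in> curve" using assms by simp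
    then have P': "neg P \<in> curve" by simp
    have "fps_nth (fst (param P)) 0 = fst (neg P)" "fps_nth (- snd (param P)) 0 = snd (neg P)"
      "(- snd (param P))\<^sup>2 = fps_eval g (fst (param P))"
      using param_simps[OF P] by (simp_all add: neg_def)
    then obtain \<sigma> where s: "fps_nth \<sigma> 0 = 0" "fst (param P) = fst (param (neg P)) oo \<sigma>"
        "- snd (param P) = snd (param (neg P)) oo \<sigma>"
      using param[OF P'] unfolding local_parameter_def by blast
    have "flip (point_chart p) $ i = affine_chart (fst (param P)) (- snd (param P)) $ i" for i
      using Some exhaust_3[of i] by (auto simp: affine_chart_def)
    moreover have "affine_chart (fst (param P)) (- snd (param P)) $ i =
        affine_chart (fst (param (neg P))) (snd (param (neg P))) $ i oo \<sigma>" for i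
      using affine_chart_compose[OF s(1), of "fst (param (neg P))" "snd (param (neg P))" i]
      unfolding s(2,3)[symmetric] .
    ultimately show ?thesis
      using reparametrizationI[OF par _ s(1), of 1 "point_chart (opp p)"] Some by simp
  qed
qed

lemma reflection_place:
  assumes "p \<in> pts"
  shows "reflection (place p) = place (opp p)"
proof -
  have *: "flip \<phi> \<in> place (opp q)" if "q \<in> pts" "\<phi> \<in> place q" for q \<phi>
    using that reparametrization_trans[OF reparametrization_flip_chart reparametrization_flip] parametrization_flip
    by (auto simp: place_def)
  show ?thesis
  proof
    show "reflection (place p) \<subseteq> place (opp p)" using * assms by (auto simp: reflection_eq)
    show "place (opp p) \<subseteq> reflection (place p)"
    proof
      fix \<phi> assume "\<phi> \<in> place (opp p)"
      then have "flip \<phi> \<in> place p" using *[of "opp p" \<phi>] assms by simp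
      then have "flip (flip \<phi>) \<in> reflection (place p)" unfolding reflection_eq by blast
      then show "\<phi> \<in> reflection (place p)" by simp
    qed
  qed
qed

end

section \<open>Circles through N and their residual divisors\<close>

context miquel_quartic
begin

text \<open>The value of the conic at N = (n : 0 : 1), hence zero exactly for circles through
  N.\<close>

definition circle_constant :: "complex^3^3 \<Rightarrow> complex" where
  "circle_constant K = n\<^sup>2 * K$1$1 + 2 * n * K$1$3 + K$3$3"

text \<open>Inserting \<open>v = (\<eta> u - 1) / \<theta>\<close> into the linear form of the
  circle in \<open>u\<close>, \<open>v\<close>, \<open>y\<close> gives
  \<open>A(u) + B y\<close>.\<close>

definition circle_A :: "complex^3^3 \<Rightarrow> complex poly" where
  "circle_A K = [:- 2 * K$1$3 / \<theta>, K$1$1 + 2 * K$1$3 * \<eta> / \<theta>:]"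

definition circle_B :: "complex^3^3 \<Rightarrow> complex poly" where
  "circle_B K = [:2 * K$2$3:]"

lemma circle_poly_nonzero:
  assumes "complex_circle K" "circle_constant K = 0"
  shows "circle_A K \<noteq> 0 \<or> circle_B K \<noteq> 0"
proof (rule ccontr)
  assume "\<not> ?thesis"
  then have "K$1$3 = 0" "K$1$1 = 0" "K$2$3 = 0"
    using \<theta>_nonzero by (auto simp: circle_A_def circle_B_def)
  then have "K = 0"
    using conic_form_circle(2-6)[OF assms(1)] assms(2)
    by (simp add: vec_eq_iff forall_3 circle_constant_def)
  then show False using assms(1) by (simp add: complex_circle_def)
qed

text \<open>Unit factors and invertible substitutions preserve the order of vanishing, so the
  arbitrary choice in \<open>representative\<close> is harmless.\<close>

lemma pullback_place:
  assumes "p \<in> pts"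
  shows "pullback_multiplicity K (place p) = subdegree (conic_form (\<chi> i j. fps_const (K$i$j)) (point_chart p))"
proof -
  obtain w \<sigma> where w: "fps_nth w 0 \<noteq> 0" and s: "fps_nth \<sigma> 0 = 0" "fps_nth \<sigma> 1 \<noteq> 0"
    and rep: "representative (place p) = substituted w \<sigma> (point_chart p)"
    using representative_place[OF assms] by metis
  let ?f = "conic_form (\<chi> i j. fps_const (K$i$j)) (point_chart p)"
  have sd: "subdegree (?f oo \<sigma>) = subdegree ?f"
    using subdegree_compose[OF s(1)] subdegree_eq_1I[OF s] by simp
  have "subdegree (w\<^sup>2 * (?f oo \<sigma>)) = subdegree ?f"
  proof (cases "?f oo \<sigma> = 0")
    case True
    then show ?thesis using sd by simp
  next
    case False
    have "w \<noteq> 0" "subdegree w = 0" using w by (auto simp: subdegree_eq_0)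
    then show ?thesis using False sd by simp
  qed
  then show ?thesis unfolding pullback_multiplicity_def rep conic_form_substituted[OF s(1)] .
qed

lemma node_place:
  assumes "p \<in> pts"
  shows "node (quartic a b c) (center (representative (place p))) \<longleftrightarrow> fps_nth (point_chart p $ 3) 0 = 0"
proof -
  obtain w \<sigma> where w: "fps_nth w 0 \<noteq> 0"
    and rep: "representative (place p) = substituted w \<sigma> (point_chart p)"
    and par: "parametrization a b c (representative (place p))"
    using representative_place[OF assms] by metis
  have "center (representative (place p)) \<noteq> 0" using par by (simp add: parametrization_def)
  moreover have "quartic a b c (center (representative (place p))) = 0"
  proof -
    have "fps_nth (form_fps (representative (place p))) 0 = 0" using par by (simp add: parametrization_def)
    then show ?thesis by (simp add: quartic_def miquel_form_def power2_eq_square power4_eq_xxxx)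
  qed
  ultimately have "node (quartic a b c) (center (representative (place p))) \<longleftrightarrow>
      center (representative (place p)) $ 3 = 0"
    using node_quartic_iff real_nondegenerate by blast
  then show ?thesis using w by (simp add: rep)
qed

text \<open>At the four places over the nodes, \<open>k\<close> vanishes to first order: the factor \<open>k\<close> of the
  pulled back circle is exactly the divisor that is removed.\<close>

lemma subdegree_k:
  assumes P: "P \<in> curve"
  shows "subdegree (fps_eval k_poly (fst (param P))) = (if poly k_poly (fst P) = 0 then 1 else 0)"
proof (cases "poly k_poly (fst P) = 0")
  case False
  then show ?thesis using param_simps(1)[OF P] by (simp add: subdegree_eq_0)
next
  case True
  define u v where "u = fst P" and "v = poly v_poly u"
  have uv: "\<eta> * u - \<theta> * v = 1" unfolding v_def by (rule v_poly_poly)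
  have k: "\<delta> * v\<^sup>2 = u\<^sup>2" using True by (simp add: k_poly_def u_def v_def)
  have v: "v \<noteq> 0" using uv k by auto
  have gu: "poly g u = - u * ((u - n * v)\<^sup>2 - m\<^sup>2 * v\<^sup>2)"
    unfolding g_def poly_mult poly_minus poly_diff poly_power v_def by simp
  have "v\<^sup>2 * 1 + poly g u = (u - 2 * n * v) * (\<delta> * v\<^sup>2 - u\<^sup>2)"
    using quadric_section_identity[OF _ gu, of \<beta> 1] uv by (simp add: \<eta>_def \<theta>_def \<delta>_def)
  \<comment> \<open>Where \<open>k\<close> vanishes the first quadric reads y^2 = -v^2 with
    \<open>v\<close> nonzero, so the places over the nodes are not branch points.\<close>
  then have "(snd P)\<^sup>2 = - (v\<^sup>2)" using P k by (simp add: curve_def u_def add_eq_0_iff2 add.commute)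
  then have "snd P \<noteq> 0" using v by auto
  then have ram: "ram P = 1" using P by (simp add: ram_def)
  have "poly (pderiv k_poly) u \<noteq> 0"
  proof
    assume "poly (pderiv k_poly) u = 0"
    moreover have "poly (pderiv k_poly) u = 2 * (\<delta> * v * (\<eta> / \<theta>) - u)"
    proof -
      have "poly (pderiv v_poly) u = \<eta> / \<theta>" by (simp add: v_poly_def pderiv_pCons)
      then show ?thesis
        by (simp add: k_poly_def power2_eq_square pderiv_diff pderiv_mult pderiv_smult pderiv_pCons v_def algebra_simps)
    qed
    ultimately have "\<delta> * v * \<eta> = u * \<theta>" using \<theta>_nonzero by (simp add: field_simps)
    then have "\<delta> * v * (\<eta> * u) = u\<^sup>2 * \<theta>" by (simp add: power2_eq_square mult.assoc)
    then have "\<delta> * v * (\<eta> * u - \<theta> * v) = 0" unfolding k[symmetric] by (simp add: algebra_simps power2_eq_square)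
    then show False using uv v \<delta>_nonzero by simp
  qed
  then have "order u k_poly = 1"
    using order_pderiv[OF k_poly_nonzero, of u] order_0I[of "pderiv k_poly" u] True by (simp add: u_def)
  then show ?thesis using fps_eval_param(2)[OF P k_poly_nonzero] ram True by (simp add: u_def)
qed

lemma conic_form_affine:
  assumes "complex_circle K" "P \<in> curve" "circle_constant K = 0"
  shows "conic_form (\<chi> i j. fps_const (K$i$j)) (point_chart (Some P)) =
    fps_eval k_poly (fst (param P)) * expansion P (circle_A K) (circle_B K)"
proof -
  let ?u = "fst (param P)"
  have A: "circle_A K = [:K$1$1:] * [:0, 1:] + [:2 * K$1$3:] * v_poly"
    by (simp add: circle_A_def v_poly_def)
  have "fps_const (K$1$1) * ?u + fps_const (2 * K$1$3) * fps_eval v_poly ?u + fps_const (2 * K$2$3) * snd (param P)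
      = expansion P (circle_A K) (circle_B K)"
    unfolding expansion_def A fps_eval_add fps_eval_mult circle_B_def by simp
  then show ?thesis
    using conic_form_chart[OF assms(1) chart_eqs_affine[OF param_simps(3)[OF assms(2)]]] assms(3)
    by (simp add: affine_chart_def circle_constant_def)
qed

lemma residual_affine:
  assumes "complex_circle K" "P \<in> curve" "circle_constant K = 0"
  shows "residual_divisor a b c K (place (Some P)) = int (count (divisor (circle_A K) (circle_B K)) P)"
proof -
  note nz = circle_poly_nonzero[OF assms(1,3)]
  have p: "Some P \<in> pts" using assms(2) by simp
  have "fps_nth (point_chart (Some P) $ 3) 0 = poly k_poly (fst P)"
    using param_simps(1)[OF assms(2)] by (simp add: affine_chart_def)
  moreover have "pullback_multiplicity K (place (Some P)) =
      (if poly k_poly (fst P) = 0 then 1 else 0) + ord P (circle_A K) (circle_B K)"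
    unfolding pullback_place[OF p] conic_form_affine[OF assms]
    using k_nonzero[OF assms(2)] expansion_nonzero[OF assms(2) nz] subdegree_k[OF assms(2)]
    by (simp add: ord_def)
  ultimately show ?thesis
    unfolding residual_divisor_def node_place[OF p] count_divisor[OF nz] using assms(2) by simp
qed

text \<open>Rescaled at N, the line becomes \<open>s r + t r\<^sup>2 + 2 K$2$3 w\<close> with
  \<open>r\<close> of order 2 and \<open>w\<close> of order 1. Its order is 1, 2 or 4, matching 3, 2
  or 0 affine zeros.\<close>

lemma residual_inf:
  assumes "complex_circle K"
  shows "circle_constant K \<noteq> 0 \<Longrightarrow> residual_divisor a b c K (place None) = 0"
    and "circle_constant K = 0 \<Longrightarrow>
      residual_divisor a b c K (place None) = 4 - int (size (divisor (circle_A K) (circle_B K)))"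
proof -
  define r w where "r = fst param_inf" and "w = snd param_inf"
  have r0: "fps_nth r 0 = 0" and w0: "fps_nth w 0 = 0" and w1: "fps_nth w 1 \<noteq> 0"
    by (simp_all add: r_def w_def param_inf_simps param_inf_simps(3)[unfolded One_nat_def])
  have rsub: "subdegree r = 2" using subdegree_param_inf by (simp add: r_def)
  let ?k = "fps_eval k_poly_inf r"
  define L where "L = fps_const (K$1$1) * r + fps_const (2 * K$1$3) * (r * fps_eval v_poly_inf r)
    + fps_const (2 * K$2$3) * w"
  have k0: "fps_nth ?k 0 \<noteq> 0" using r0 k_poly_inf_0 by simp
  have conic: "conic_form (\<chi> i j. fps_const (K$i$j)) (point_chart None) = ?k * (fps_const (circle_constant K) * ?k + L)"
    using conic_form_chart[OF assms chart_eqs_inf[OF param_inf_simps(4)]]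
    by (simp add: chart_inf_def circle_constant_def L_def r_def w_def)
  have node: "\<not> node (quartic a b c) (center (representative (place None)))"
    using node_place[of None] k0 by (simp add: chart_inf_def r_def)
  have res: "residual_divisor a b c K (place None) = int (subdegree (?k * (fps_const (circle_constant K) * ?k + L)))"
    unfolding residual_divisor_def pullback_place[OF pts_simps(1)] conic using node by simp
  have L0: "fps_nth L 0 = 0" using r0 w0 by (simp add: L_def)
  show "residual_divisor a b c K (place None) = 0" if "circle_constant K \<noteq> 0"
  proof -
    have "fps_nth (?k * (fps_const (circle_constant K) * ?k + L)) 0 \<noteq> 0" using that k0 L0 by simp
    then show ?thesis unfolding res by (simp add: subdegree_eq_0)
  qed
  show "residual_divisor a b c K (place None) = 4 - int (size (divisor (circle_A K) (circle_B K)))"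
    if c0: "circle_constant K = 0"
  proof -
    note nz = circle_poly_nonzero[OF assms c0]
    note size = size_divisor[OF nz]
    define s t where "s = K$1$1 + 2 * K$1$3 * \<eta> / \<theta>" and "t = - 2 * K$1$3 / \<theta>"
    have A: "circle_A K = [:t, s:]" by (simp add: circle_A_def s_def t_def)
    have LA: "L = fps_eval [:0, s, t:] r + fps_const (2 * K$2$3) * w"
    proof -
      have "[:0, s, t:] = [:K$1$1:] * [:0, 1:] + [:2 * K$1$3:] * ([:0, 1:] * v_poly_inf)"
        by (simp add: s_def t_def v_poly_inf_def)
      then have "fps_eval [:0, s, t:] r = fps_const (K$1$1) * r + fps_const (2 * K$1$3) * (r * fps_eval v_poly_inf r)"
        by (simp only: fps_eval_add fps_eval_mult) simp
      then show ?thesis by (simp add: L_def)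
    qed
    have "L \<noteq> 0 \<and> subdegree L = 4 - size (divisor (circle_A K) (circle_B K)) \<and> size (divisor (circle_A K) (circle_B K)) \<le> 4"
    proof (cases "K$2$3 = 0")
      case False
      have "fps_nth r 1 = 0" using rsub by (intro nth_less_subdegree_zero) simp
      then have "fps_nth L 1 \<noteq> 0" using w1 r0 w0 False
        by (simp add: LA fps_mult_nth_1 del: One_nat_def)
      then have "L \<noteq> 0" "subdegree L = 1" using subdegree_eq_1I[OF L0] by auto
      moreover have "size (divisor (circle_A K) (circle_B K)) = 3"
        using False size by (simp add: A circle_B_def)
      ultimately show ?thesis by simp
    next
      case True
      have rr: "r \<noteq> fps_const (fps_nth r 0)" using rsub r0 by auto
      have st: "[:0, s, t:] \<noteq> 0" using nz True by (auto simp: A circle_B_def)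
      have L: "L = fps_eval [:0, s, t:] r" using True by (simp add: LA)
      have L_nz: "L \<noteq> 0" "subdegree L = order 0 [:0, s, t:] * 2"
        using subdegree_fps_eval[OF st rr] L r0 rsub by simp_all
      show ?thesis
      proof (cases "s = 0")
        case True
        then have "t \<noteq> 0" using st by simp
        then have "order 0 [:0, 0, t:] = 2"
          using order_pderiv[of "[:0, 0, t:]" 0] order_pderiv[of "[:0, 2 * t:]" 0] order_0I[of "[:2 * t:]" 0]
          by (simp add: pderiv_pCons)
        then show ?thesis using L_nz size True \<open>K$2$3 = 0\<close> by (simp add: A circle_B_def)
      next
        case False
        have "poly (pderiv [:0, s, t:]) 0 \<noteq> 0" using False by (simp add: pderiv_pCons)
        then have "order 0 [:0, s, t:] = 1"
          using order_pderiv[OF st, of 0] order_0I by fastforce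
        then show ?thesis using L_nz size False \<open>K$2$3 = 0\<close> by (simp add: A circle_B_def)
      qed
    qed
    moreover have "?k \<noteq> 0" "subdegree ?k = 0" using k0 by (auto simp: subdegree_eq_0 simp del: fps_eval_nth_0)
    ultimately show ?thesis unfolding res c0 by simp
  qed
qed

text \<open>The residual divisor of degree 4 on the cubic. A line has at most three affine zeros, so
  \<open>None\<close> fills at least one place.\<close>

definition circle_points :: "complex^3^3 \<Rightarrow> (complex \<times> complex) option multiset" where
  "circle_points K = image_mset Some (divisor (circle_A K) (circle_B K))
     + replicate_mset (4 - size (divisor (circle_A K) (circle_B K))) None"

lemma circle_points:
  assumes "complex_circle K" "circle_constant K = 0"
  shows "size (circle_points K) = 4" "None \<in># circle_points K" "set_mset (circle_points K) \<subseteq> pts"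
    and "(\<Sum>p\<in>#circle_points K. affine_part p) = divisor (circle_A K) (circle_B K)"
    and "has_residual a b c K D \<longleftrightarrow> D = image_mset place (circle_points K)"
proof -
  note nz = circle_poly_nonzero[OF assms]
  let ?d = "divisor (circle_A K) (circle_B K)"
  have size: "size ?d \<le> 3"
    using size_divisor[OF nz] by (simp add: circle_A_def circle_B_def)
  then show "size (circle_points K) = 4" "None \<in># circle_points K" by (auto simp: circle_points_def)
  show pts: "set_mset (circle_points K) \<subseteq> pts"
    using divisor_curve[OF nz] by (auto simp: circle_points_def in_replicate_mset split: if_splits)
  have "(\<Sum>p\<in>#image_mset Some d + replicate_mset j None. affine_part p) = d" for d j
  proof -
    have "(\<Sum>p\<in>#replicate_mset j None. affine_part p) = {#}" by (induction j) simp_all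
    moreover have "(\<Sum>p\<in>#image_mset Some d. affine_part p) = d" by (induction d) simp_all
    ultimately show ?thesis by simp
  qed
  then show "(\<Sum>p\<in>#circle_points K. affine_part p) = ?d" by (simp add: circle_points_def)
  have "residual_divisor a b c K (place p) = int (count (circle_points K) p)" if "p \<in> pts" for p
  proof (cases p)
    case None
    have "count (image_mset Some ?d) None = 0" by (simp add: count_eq_zero_iff)
    then show ?thesis using None residual_inf(2)[OF assms] size by (simp add: circle_points_def)
  next
    case (Some P)
    have "count (image_mset Some ?d) (Some P) = count ?d P"
      using count_image_mset_inj_on[of Some UNIV ?d P] by simp
    then show ?thesis using Some that residual_affine[OF assms(1) _ assms(2), of P] by (simp add: circle_points_def)
  qed
  then have res: "residual_divisor a b c K (place p) = int (count (image_mset place (circle_points K)) (place p))"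
    if "p \<in> pts" for p
    using that count_image_mset_inj_on[OF inj_place pts that] by simp
  show "has_residual a b c K D \<longleftrightarrow> D = image_mset place (circle_points K)"
  proof
    assume "D = image_mset place (circle_points K)"
    then show "has_residual a b c K D"
      using res pts unfolding has_residual_def normalization_eq by auto
  next
    assume D: "has_residual a b c K D"
    show "D = image_mset place (circle_points K)"
    proof (rule multiset_eqI)
      fix P
      show "count D P = count (image_mset place (circle_points K)) P"
      proof (cases "P \<in> normalization a b c")
        case True
        then obtain p where "p \<in> pts" "P = place p" unfolding normalization_eq by blast
        then show ?thesis using res D True unfolding has_residual_def by fastforce
      next
        case False
        then have "P \<notin># D" "P \<notin># image_mset place (circle_points K)"
          using D pts unfolding has_residual_def normalization_eq by auto
        then show ?thesis by (simp only: not_in_iff)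
      qed
    qed
  qed
qed

lemma circle_constant_eq_0:
  assumes "complex_circle K" "residual_divisor a b c K (place None) \<ge> 1"
  shows "circle_constant K = 0"
  using residual_inf(1)[OF assms(1)] assms(2) by fastforce

lemma principal_circle:
  assumes "principal M" "size M \<le> 3"
  shows "\<exists>K. complex_circle K \<and> circle_constant K = 0 \<and> M = divisor (circle_A K) (circle_B K)"
proof -
  obtain A B where AB: "A \<noteq> 0 \<or> B \<noteq> 0" and M: "M = divisor A B"
    using assms(1) unfolding principal_def by blast
  have "degree A \<le> 1" "degree B = 0"
    using size_divisor[OF AB] assms(2) M by (auto split: if_splits)
  obtain s t where A: "A = [:t, s:]"
  proof
    show "A = [:coeff A 0, coeff A 1:]"
      using \<open>degree A \<le> 1\<close> by (intro poly_eqI) (auto simp: coeff_pCons coeff_eq_0 split: nat.split)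
  qed
  obtain e where B: "B = [:e:]" using \<open>degree B = 0\<close> by (rule degree_eq_zeroE)
  \<comment> \<open>\<open>k13\<close> and \<open>k11\<close> solve the coefficient equations of
    \<open>circle_A\<close>; \<open>k33\<close> is then forced by passing through N.\<close>
  define k13 where "k13 = - \<theta> * t / 2"
  define k11 where "k11 = s + \<eta> * t"
  define k33 where "k33 = - (n\<^sup>2 * k11 + 2 * n * k13)"
  define K :: "complex^3^3" where
    "K = vector [vector [k11, 0, k13], vector [0, k11, e / 2], vector [k13, e / 2, k33]]"
  have K: "K$1$1 = k11" "K$1$2 = 0" "K$1$3 = k13" "K$2$1 = 0" "K$2$2 = k11" "K$2$3 = e / 2"
    "K$3$1 = k13" "K$3$2 = e / 2" "K$3$3 = k33"
    by (simp_all add: K_def)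
  have cA: "circle_A K = A" and cB: "circle_B K = B"
    using \<theta>_nonzero by (simp_all add: circle_A_def circle_B_def K A B k13_def k11_def)
  have "K \<noteq> 0"
    using AB unfolding cA[symmetric] cB[symmetric] by (auto simp: circle_A_def circle_B_def)
  then have "complex_circle K"
    by (simp add: complex_circle_def vec_eq_iff forall_3 transpose_def conic_form_def sum_3 K mult.assoc)
  moreover have "circle_constant K = 0" by (simp add: circle_constant_def K k33_def)
  ultimately show ?thesis using M cA cB by blast
qed

section \<open>Transport of the group law to the places\<close>

definition point :: "place \<Rightarrow> (complex \<times> complex) option" where
  "point = inv_into pts place"

lemma point_place [simp]: "p \<in> pts \<Longrightarrow> point (place p) = p"
  unfolding point_def by (rule inv_into_f_f[OF inj_place])

definition place_group :: "place monoid" where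
  "place_group = \<lparr>carrier = normalization a b c, mult = \<lambda>P Q. place (add (point P) (point Q)), one = place None\<rparr>"

lemma place_group_simps:
  "carrier place_group = place ` pts" "\<one>\<^bsub>place_group\<^esub> = place None"
  "p \<in> pts \<Longrightarrow> q \<in> pts \<Longrightarrow> place p \<otimes>\<^bsub>place_group\<^esub> place q = place (add p q)"
  by (simp_all add: place_group_def normalization_eq)

lemma comm_group_place_group: "comm_group place_group"
proof (rule comm_groupI)
  fix x y assume "x \<in> carrier place_group" "y \<in> carrier place_group"
  then obtain p q where p: "p \<in> pts" "x = place p" and q: "q \<in> pts" "y = place q"
    by (auto simp: place_group_simps(1))
  show "x \<otimes>\<^bsub>place_group\<^esub> y \<in> carrier place_group"
    using p q add(1) by (simp add: place_group_simps)
  show "x \<otimes>\<^bsub>place_group\<^esub> y = y \<otimes>\<^bsub>place_group\<^esub> x"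
    using p q add_commute[of p q] by (simp add: place_group_simps)
  fix z assume "z \<in> carrier place_group"
  then obtain r where r: "r \<in> pts" "z = place r" by (auto simp: place_group_simps(1))
  show "x \<otimes>\<^bsub>place_group\<^esub> y \<otimes>\<^bsub>place_group\<^esub> z = x \<otimes>\<^bsub>place_group\<^esub> (y \<otimes>\<^bsub>place_group\<^esub> z)"
    using p q r add(1) add_assoc[of p q r] by (simp add: place_group_simps)
next
  show "\<one>\<^bsub>place_group\<^esub> \<in> carrier place_group" by (simp add: place_group_simps)
next
  fix x assume "x \<in> carrier place_group"
  then obtain p where p: "p \<in> pts" "x = place p" by (auto simp: place_group_simps(1))
  show "\<one>\<^bsub>place_group\<^esub> \<otimes>\<^bsub>place_group\<^esub> x = x"
    using p add_None by (simp add: place_group_simps)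
  have "place (opp p) \<otimes>\<^bsub>place_group\<^esub> x = \<one>\<^bsub>place_group\<^esub>"
    using p add_opp by (simp add: place_group_simps)
  then show "\<exists>y\<in>carrier place_group. y \<otimes>\<^bsub>place_group\<^esub> x = \<one>\<^bsub>place_group\<^esub>"
    using p by (intro bexI[of _ "place (opp p)"]) (auto simp: place_group_simps(1))
qed

lemma inv_place_group:
  assumes "P \<in> carrier place_group"
  shows "inv\<^bsub>place_group\<^esub> P = reflection P"
proof -
  interpret comm_group place_group by (rule comm_group_place_group)
  obtain p where p: "p \<in> pts" "P = place p" using assms by (auto simp: place_group_simps(1))
  have "place (opp p) \<otimes>\<^bsub>place_group\<^esub> P = \<one>\<^bsub>place_group\<^esub>"
    using p add_opp by (simp add: place_group_simps)
  then have "inv\<^bsub>place_group\<^esub> P = place (opp p)"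
    using assms p by (intro inv_equality) (auto simp: place_group_simps(1))
  then show ?thesis using p reflection_place by simp
qed

lemma circle_residual_exists:
  assumes "complex_circle K" "residual_divisor a b c K (place None) \<ge> 1"
  shows "\<exists>X Y Z. has_residual a b c K {#place None, X, Y, Z#}"
proof -
  note c = circle_points[OF assms(1) circle_constant_eq_0[OF assms]]
  have "size (circle_points K - {#None#}) = 3" using c(1,2) by (simp add: size_Diff_singleton)
  then obtain x y z where "circle_points K - {#None#} = {#x, y, z#}" using size_3_mset by blast
  then have "circle_points K = {#None, x, y, z#}" using c(2) by (metis insert_DiffM)
  then show ?thesis using c(5)[of "{#place None, place x, place y, place z#}"] by auto
qed

lemma circle_residual_sum:
  assumes "complex_circle K" "residual_divisor a b c K (place None) \<ge> 1"
    and "has_residual a b c K {#place None, X, Y, Z#}"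
  shows "X \<otimes>\<^bsub>place_group\<^esub> Y \<otimes>\<^bsub>place_group\<^esub> Z = \<one>\<^bsub>place_group\<^esub>"
proof -
  note c = circle_points[OF assms(1) circle_constant_eq_0[OF assms(1,2)]]
  have "X \<in> place ` pts" "Y \<in> place ` pts" "Z \<in> place ` pts"
    using assms(3) unfolding has_residual_def normalization_eq by auto
  then obtain x y z where x: "x \<in> pts" "X = place x" and y: "y \<in> pts" "Y = place y"
    and z: "z \<in> pts" "Z = place z" by blast
  have "image_mset place {#None, x, y, z#} = image_mset place (circle_points K)"
    using c(5)[of "{#place None, X, Y, Z#}"] assms(3) x y z by simp
  then have "image_mset point (image_mset place {#None, x, y, z#}) = image_mset point (image_mset place (circle_points K))"
    by simp
  moreover have "image_mset point (image_mset place M) = M" if "set_mset M \<subseteq> pts" for M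
    using that by (induction M) simp_all
  ultimately have eq: "circle_points K = {#None, x, y, z#}" using c(3) x y z by simp
  have "affine_part x + affine_part y + affine_part z = divisor (circle_A K) (circle_B K)"
    using c(4) unfolding eq by (simp add: ac_simps)
  then have "principal (affine_part x + affine_part y + affine_part z)"
    using circle_poly_nonzero[OF assms(1) circle_constant_eq_0[OF assms(1,2)]] unfolding principal_def by blast
  then have "add (add x y) z = None" using add_add_eq_None_iff x y z by blast
  then show ?thesis using x y z add(1) by (simp add: place_group_simps)
qed

lemma circle_through_points:
  assumes "P1 \<in> carrier place_group" "P2 \<in> carrier place_group"
  shows "\<exists>K P3. complex_circle K \<and> has_residual a b c K {#place None, P1, P2, P3#}"
proof -
  obtain p q where p: "p \<in> pts" "P1 = place p" and q: "q \<in> pts" "P2 = place q"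
    using assms by (auto simp: place_group_simps(1))
  obtain r where r: "r \<in> pts" and pr: "principal (affine_part p + affine_part q + affine_part r)"
    using third_point[OF p(1) q(1)] by blast
  have "size (affine_part p + affine_part q + affine_part r) \<le> 3"
    by (cases p; cases q; cases r) simp_all
  then obtain K where K: "complex_circle K" "circle_constant K = 0"
    and d: "affine_part p + affine_part q + affine_part r = divisor (circle_A K) (circle_B K)"
    using principal_circle[OF pr] by blast
  have "circle_points K = {#None, p, q, r#}"
    unfolding circle_points_def d[symmetric]
    by (cases p; cases q; cases r) (simp_all add: numeral_eq_Suc add_mset_commute)
  then have "has_residual a b c K {#place None, P1, P2, place r#}"
    using circle_points(5)[OF K] p q by simp
  then show ?thesis using K by blast
qed

lemma circle_sum:
  assumes "P1 \<in> carrier place_group" "P2 \<in> carrier place_group" "complex_circle K"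
    and res: "has_residual a b c K {#place None, P1, P2, P3#}"
  shows "P1 \<otimes>\<^bsub>place_group\<^esub> P2 = reflection P3"
proof -
  interpret comm_group place_group by (rule comm_group_place_group)
  have N: "place None \<in> normalization a b c" by (simp add: normalization_eq)
  have P3: "P3 \<in> carrier place_group"
    using res by (simp add: has_residual_def place_group_def)
  have "residual_divisor a b c K (place None) \<ge> 1"
    using res N unfolding has_residual_def by auto
  then have "P1 \<otimes>\<^bsub>place_group\<^esub> P2 \<otimes>\<^bsub>place_group\<^esub> P3 = \<one>\<^bsub>place_group\<^esub>"
    using circle_residual_sum assms by blast
  then have "inv\<^bsub>place_group\<^esub> P3 = P1 \<otimes>\<^bsub>place_group\<^esub> P2"
    using assms(1,2) P3 by (intro inv_equality) auto
  then show ?thesis using inv_place_group[OF P3] by simp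
qed

end

section \<open>The equation of the curve of a pattern\<close>

lemma orthonormal_expand:
  assumes "orthonormal e1 e2"
  shows "v = (v \<bullet> e1) *\<^sub>R e1 + (v \<bullet> e2) *\<^sub>R e2"
    and "v \<bullet> v = (v \<bullet> e1)\<^sup>2 + (v \<bullet> e2)\<^sup>2"
    and "(e1$1)\<^sup>2 + (e2$1)\<^sup>2 = 1" "(e1$2)\<^sup>2 + (e2$2)\<^sup>2 = 1"
    and "(e1$1 * e2$2 - e1$2 * e2$1)\<^sup>2 = 1"
proof -
  have o: "(e1$1)\<^sup>2 + (e1$2)\<^sup>2 = 1" "(e2$1)\<^sup>2 + (e2$2)\<^sup>2 = 1" "e1$1 * e2$1 + e1$2 * e2$2 = 0"
    using assms by (simp_all add: orthonormal_def norm_eq_1 inner_vec_def sum_2 power2_eq_square)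
  show d: "(e1$1 * e2$2 - e1$2 * e2$1)\<^sup>2 = 1" using o by algebra
  show r: "(e1$1)\<^sup>2 + (e2$1)\<^sup>2 = 1" "(e1$2)\<^sup>2 + (e2$2)\<^sup>2 = 1" using o by algebra+
  have r3: "e1$1 * e1$2 + e2$1 * e2$2 = 0" using o by algebra
  have "v$1 = (v$1 * e1$1 + v$2 * e1$2) * e1$1 + (v$1 * e2$1 + v$2 * e2$2) * e2$1"
    "v$2 = (v$1 * e1$1 + v$2 * e1$2) * e1$2 + (v$1 * e2$1 + v$2 * e2$2) * e2$2"
    using r r3 by algebra+
  then show "v = (v \<bullet> e1) *\<^sub>R e1 + (v \<bullet> e2) *\<^sub>R e2"
    by (simp add: vec_eq_iff forall_2 inner_vec_def sum_2)
  have "v$1 * v$1 + v$2 * v$2 = (v$1 * e1$1 + v$2 * e1$2)\<^sup>2 + (v$1 * e2$1 + v$2 * e2$2)\<^sup>2"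
    using r r3 by algebra
  then show "v \<bullet> v = (v \<bullet> e1)\<^sup>2 + (v \<bullet> e2)\<^sup>2"
    by (simp add: inner_vec_def sum_2)
qed

lemma miquel_coordinates_eq:
  assumes "miquel_coordinates q p e1 e2 a b c"
  shows "q (p + z) = (z \<bullet> z)\<^sup>2 + a * (z \<bullet> e1)\<^sup>2 + b * (z \<bullet> e2)\<^sup>2 + c"
proof -
  have o: "orthonormal e1 e2" using assms by (simp add: miquel_coordinates_def)
  have "q (p + z) = q (p + (z \<bullet> e1) *\<^sub>R e1 + (z \<bullet> e2) *\<^sub>R e2)"
    using orthonormal_expand(1)[OF o, of z] by (metis add.assoc)
  then show ?thesis
    using assms orthonormal_expand(2)[OF o, of z] by (simp add: miquel_coordinates_def)
qed

text \<open>The two combinations are the trace and four times the determinant of the form, which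
  every orthonormal frame computes alike.\<close>

lemma quadratic_form_invariants:
  fixes e1 e2 :: "real^2" and a b :: real
  assumes "orthonormal e1 e2"
  defines "Q \<equiv> \<lambda>z. a * (z \<bullet> e1)\<^sup>2 + b * (z \<bullet> e2)\<^sup>2"
  shows "Q (vector [1, 0]) + Q (vector [0, 1]) = a + b"
    and "4 * Q (vector [1, 0]) * Q (vector [0, 1])
      - (Q (vector [1, 1]) - Q (vector [1, 0]) - Q (vector [0, 1]))\<^sup>2 = 4 * a * b"
proof -
  note o = orthonormal_expand(3-5)[OF assms(1)]
  have Q: "Q (vector [s, t]) = a * (s * e1$1 + t * e1$2)\<^sup>2 + b * (s * e2$1 + t * e2$2)\<^sup>2" for s t
    by (simp add: Q_def inner_vec_def sum_2)
  show "Q (vector [1, 0]) + Q (vector [0, 1]) = a + b"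
    unfolding Q using assms(1)
    by (simp add: orthonormal_def norm_eq_1 inner_vec_def sum_2 power2_eq_square) algebra
  have "4 * Q (vector [1, 0]) * Q (vector [0, 1])
      - (Q (vector [1, 1]) - Q (vector [1, 0]) - Q (vector [0, 1]))\<^sup>2
      = 4 * a * b * (e1$1 * e2$2 - e1$2 * e2$1)\<^sup>2"
    unfolding Q by (simp add: algebra_simps power2_eq_square)
  then show "4 * Q (vector [1, 0]) * Q (vector [0, 1])
      - (Q (vector [1, 1]) - Q (vector [1, 0]) - Q (vector [0, 1]))\<^sup>2 = 4 * a * b"
    unfolding o by simp
qed

text \<open>On the line joining two possible origins \<open>q\<close> would be an even quartic about
  both, so they coincide. After that, only symmetric functions of \<open>a\<close> and
  \<open>b\<close> can be compared, since the axes may be exchanged.\<close>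

lemma miquel_coordinates_unique:
  assumes m: "miquel_coordinates q p e1 e2 a b c" and m': "miquel_coordinates q p' e1' e2' a' b' c'"
  shows "c' = c" "a' + b' = a + b" "a' * b' = a * b"
proof -
  note q = miquel_coordinates_eq[OF m] and q' = miquel_coordinates_eq[OF m']
  define d where "d = p' - p"
  define D E where "D = d \<bullet> d" and "E = a * (d \<bullet> e1)\<^sup>2 + b * (d \<bullet> e2)\<^sup>2"
  have qd: "q (p + r *\<^sub>R d) = r ^ 4 * D\<^sup>2 + r\<^sup>2 * E + c" for r
    unfolding q by (simp add: D_def E_def algebra_simps power2_eq_square power4_eq_xxxx)
  have sym: "q (p' + t *\<^sub>R d) = q (p' - t *\<^sub>R d)" for t
    using q'[of "t *\<^sub>R d"] q'[of "- t *\<^sub>R d"] by simp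
  have e: "(1 + t) ^ 4 * D\<^sup>2 + (1 + t)\<^sup>2 * E = (1 - t) ^ 4 * D\<^sup>2 + (1 - t)\<^sup>2 * E" for t
    using sym[of t] qd[of "1 + t"] qd[of "1 - t"] by (simp add: d_def algebra_simps)
  have "16 * D\<^sup>2 + 4 * E = 0" "80 * D\<^sup>2 + 8 * E = 0" using e[of 1] e[of 2] by simp_all
  then have "D\<^sup>2 = 0" by linarith
  then have "d = 0" by (simp add: D_def)
  then have p: "p' = p" by (simp add: d_def)
  show c: "c' = c" using q[of 0] q'[of 0] p by simp
  have Q: "a * (z \<bullet> e1)\<^sup>2 + b * (z \<bullet> e2)\<^sup>2 = a' * (z \<bullet> e1')\<^sup>2 + b' * (z \<bullet> e2')\<^sup>2" for z
    using q[of z] q'[of z] p c by simp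
  have o: "orthonormal e1 e2" "orthonormal e1' e2'" using m m' by (simp_all add: miquel_coordinates_def)
  show "a' + b' = a + b"
    using quadratic_form_invariants(1)[OF o(1), of a b] quadratic_form_invariants(1)[OF o(2), of a' b']
    unfolding Q by simp
  show "a' * b' = a * b"
    using quadratic_form_invariants(2)[OF o(1), of a b] quadratic_form_invariants(2)[OF o(2), of a' b']
    unfolding Q by simp
qed

section \<open>Uniqueness of the curve of a pattern\<close>

lemma collinear_3_scaleR:
  fixes x y z :: "'a::real_vector"
  assumes "collinear {x, y, z}" "z \<noteq> x"
  shows "\<exists>k. y = x + k *\<^sub>R (z - x)"
proof -
  have "collinear {z, x, y}" using assms(1) by (simp add: insert_commute)
  then have "collinear {0, z - x, y - x}" by (simp add: collinear_3)
  then show ?thesis using assms(2) by (auto simp: collinear_lemma algebra_simps)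
qed

text \<open>Two centres would put the three points on a line orthogonal to \<open>P - P'\<close>,
  but a line meets a circle at most twice. In the proof \<open>b\<close> and \<open>c\<close> are
  positions on that line measured from \<open>A\<close>.\<close>

lemma circumcenter_unique:
  fixes A B C P P' :: "real^2"
  assumes "A \<noteq> B" "B \<noteq> C" "A \<noteq> C"
    and "dist P A = dist P B" "dist P B = dist P C" "dist P' A = dist P' B" "dist P' B = dist P' C"
  shows "P = P'"
proof (rule ccontr)
  assume "P \<noteq> P'"
  define w1 w2 where "w1 = P$1 - P'$1" and "w2 = P$2 - P'$2"
  have w: "w1\<^sup>2 + w2\<^sup>2 \<noteq> 0"
    using \<open>P \<noteq> P'\<close> by (auto simp: w1_def w2_def vec_eq_iff forall_2 sum_power2_eq_zero_iff)
  have d: "dist X Y = dist X Z \<longleftrightarrow> (X$1 - Y$1)\<^sup>2 + (X$2 - Y$2)\<^sup>2 = (X$1 - Z$1)\<^sup>2 + (X$2 - Z$2)\<^sup>2"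
    for X Y Z :: "real^2"
    by (simp add: dist_norm norm_eq_sqrt_inner inner_vec_def sum_2 power2_eq_square)
  define b c s where "b = ((B$2 - A$2) * w1 - (B$1 - A$1) * w2) / (w1\<^sup>2 + w2\<^sup>2)"
    and "c = ((C$2 - A$2) * w1 - (C$1 - A$1) * w2) / (w1\<^sup>2 + w2\<^sup>2)"
    and "s = (A$2 - P$2) * w1 - (A$1 - P$1) * w2"
  note e = assms(4-7)[unfolded d]
  have perp: "(B$1 - A$1) * w1 + (B$2 - A$2) * w2 = 0" "(C$1 - A$1) * w1 + (C$2 - A$2) * w2 = 0"
    using e unfolding w1_def w2_def by algebra+
  have B: "B$1 = A$1 - b * w2" "B$2 = A$2 + b * w1"
  proof -
    have "(B$1 - A$1) * (w1\<^sup>2 + w2\<^sup>2) = - (b * w2) * (w1\<^sup>2 + w2\<^sup>2)"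
      "(B$2 - A$2) * (w1\<^sup>2 + w2\<^sup>2) = b * w1 * (w1\<^sup>2 + w2\<^sup>2)"
      using perp(1) w by (simp_all add: b_def) algebra+
    then have "B$1 - A$1 = - (b * w2)" "B$2 - A$2 = b * w1"
      using mult_right_cancel[OF w] by blast+
    then show "B$1 = A$1 - b * w2" "B$2 = A$2 + b * w1" by linarith+
  qed
  have C: "C$1 = A$1 - c * w2" "C$2 = A$2 + c * w1"
  proof -
    have "(C$1 - A$1) * (w1\<^sup>2 + w2\<^sup>2) = - (c * w2) * (w1\<^sup>2 + w2\<^sup>2)"
      "(C$2 - A$2) * (w1\<^sup>2 + w2\<^sup>2) = c * w1 * (w1\<^sup>2 + w2\<^sup>2)"
      using perp(2) w by (simp_all add: c_def) algebra+
    then have "C$1 - A$1 = - (c * w2)" "C$2 - A$2 = c * w1"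
      using mult_right_cancel[OF w] by blast+
    then show "C$1 = A$1 - c * w2" "C$2 = A$2 + c * w1" by linarith+
  qed
  have "b * (2 * s + b * (w1\<^sup>2 + w2\<^sup>2)) = 0" "c * (2 * s + c * (w1\<^sup>2 + w2\<^sup>2)) = 0"
    using e(1,2) unfolding B C s_def by algebra+
  moreover have "b \<noteq> 0" "c \<noteq> 0" using assms(1,3) B C by (auto simp: vec_eq_iff forall_2)
  ultimately have "2 * s + b * (w1\<^sup>2 + w2\<^sup>2) = 0" "2 * s + c * (w1\<^sup>2 + w2\<^sup>2) = 0"
    by (simp_all only: mult_eq_0_iff simp_thms)
  then have "(b - c) * (w1\<^sup>2 + w2\<^sup>2) = 0" unfolding left_diff_distrib by linarith
  then have "b = c" using w by (metis mult_eq_0_iff eq_iff_diff_eq_0)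
  then show False using assms(2) B C by (simp add: vec_eq_iff forall_2)
qed

lemma S22_facts:
  assumes "S \<in> S22"
  obtains u v where "\<not> collinear {0, u, v}" "u \<noteq> 0" "v \<noteq> 0"
    "\<And>i j. S (i + 2) j = S i j + u" "\<And>i j. S i (j + 2) = S i j + v"
    "\<And>i j. distinct [S i j, S (i+1) j, S i (j+1), S (i+1) (j+1)]"
    "\<And>i j. \<exists>z r. {S i j, S (i+1) j, S i (j+1), S (i+1) (j+1)} \<subseteq> sphere z r"
proof -
  obtain u v where uv: "\<not> collinear {0, u, v}" "\<And>i j. S (i + 2) j = S i j + u" "\<And>i j. S i (j + 2) = S i j + v"
    using assms unfolding S22_def by blast
  have nz: "u \<noteq> 0" "v \<noteq> 0" using uv(1) by (auto simp: collinear_lemma)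
  have "sgcp S" using assms by (simp add: S22_def)
  then have cell: "\<And>i j. distinct [S i j, S (i+1) j, S i (j+1), S (i+1) (j+1)]"
    "\<And>i j. \<exists>z r. {S i j, S (i+1) j, S i (j+1), S (i+1) (j+1)} \<subseteq> sphere z r"
    unfolding sgcp_def by blast+
  show ?thesis by (rule that[OF uv(1) nz uv(2,3) cell])
qed

lemma transposed_S22:
  assumes "S \<in> S22"
  shows "transposed S \<in> S22"
proof -
  obtain u v where uv: "\<not> collinear {0, u, v}" "\<And>i j. S (i + 2) j = S i j + u" "\<And>i j. S i (j + 2) = S i j + v"
    and cell: "\<And>i j. distinct [S i j, S (i+1) j, S i (j+1), S (i+1) (j+1)]"
    "\<And>i j. \<exists>z r. {S i j, S (i+1) j, S i (j+1), S (i+1) (j+1)} \<subseteq> sphere z r"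
    using S22_facts[OF assms] by metis
  have "\<not> collinear {0, v, u}" using uv(1) by (simp add: insert_commute)
  moreover have "distinct [S j i, S j (i+1), S (j+1) i, S (j+1) (i+1)]" for i j
    using cell(1)[of j i] by auto
  moreover have "\<exists>z r. {S j i, S j (i+1), S (j+1) i, S (j+1) (i+1)} \<subseteq> sphere z r" for i j
    using cell(2)[of j i] by (simp add: insert_commute)
  ultimately have nc: "\<not> collinear {0, v, u}" and sg: "sgcp (transposed S)"
    unfolding sgcp_def transposed_def by simp_all
  have tr: "transposed S (i + 2) j = transposed S i j + v"
    "transposed S i (j + 2) = transposed S i j + u" for i j
    by (simp_all only: transposed_def uv(2,3))
  have "\<exists>u v. \<not> collinear {0, u, v} \<and>
      (\<forall>i j. transposed S (i + 2) j = transposed S i j + u \<and> transposed S i (j + 2) = transposed S i j + v)"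
    by (rule exI[of _ v], rule exI[of _ u], intro conjI allI) (rule nc tr)+
  with sg show ?thesis
    unfolding S22_def mem_Collect_eq by (rule conjI)
qed

lemma line_intersection_unique:
  fixes P P' X Y u v :: "'a::real_vector"
  assumes "\<not> collinear {0, u, v}" "P = X + s *\<^sub>R v" "P = Y + t *\<^sub>R u" "P' = X + s' *\<^sub>R v" "P' = Y + t' *\<^sub>R u"
  shows "P = P'"
proof -
  have "(s - s') *\<^sub>R v = P - P'" unfolding assms(2,4) by (simp add: algebra_simps)
  also have "\<dots> = (t - t') *\<^sub>R u" unfolding assms(3,5) by (simp add: algebra_simps)
  finally have e: "(s - s') *\<^sub>R v = (t - t') *\<^sub>R u" .
  have "s = s'"
  proof (rule ccontr)
    assume "s \<noteq> s'"
    then have "v = inverse (s - s') *\<^sub>R ((s - s') *\<^sub>R v)" by simp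
    then have "v = (inverse (s - s') * (t - t')) *\<^sub>R u" unfolding e by simp
    then show False using assms(1) by (auto simp: collinear_lemma)
  qed
  then show ?thesis using assms by simp
qed

definition generic_curve :: "pattern \<Rightarrow> real^2 \<Rightarrow> real^2 \<Rightarrow> real^2 \<Rightarrow> real" where
  "generic_curve S P P' =
     (let A = S 0 0; C = S 2 0; W = Omega S;
          lam = ((dist P A)\<^sup>2 * (dist P' A)\<^sup>2 - (dist P C)\<^sup>2 * (dist P' C)\<^sup>2)
                   / ((dist W A)\<^sup>2 - (dist W C)\<^sup>2);
          k = ((dist W A)\<^sup>2 * (dist P C)\<^sup>2 * (dist P' C)\<^sup>2
                  - (dist W C)\<^sup>2 * (dist P A)\<^sup>2 * (dist P' A)\<^sup>2)
                 / ((dist W A)\<^sup>2 - (dist W C)\<^sup>2)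
      in (\<lambda>M. (dist P M)\<^sup>2 * (dist P' M)\<^sup>2 - lam * (dist W M)\<^sup>2 - k))"

lemma generic_equationD:
  assumes "generic_equation S q"
  shows "\<exists>OB OD P P' s t.
    dist OB (S 0 0) = dist OB (S 1 0) \<and> dist OB (S 1 0) = dist OB (S 2 0) \<and>
    dist OD (S 0 0) = dist OD (S 0 1) \<and> dist OD (S 0 1) = dist OD (S 0 2) \<and>
    P = OB + s *\<^sub>R (S 0 2 - S 0 0) \<and> P = OD + t *\<^sub>R (S 2 0 - S 0 0) \<and>
    midpoint P P' = Omega S \<and> q = generic_curve S P P'"
  using assms unfolding generic_equation_def Let_def
  by (elim conjE exE)
    (intro exI conjI, assumption+, simp only: generic_curve_def Let_def)

lemma generic_equation_unique:
  assumes "S \<in> S22" "generic_equation S q" "generic_equation S q'"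
  shows "q = q'"
proof -
  obtain u v where uv: "\<not> collinear {0, u, v}" "u \<noteq> 0" "v \<noteq> 0"
    "\<And>i j. S (i + 2) j = S i j + u" "\<And>i j. S i (j + 2) = S i j + v"
    and cell: "\<And>i j. distinct [S i j, S (i+1) j, S i (j+1), S (i+1) (j+1)]"
    using S22_facts[OF assms(1)] by metis
  have C: "S 2 0 = S 0 0 + u" using uv(4)[of 0 0] by simp
  have G: "S 0 2 = S 0 0 + v" using uv(5)[of 0 0] by simp
  have uC: "S 2 0 - S 0 0 = u" and uG: "S 0 2 - S 0 0 = v" using C G by simp_all
  have ne: "S 0 0 \<noteq> S 1 0" "S 1 0 \<noteq> S 2 0" "S 0 0 \<noteq> S 2 0" "S 0 0 \<noteq> S 0 1" "S 0 1 \<noteq> S 0 2" "S 0 0 \<noteq> S 0 2"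
    using cell[of 0 0] cell[of 1 0] cell[of 0 1] C G uv(2,3) by auto
  obtain OB OD P P' s t where h: "dist OB (S 0 0) = dist OB (S 1 0)" "dist OB (S 1 0) = dist OB (S 2 0)"
    "dist OD (S 0 0) = dist OD (S 0 1)" "dist OD (S 0 1) = dist OD (S 0 2)"
    "P = OB + s *\<^sub>R v" "P = OD + t *\<^sub>R u" "midpoint P P' = Omega S"
    and q: "q = generic_curve S P P'"
    using generic_equationD[OF assms(2)] unfolding uG uC by blast
  obtain OB1 OD1 P1 P1' s1 t1 where h1: "dist OB1 (S 0 0) = dist OB1 (S 1 0)" "dist OB1 (S 1 0) = dist OB1 (S 2 0)"
    "dist OD1 (S 0 0) = dist OD1 (S 0 1)" "dist OD1 (S 0 1) = dist OD1 (S 0 2)"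
    "P1 = OB1 + s1 *\<^sub>R v" "P1 = OD1 + t1 *\<^sub>R u" "midpoint P1 P1' = Omega S"
    and q1: "q' = generic_curve S P1 P1'"
    using generic_equationD[OF assms(3)] unfolding uG uC by blast
  have "OB = OB1" using circumcenter_unique[OF ne(1-3) h(1,2) h1(1,2)] .
  moreover have "OD = OD1" using circumcenter_unique[OF ne(4-6) h(3,4) h1(3,4)] .
  ultimately have P: "P = P1"
    using line_intersection_unique[OF uv(1) h(5,6)] h1(5,6) by blast
  have "midpoint P P' = midpoint P P1'" using h(7) h1(7) P by simp
  then have "P' = P1'" by (simp add: midpoint_def)
  with P show ?thesis unfolding q q1 by simp
qed

definition horizontal_curve :: "pattern \<Rightarrow> real^2 \<Rightarrow> real^2 \<Rightarrow> real^2 \<Rightarrow> real" where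
  "horizontal_curve S e1 e2 =
     (let x = (\<lambda>M. (M - Omega S) \<bullet> e1); y = (\<lambda>M. (M - Omega S) \<bullet> e2);
          xC = x (S 2 0); yC = y (S 2 0); xD = x (S 0 1); xE = x (S 1 1); yE = y (S 1 1);
          rho = xC\<^sup>2 + yC\<^sup>2 - xE\<^sup>2 - yE\<^sup>2;
          alpha = xC\<^sup>2 + yC\<^sup>2 + xE\<^sup>2 + yE\<^sup>2 + (xD + xC)\<^sup>2 * rho / (yC\<^sup>2 - yE\<^sup>2);
          beta = xC\<^sup>2 + yC\<^sup>2 + xE\<^sup>2 + yE\<^sup>2
                   + (xD + xC)\<^sup>2 * (xE\<^sup>2 - xC\<^sup>2) * rho / (yC\<^sup>2 - yE\<^sup>2)\<^sup>2;
          gamma = (xC\<^sup>2 + yC\<^sup>2) * (xE\<^sup>2 + yE\<^sup>2)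
                   + (xD + xC)\<^sup>2 * (xE\<^sup>2 * yC\<^sup>2 - xC\<^sup>2 * yE\<^sup>2) * rho / (yC\<^sup>2 - yE\<^sup>2)\<^sup>2
      in (\<lambda>M. ((x M)\<^sup>2 + (y M)\<^sup>2)\<^sup>2 - alpha * (x M)\<^sup>2 - beta * (y M)\<^sup>2 + gamma))"

lemma horizontal_equationD:
  assumes "horizontal_equation S q"
  shows "horizontal_trapezoidal S"
    and "\<exists>e1 e2 s. orthonormal e1 e2 \<and> S 2 0 - S 0 0 = s *\<^sub>R e1 \<and> q = horizontal_curve S e1 e2"
proof -
  show "horizontal_trapezoidal S" using assms by (simp add: horizontal_equation_def)
  show "\<exists>e1 e2 s. orthonormal e1 e2 \<and> S 2 0 - S 0 0 = s *\<^sub>R e1 \<and> q = horizontal_curve S e1 e2"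
    using assms unfolding horizontal_equation_def horizontal_curve_def Let_def
    by (elim conjE exE) (intro exI conjI, assumption+)
qed

lemma horizontal_curve_minus:
  "horizontal_curve S (- e1) e2 = horizontal_curve S e1 e2"
  "horizontal_curve S e1 (- e2) = horizontal_curve S e1 e2"
proof -
  have "(- x - y)\<^sup>2 = (x + y)\<^sup>2" for x y :: real by (simp add: power2_eq_square algebra_simps)
  then show "horizontal_curve S (- e1) e2 = horizontal_curve S e1 e2"
    "horizontal_curve S e1 (- e2) = horizontal_curve S e1 e2"
    by (simp_all only: horizontal_curve_def Let_def inner_minus_right power2_minus add_uminus_conv_diff)
qed

lemma orthonormal_first_axis:
  assumes o: "orthonormal e1 e2" "orthonormal f1 f2" and "f1 = e1 \<or> f1 = - e1"
  shows "f2 = e2 \<or> f2 = - e2"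
proof -
  have "f2 \<bullet> e1 = 0" using o assms(3) by (auto simp: orthonormal_def inner_commute)
  then have f2: "f2 = (f2 \<bullet> e2) *\<^sub>R e2" using orthonormal_expand(1)[OF o(1), of f2] by simp
  then have "norm f2 = \<bar>f2 \<bullet> e2\<bar> * norm e2" by (metis norm_scaleR)
  then have "\<bar>f2 \<bullet> e2\<bar> = 1" using o by (simp add: orthonormal_def)
  then have "f2 \<bullet> e2 = 1 \<or> f2 \<bullet> e2 = - 1" by linarith
  then show ?thesis using f2 by auto
qed

text \<open>The direction from \<open>S 0 0\<close> to \<open>S 2 0\<close> fixes the frame up to
  the signs of its axes, and the formula is even in each of them.\<close>

lemma horizontal_equation_unique:
  assumes "S \<in> S22" "horizontal_equation S q" "horizontal_equation S q'"
  shows "q = q'"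
proof -
  obtain u v where "u \<noteq> 0" "\<And>i j. S (i + 2) j = S i j + u"
    using S22_facts[OF assms(1)] by metis
  then have ne: "S 2 0 - S 0 0 \<noteq> 0" by (metis add_0 add_diff_cancel_left')
  obtain e1 e2 s where e: "orthonormal e1 e2" "S 2 0 - S 0 0 = s *\<^sub>R e1" and q: "q = horizontal_curve S e1 e2"
    using horizontal_equationD(2)[OF assms(2)] by blast
  obtain f1 f2 t where f: "orthonormal f1 f2" "S 2 0 - S 0 0 = t *\<^sub>R f1" and q': "q' = horizontal_curve S f1 f2"
    using horizontal_equationD(2)[OF assms(3)] by blast
  have "t \<noteq> 0" using ne f by auto
  then have f1: "f1 = (s / t) *\<^sub>R e1"
    using e(2) f(2) by (metis divide_inverse_commute scaleR_scaleR scaleR_one left_inverse)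
  then have "norm f1 = \<bar>s / t\<bar> * norm e1" by (metis norm_scaleR)
  moreover have "norm f1 = 1" "norm e1 = 1" using e f by (simp_all add: orthonormal_def)
  ultimately have "\<bar>s / t\<bar> = 1" by (simp only: mult_1_right)
  then have "s / t = 1 \<or> s / t = - 1" by linarith
  then have "f1 = e1 \<or> f1 = - e1" using f1 by auto
  moreover from this have "f2 = e2 \<or> f2 = - e2" using orthonormal_first_axis e(1) f(1) by blast
  ultimately show ?thesis unfolding q q' by (auto simp: horizontal_curve_minus)
qed

lemma cyclic_parallelogram:
  fixes A x y z :: "'a::real_inner"
  assumes "{A, A + x, A + y, A + x + y} \<subseteq> sphere z r"
  shows "x \<bullet> y = 0"
proof -
  have "norm (z - A) = r" "norm (z - (A + x)) = r" "norm (z - (A + y)) = r" "norm (z - (A + x + y)) = r"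
    using assms by (simp_all add: dist_norm)
  then have "(z - A) \<bullet> (z - A) = r\<^sup>2" "(z - (A + x)) \<bullet> (z - (A + x)) = r\<^sup>2"
    "(z - (A + y)) \<bullet> (z - (A + y)) = r\<^sup>2" "(z - (A + x + y)) \<bullet> (z - (A + x + y)) = r\<^sup>2"
    by (simp_all flip: power2_norm_eq_inner)
  then show ?thesis by (simp add: inner_simps inner_commute)
qed

text \<open>A pattern that is trapezoidal in both directions is a grid of rectangles, whose curve is a
  pair of concentric circles.\<close>

lemma rectangular_equation:
  assumes S: "S \<in> S22" and "horizontal_trapezoidal S" "vertical_trapezoidal S"
    and eq: "horizontal_equation S q" and m: "miquel_coordinates q p f1 f2 a b c"
  shows "a = b"
proof -
  obtain u v where uv: "\<not> collinear {0, u, v}" "u \<noteq> 0" "v \<noteq> 0"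
    "\<And>i j. S (i + 2) j = S i j + u" "\<And>i j. S i (j + 2) = S i j + v"
    and cell: "\<And>i j. distinct [S i j, S (i+1) j, S i (j+1), S (i+1) (j+1)]"
    "\<And>i j. \<exists>z r. {S i j, S (i+1) j, S i (j+1), S (i+1) (j+1)} \<subseteq> sphere z r"
    using S22_facts[OF S] by metis
  have p: "S 2 0 = S 0 0 + u" "S 0 2 = S 0 0 + v" "S 2 1 = S 0 1 + u" "S 1 2 = S 1 0 + v" "S 2 2 = S 0 0 + u + v"
    using uv(4)[of 0 0] uv(5)[of 0 0] uv(4)[of 0 1] uv(5)[of 1 0] uv(4)[of 0 2] by simp_all
  have col: "collinear {S 0 0, S 1 0, S 2 0}" "collinear {S 0 1, S 1 1, S 2 1}"
    "collinear {S 0 0, S 0 1, S 0 2}" "collinear {S 1 0, S 1 1, S 1 2}"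
    using assms(2,3) by (simp_all add: horizontal_trapezoidal_def vertical_trapezoidal_def)
  obtain k where B: "S 1 0 = S 0 0 + k *\<^sub>R u"
    using collinear_3_scaleR[OF col(1)] p(1) uv(2) by auto
  obtain l where D: "S 0 1 = S 0 0 + l *\<^sub>R v"
    using collinear_3_scaleR[OF col(3)] p(2) uv(3) by auto
  obtain k' where E: "S 1 1 = S 0 1 + k' *\<^sub>R u"
    using collinear_3_scaleR[OF col(2)] p(3) uv(2) by auto
  obtain l' where E': "S 1 1 = S 1 0 + l' *\<^sub>R v"
    using collinear_3_scaleR[OF col(4)] p(4) uv(3) by auto
  have "S 1 1 = S 0 0 + k *\<^sub>R u + l *\<^sub>R v"
  proof (rule line_intersection_unique[OF uv(1)])
    show "S 1 1 = (S 0 0 + k *\<^sub>R u) + l' *\<^sub>R v" using E' B by simp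
    show "S 1 1 = (S 0 0 + l *\<^sub>R v) + k' *\<^sub>R u" using E D by simp
    show "S 0 0 + k *\<^sub>R u + l *\<^sub>R v = (S 0 0 + k *\<^sub>R u) + l *\<^sub>R v" by simp
    show "S 0 0 + k *\<^sub>R u + l *\<^sub>R v = (S 0 0 + l *\<^sub>R v) + k *\<^sub>R u" by simp
  qed
  then have "\<exists>z r. {S 0 0, S 0 0 + k *\<^sub>R u, S 0 0 + l *\<^sub>R v, S 0 0 + k *\<^sub>R u + l *\<^sub>R v} \<subseteq> sphere z r"
    using cell(2)[of 0 0] B D by simp
  then have "(k *\<^sub>R u) \<bullet> (l *\<^sub>R v) = 0" using cyclic_parallelogram by blast
  moreover have "k \<noteq> 0" "l \<noteq> 0" using cell(1)[of 0 0] B D by auto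
  ultimately have perp: "u \<bullet> v = 0" by simp
  obtain e1 e2 s where e: "orthonormal e1 e2" "S 2 0 - S 0 0 = s *\<^sub>R e1" and q: "q = horizontal_curve S e1 e2"
    using horizontal_equationD(2)[OF eq] by blast
  have "u = s *\<^sub>R e1" using e(2) p(1) by simp
  then have ve: "v \<bullet> e1 = 0" using perp uv(2) by (auto simp: inner_commute)
  \<comment> \<open>For perpendicular grid directions this makes \<open>xD + xC\<close> vanish, and
    with it every term by which \<open>alpha\<close> and \<open>beta\<close> differ.\<close>
  have "S 0 1 - Omega S + (S 2 0 - Omega S) = (l - 1) *\<^sub>R v"
    unfolding Omega_def midpoint_def p D by (simp add: algebra_simps flip: scaleR_left.add)
  then have "(S 0 1 - Omega S) \<bullet> e1 + (S 2 0 - Omega S) \<bullet> e1 = 0"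
    using ve by (simp flip: inner_add_left)
  then obtain R k where "q = (\<lambda>M. (((M - Omega S) \<bullet> e1)\<^sup>2 + ((M - Omega S) \<bullet> e2)\<^sup>2)\<^sup>2
      - R * ((M - Omega S) \<bullet> e1)\<^sup>2 - R * ((M - Omega S) \<bullet> e2)\<^sup>2 + k)"
    unfolding q horizontal_curve_def Let_def by simp
  then have "miquel_coordinates q (Omega S) e1 e2 (- R) (- R) k"
    using e(1) by (simp add: miquel_coordinates_def inner_simps orthonormal_def inner_commute norm_eq_1)
  from miquel_coordinates_unique[OF this m] have "a + b = - 2 * R" "a * b = R * R" by simp_all
  then have "(a - b)\<^sup>2 = 0" by algebra
  then show ?thesis by simp
qed

lemma horizontal_trapezoidal_transposed:
  "horizontal_trapezoidal (transposed S) \<longleftrightarrow> vertical_trapezoidal S"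
  "vertical_trapezoidal (transposed S) \<longleftrightarrow> horizontal_trapezoidal S"
  by (simp_all add: horizontal_trapezoidal_def vertical_trapezoidal_def transposed_def)

text \<open>Two clauses of \<open>Q_equation\<close> can hold together only for a pattern
  trapezoidal in both directions. That case is excluded because the curve is then a pair of
  concentric circles, with \<open>a = b\<close>.\<close>

lemma Q_equation_unique:
  assumes S: "S \<in> S22" and q: "Q_equation S q" "miquel_coordinates q p e1 e2 a b c" "a \<noteq> b"
    and q': "Q_equation S q'"
  shows "q' = q"
proof -
  have gen: "\<not> horizontal_equation S f \<and> \<not> horizontal_equation (transposed S) f"
    if "generic_equation S h" for f h
    using that horizontal_equationD(1) horizontal_trapezoidal_transposed
    unfolding generic_equation_def by blast
  have both: "\<not> (horizontal_equation S f \<and> horizontal_equation (transposed S) h)"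
    if "q = f \<or> q = h" for f h
  proof
    assume fh: "horizontal_equation S f \<and> horizontal_equation (transposed S) h"
    then have "horizontal_trapezoidal S" "vertical_trapezoidal S"
      using horizontal_equationD(1) horizontal_trapezoidal_transposed by blast+
    then show False
      using that fh rectangular_equation[OF S _ _ _ q(2)] rectangular_equation[OF transposed_S22[OF S] _ _ _ q(2)] q(3)
        horizontal_trapezoidal_transposed by blast
  qed
  show ?thesis
    using q(1) q' gen both generic_equation_unique[OF S] horizontal_equation_unique[OF S]
      horizontal_equation_unique[OF transposed_S22[OF S]]
    unfolding Q_equation_def by blast
qed

section \<open>The given equation and the chosen axis point\<close>

text \<open>Only \<open>c\<close>, \<open>a + b\<close> and \<open>a * b\<close> carry over from the
  frame provided by \<open>S22_0\<close>, so the conditions are transferred through (a - b)^2 and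
  (a^2 - 4c)(b^2 - 4c), which are symmetric in \<open>a\<close> and \<open>b\<close>.\<close>

lemma S22_0_nondegenerate:
  assumes "S \<in> S22_0" "Q_equation S q" "miquel_coordinates q p e1 e2 a b c"
  shows "a \<noteq> b" "c \<noteq> 0" "a\<^sup>2 \<noteq> 4 * c" "b\<^sup>2 \<noteq> 4 * c"
proof -
  obtain q0 p0 f1 f2 a0 b0 c0 where S: "S \<in> S22" and Q0: "Q_equation S q0"
    and m0: "miquel_coordinates q0 p0 f1 f2 a0 b0 c0" and nd: "nondegenerate_binodal (quartic a0 b0 c0)"
    using assms(1) unfolding S22_0_def by blast
  note n = nondegenerate_binodal_imp[OF nd]
  have "q = q0" using Q_equation_unique[OF S Q0 m0 n(1) assms(2)] .
  with assms(3) have "miquel_coordinates q0 p e1 e2 a b c" by simp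
  note u = miquel_coordinates_unique[OF m0 this]
  have "(a - b)\<^sup>2 = (a + b)\<^sup>2 - 4 * (a * b)" by (simp add: power2_eq_square algebra_simps)
  also have "\<dots> = (a0 - b0)\<^sup>2" unfolding u by (simp add: power2_eq_square algebra_simps)
  finally show "a \<noteq> b" using n(1) by auto
  show "c \<noteq> 0" using u n by simp
  have "(a\<^sup>2 - 4 * c) * (b\<^sup>2 - 4 * c) = (a * b)\<^sup>2 - 4 * c * ((a + b)\<^sup>2 - 2 * (a * b)) + 16 * c\<^sup>2"
    by (simp add: power2_eq_square algebra_simps)
  also have "\<dots> = (a0\<^sup>2 - 4 * c0) * (b0\<^sup>2 - 4 * c0)"
    unfolding u by (simp add: power2_eq_square algebra_simps)
  finally show "a\<^sup>2 \<noteq> 4 * c" "b\<^sup>2 \<noteq> 4 * c" using n by auto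
qed

lemma representative_parametrization:
  assumes "P \<in> normalization a b c"
  shows "parametrization a b c (representative P)"
proof -
  obtain \<phi> where \<phi>: "parametrization a b c \<phi>"
    and P: "P = {(\<phi>, \<psi>). parametrization a b c \<phi> \<and> parametrization a b c \<psi> \<and> reparametrization \<phi> \<psi>} `` {\<phi>}"
    using assms unfolding normalization_def by (auto elim!: quotientE)
  have "\<phi> \<in> P" using \<phi> reparametrization_refl by (simp add: P)
  then have "representative P \<in> P" unfolding representative_def by (rule someI)
  moreover have "parametrization a b c \<psi>" if "\<psi> \<in> P" for \<psi> using that unfolding P by blast
  ultimately show ?thesis by blast
qed

text \<open>An affine place with this centre would have \<open>y = v = 0\<close>, hence
  \<open>u = 0\<close> by the cubic, against \<open>\<eta> u - \<theta> v = 1\<close>. So the centre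
  alone identifies the place.\<close>

lemma (in miquel_quartic) place_None_eqI:
  assumes "P \<in> normalization a b c" "center (representative P) $ 2 = 0"
    and "center (representative P) $ 1 = n * center (representative P) $ 3"
  shows "P = place None"
proof -
  obtain p where p: "p \<in> pts" "P = place p" using assms(1) unfolding normalization_eq by blast
  show ?thesis
  proof (cases p)
    case None
    then show ?thesis using p by simp
  next
    case (Some Q)
    then have Q: "Q \<in> curve" using p by simp
    obtain w \<sigma> where w: "fps_nth w 0 \<noteq> 0" "representative P = substituted w \<sigma> (point_chart p)"
      using representative_place[OF p(1)] p(2) by metis
    have y: "snd Q = 0" and v: "poly v_poly (fst Q) = 0"
      using assms(2,3) w Some param_simps(1,2)[OF Q]
      by (simp_all add: affine_chart_def algebra_simps)
    have "poly g (fst Q) = 0" using Q y by (simp add: curve_def)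
    then have "fst Q = 0" using v by (simp add: g_def)
    then show ?thesis using v v_poly_poly[of 0] by simp
  qed
qed

theorem proposition1p2:
  fixes S :: pattern and q :: "real^2 \<Rightarrow> real" and p e1 e2 :: "real^2" and a b c :: real
    and N :: place
  assumes "S \<in> S22_0"
    and "Q_equation S q"
    and "miquel_coordinates q p e1 e2 a b c"
    and "N \<in> normalization a b c" and "on_x_axis N"
  shows "\<exists>G :: place monoid. comm_group G \<and> carrier G = normalization a b c \<and> \<one>\<^bsub>G\<^esub> = N \<and>
    (\<forall>K. complex_circle K \<and> residual_divisor a b c K N \<ge> 1 \<longrightarrow>
       (\<exists>X Y Z. has_residual a b c K {#N, X, Y, Z#}) \<and>
       (\<forall>X Y Z. has_residual a b c K {#N, X, Y, Z#} \<longrightarrow> X \<otimes>\<^bsub>G\<^esub> Y \<otimes>\<^bsub>G\<^esub> Z = \<one>\<^bsub>G\<^esub>)) \<and>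
    (\<forall>P \<in> carrier G. inv\<^bsub>G\<^esub> P = reflection P) \<and>
    (\<forall>P1 \<in> carrier G. \<forall>P2 \<in> carrier G.
       (\<exists>K P3. complex_circle K \<and> has_residual a b c K {#N, P1, P2, P3#}) \<and>
       (\<forall>K P3. complex_circle K \<and> has_residual a b c K {#N, P1, P2, P3#} \<longrightarrow>
          P1 \<otimes>\<^bsub>G\<^esub> P2 = reflection P3))"
proof -
  note nd = S22_0_nondegenerate[OF assms(1-3)]
  define z where "z = center (representative N)"
  have par: "parametrization a b c (representative N)"
    using representative_parametrization[OF assms(4)] .
  have z2: "z$2 = 0" using assms(5) by (simp add: on_x_axis_def z_def)
  have "z \<noteq> 0" using par by (simp add: parametrization_def z_def)
  have "quartic a b c z = 0"
  proof -
    have "fps_nth (miquel_form (fps_const (of_real a)) (fps_const (of_real b)) (fps_const (of_real c)) (representative N)) 0 = 0"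
      using par by (simp add: parametrization_def)
    then show ?thesis by (simp add: z_def quartic_def miquel_form_def power2_eq_square power4_eq_xxxx)
  qed
  then have F: "(z$1) ^ 4 + of_real a * (z$1)\<^sup>2 * (z$3)\<^sup>2 + of_real c * (z$3) ^ 4 = 0"
    using z2 by (simp add: quartic_def miquel_form_def)
  have z3: "z$3 \<noteq> 0" using F \<open>z \<noteq> 0\<close> z2 by (auto simp: vec_eq_iff forall_3)
  \<comment> \<open>N is centred at (n : 0 : 1), so n^2 is a root of X^2 + aX + c; m^2 is the other
    root, read off from the sum -a.\<close>
  define n m where "n = z$1 / z$3" and "m = csqrt (- of_real a - n\<^sup>2)"
  have n: "n ^ 4 + of_real a * n\<^sup>2 + of_real c = 0"
  proof -
    have "(z$3) ^ 4 * (n ^ 4 + of_real a * n\<^sup>2 + of_real c) = 0"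
      using F z3 by (simp add: n_def field_simps power2_eq_square power4_eq_xxxx)
    then show ?thesis using z3 by simp
  qed
  have a_eq: "complex_of_real a = - (n\<^sup>2 + m\<^sup>2)" by (simp add: m_def)
  have c_eq: "complex_of_real c = n\<^sup>2 * m\<^sup>2"
    using n unfolding a_eq by (simp add: algebra_simps power2_eq_square power4_eq_xxxx)
  have sqr: "(complex_of_real x)\<^sup>2 \<noteq> 4 * complex_of_real c" if "x\<^sup>2 \<noteq> 4 * c" for x
    using that by (metis of_real_eq_iff of_real_mult of_real_numeral of_real_power)
  interpret miquel_quartic a b c n m
  proof
    show "n \<noteq> 0" "m \<noteq> 0" using c_eq nd(2) by auto
    show "n\<^sup>2 \<noteq> m\<^sup>2"
      using sqr[OF nd(3)] unfolding a_eq c_eq by (auto simp: power2_eq_square algebra_simps)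
    show "complex_of_real b \<noteq> complex_of_real a" using nd(1) by simp
    show "(complex_of_real b)\<^sup>2 \<noteq> 4 * n\<^sup>2 * m\<^sup>2"
      using sqr[OF nd(4)] unfolding c_eq by (simp add: mult.assoc)
  qed (simp_all only: a_eq c_eq)
  have N: "N = place None"
    using place_None_eqI[OF assms(4)] z2 z3 by (simp add: n_def z_def)
  show ?thesis
    unfolding N
  proof (intro exI[of _ place_group] conjI allI ballI impI)
    show "comm_group place_group" by (rule comm_group_place_group)
    show "carrier place_group = normalization a b c" "\<one>\<^bsub>place_group\<^esub> = place None"
      by (simp_all add: place_group_def)
  qed (use circle_residual_exists circle_residual_sum inv_place_group circle_through_points circle_sum in blast)+
qed

end
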